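(* Let $\mathsf{R}>0$, let $\mathbb{D}\subset\mathbb{R}^2$ be the disk of radius $\mathsf{R}$ centered at the origin, let $\omega_0\in\mathbb{R}$ and $\nu>0$ be arbitrary. Let $u_0\in L^2(\mathbb{D};\mathbb{R}^2)$ be divergence-free in the sense of distributions, and let $u$ be the unique Leray–Hopf weak solution, with initial datum $u_0$, of the Navier–Stokes equations $$\partial_t u+u\cdot\nabla u=-\nabla p+\nu\Delta u,\qquad \nabla\cdot u=0\quad\text{in }\mathbb{D},$$ $$u\cdot\hat n=0,\qquad u\cdot\hat\tau=f:=\tfrac12\omega_0\mathsf{R}\quad\text{on }\partial\mathbb{D}.$$ Then $u(t)$ converges as $t\to\infty$ to the solid body rotation $u_{\mathsf{sb}}(x)=\tfrac12\omega_0x^\perp$, which has vorticity $\omega_0$. In fact, for all $t\ge 0$, $$\|u(t)-u_{\mathsf{sb}}\|_{L^2(\mathbb{D})}\le\|u_0-u_{\mathsf{sb}}\|_{L^2(\mathbb{D})}\,e^{-\lambda_1\nu t},$$ where $\lambda_1$ is the first positive eigenvalue of $-\Delta$ with Dirichlet boundary conditions on $\mathbb{D}$.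
   Context: Here $x^\perp=(-x_2,x_1)$, $\hat n$ is the outer unit normal on $\partial\mathbb{D}$ and $\hat\tau=\hat n^\perp$ is the unit tangent. The vorticity of $u$ is $\partial_1u_2-\partial_2u_1$. A Leray–Hopf weak solution is a $u$ such that $v=u-u_{\mathsf{sb}}$ belongs to $L^\infty_{\rm loc}([0,\infty);L^2)\cap L^2_{\rm loc}([0,\infty);H^1_0)$, is divergence-free, satisfies the weak formulation of the equation for $v$ (tested against divergence-free compactly supported vector fields, with initial datum $u_0-u_{\mathsf{sb}}$), and satisfies the energy inequality for $v$; in two dimensions such a solution exists and is unique. *)

theory Defs
  imports "HOL-Analysis.Analysis"
begin

section \<open>Differential operators and test functions in the plane\<close>

definition partial :: "2 \<Rightarrow> (real^2 \<Rightarrow> 'b::real_normed_vector) \<Rightarrow> real^2 \<Rightarrow> 'b" where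
  "partial i f x = frechet_derivative f (at x) (axis i 1)"

text \<open>For scalar \<open>f\<close> this is the gradient; for a vector field, \<open>grad f x $ i $ j\<close> is the
  derivative of the \<open>j\<close>-th component in direction \<open>i\<close>, and the norm and inner product of
  the type are the Frobenius ones.\<close>

definition grad :: "(real^2 \<Rightarrow> 'b::real_normed_vector) \<Rightarrow> real^2 \<Rightarrow> 'b^2" where
  "grad f x = (\<chi> i. partial i f x)"

definition divergence :: "(real^2 \<Rightarrow> real^2) \<Rightarrow> real^2 \<Rightarrow> real" where
  "divergence f x = (\<Sum>i\<in>UNIV. partial i f x $ i)"

definition vorticity :: "(real^2 \<Rightarrow> real^2) \<Rightarrow> real^2 \<Rightarrow> real" where
  "vorticity f x = partial 1 f x $ 2 - partial 2 f x $ 1"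

primrec Ck :: "nat \<Rightarrow> (real^2 \<Rightarrow> 'b::real_normed_vector) \<Rightarrow> bool" where
  "Ck 0 f \<longleftrightarrow> continuous_on UNIV f"
| "Ck (Suc k) f \<longleftrightarrow> (\<forall>x. f differentiable (at x)) \<and> (\<forall>i. Ck k (partial i f))"

definition test_function :: "(real^2) set \<Rightarrow> (real^2 \<Rightarrow> 'b::real_normed_vector) \<Rightarrow> bool" where
  "test_function S \<phi> \<longleftrightarrow> (\<forall>k. Ck k \<phi>) \<and>
     compact (closure {x. \<phi> x \<noteq> 0}) \<and> closure {x. \<phi> x \<noteq> 0} \<subseteq> S"

section \<open>Function spaces\<close>

definition in_L2 :: "(real^2) set \<Rightarrow> (real^2 \<Rightarrow> 'b::euclidean_space) \<Rightarrow> bool" where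
  "in_L2 S f \<longleftrightarrow> f \<in> borel_measurable (lebesgue_on S) \<and>
     integrable (lebesgue_on S) (\<lambda>x. (norm (f x))\<^sup>2)"

definition L2_norm_on :: "(real^2) set \<Rightarrow> (real^2 \<Rightarrow> 'b::euclidean_space) \<Rightarrow> real" where
  "L2_norm_on S f = sqrt (\<integral>x. (norm (f x))\<^sup>2 \<partial>lebesgue_on S)"

text \<open>\<open>H10_with_grad S f g\<close>: \<open>f\<close> lies in \<open>H\<^sup>1\<^sub>0(S)\<close>, the closure of the test functions in
  \<open>H\<^sup>1\<close>, and \<open>g\<close> is its weak gradient. The \<open>L\<^sup>2\<close> limit \<open>g\<close> of the gradients is the
  weak gradient of \<open>f\<close>, hence is determined by \<open>f\<close> almost everywhere.\<close>

definition H10_with_grad ::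
    "(real^2) set \<Rightarrow> (real^2 \<Rightarrow> 'b::euclidean_space) \<Rightarrow> (real^2 \<Rightarrow> 'b^2) \<Rightarrow> bool" where
  "H10_with_grad S f g \<longleftrightarrow> in_L2 S f \<and> in_L2 S g \<and>
     (\<exists>\<phi> :: nat \<Rightarrow> real^2 \<Rightarrow> 'b. (\<forall>n. test_function S (\<phi> n)) \<and>
        (\<lambda>n. L2_norm_on S (\<lambda>x. \<phi> n x - f x)) \<longlonglongrightarrow> 0 \<and>
        (\<lambda>n. L2_norm_on S (\<lambda>x. grad (\<phi> n) x - g x)) \<longlonglongrightarrow> 0)"

definition div_free_distr :: "(real^2) set \<Rightarrow> (real^2 \<Rightarrow> real^2) \<Rightarrow> bool" where
  "div_free_distr S f \<longleftrightarrow>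
     (\<forall>q :: real^2 \<Rightarrow> real. test_function S q \<longrightarrow>
        (\<integral>x. f x \<bullet> grad q x \<partial>lebesgue_on S) = 0)"

section \<open>The Dirichlet Laplacian\<close>

text \<open>\<open>\<mu>\<close> is an eigenvalue of \<open>- \<Delta>\<close>: there is a nonzero \<open>w\<close> in \<open>H\<^sup>1\<^sub>0(S)\<close> with
  \<open>- \<Delta> w = \<mu> w\<close> weakly.\<close>

definition dirichlet_eigenvalue :: "(real^2) set \<Rightarrow> real \<Rightarrow> bool" where
  "dirichlet_eigenvalue S \<mu> \<longleftrightarrow>
     (\<exists>(w :: real^2 \<Rightarrow> real) g. H10_with_grad S w g \<and>
        \<not> (AE x in lebesgue_on S. w x = 0) \<and>
        (\<forall>\<phi>. test_function S \<phi> \<longrightarrow>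
           (\<integral>x. g x \<bullet> grad \<phi> x \<partial>lebesgue_on S) = \<mu> * (\<integral>x. w x * \<phi> x \<partial>lebesgue_on S)))"

definition first_dirichlet_eigenvalue :: "(real^2) set \<Rightarrow> real" where
  "first_dirichlet_eigenvalue S = (LEAST \<mu>. 0 < \<mu> \<and> dirichlet_eigenvalue S \<mu>)"

section \<open>Solid body rotation and Leray--Hopf solutions\<close>

definition perp :: "real^2 \<Rightarrow> real^2" where
  "perp x = vector [- (x $ 2), x $ 1]"

definition solid_body :: "real \<Rightarrow> real^2 \<Rightarrow> real^2" where
  "solid_body \<omega>\<^sub>0 x = (\<omega>\<^sub>0 / 2) *\<^sub>R perp x"

text \<open>On the circle of radius \<open>R\<close>, where the outer normal is \<open>x / R\<close>, the solid body rotation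
  has the boundary values \<open>u \<cdot> n = 0\<close> and \<open>u \<cdot> \<tau> = \<omega>\<^sub>0 R / 2\<close>. These are the boundary
  conditions encoded below by requiring \<open>u - u\<^sub>s\<^sub>b\<close> to lie in \<open>H\<^sup>1\<^sub>0\<close>.\<close>

lemma solid_body_boundary:
  assumes "0 < R" and "norm x = R"
  shows "solid_body \<omega>\<^sub>0 x \<bullet> (x /\<^sub>R R) = 0"
    and "solid_body \<omega>\<^sub>0 x \<bullet> perp (x /\<^sub>R R) = \<omega>\<^sub>0 * R / 2"
proof -
  have "x \<bullet> x = R\<^sup>2"
    using assms(2) by (simp add: dot_square_norm)
  then have *: "x $ 1 * x $ 1 + x $ 2 * x $ 2 = R * R"
    by (simp add: inner_vec_def sum_2 power2_eq_square)
  show "solid_body \<omega>\<^sub>0 x \<bullet> (x /\<^sub>R R) = 0"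
    by (simp add: solid_body_def perp_def inner_vec_def sum_2)
  have "solid_body \<omega>\<^sub>0 x \<bullet> perp (x /\<^sub>R R) = \<omega>\<^sub>0 / 2 / R * (x $ 1 * x $ 1 + x $ 2 * x $ 2)"
    by (simp add: solid_body_def perp_def inner_vec_def sum_2 field_simps add_divide_distrib)
  then show "solid_body \<omega>\<^sub>0 x \<bullet> perp (x /\<^sub>R R) = \<omega>\<^sub>0 * R / 2"
    using assms(1) by (simp add: *)
qed

definition tensor :: "real^2 \<Rightarrow> real^2 \<Rightarrow> real^2^2" where
  "tensor a b = (\<chi> i j. a $ i * b $ j)"

text \<open>Leray--Hopf weak solutions on the disk, in terms of \<open>v = u - u\<^sub>s\<^sub>b\<close>, with \<open>G\<close> the weak
  gradient of \<open>v\<close>.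

  A solution is an equivalence class in \<open>L\<^sup>\<infinity>\<^sub>l\<^sub>o\<^sub>c([0,\<infty>); L\<^sup>2)\<close>. To speak about \<open>u(t)\<close>
  for every \<open>t\<close>, we fix its weakly continuous representative, which always exists.

  Since \<open>u\<^sub>s\<^sub>b\<close> is steady and harmonic, the equation for \<open>v\<close> reads
  \<open>\<partial>\<^sub>t v + div (u \<otimes> u) = - \<nabla>p + \<nu> \<Delta> v\<close> with \<open>u = v + u\<^sub>s\<^sub>b\<close>; its weak form is integrated
  over \<open>[0, t]\<close>. The initial datum enters only through the weak form (and the energy
  inequality): \<open>v(0) = v\<^sub>0\<close> is not required, as it would force \<open>u\<^sub>0 \<cdot> n = 0\<close>.\<close>

definition leray_hopf_solution ::
    "real \<Rightarrow> real \<Rightarrow> real \<Rightarrow> (real^2 \<Rightarrow> real^2) \<Rightarrow> (real \<Rightarrow> real^2 \<Rightarrow> real^2) \<Rightarrow> bool" where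
  "leray_hopf_solution R \<omega>\<^sub>0 \<nu> u\<^sub>0 u \<longleftrightarrow>
    (let D = ball 0 R;
         v = (\<lambda>t x. u t x - solid_body \<omega>\<^sub>0 x);
         v\<^sub>0 = (\<lambda>x. u\<^sub>0 x - solid_body \<omega>\<^sub>0 x)
     in
       (\<lambda>(t, x). v t x) \<in> borel_measurable (lebesgue_on ({0..} \<times> D)) \<and>
       (\<forall>t\<ge>0. in_L2 D (v t)) \<and>
       (\<forall>T>0. \<exists>C. AE t in lebesgue_on {0..T}. L2_norm_on D (v t) \<le> C) \<and>
       (\<forall>g. in_L2 D g \<longrightarrow> continuous_on {0..} (\<lambda>t. \<integral>x. v t x \<bullet> g x \<partial>lebesgue_on D)) \<and>
       (\<forall>t\<ge>0. div_free_distr D (v t)) \<and>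
       (\<exists>G :: real \<Rightarrow> real^2 \<Rightarrow> real^2^2.
          (\<lambda>(t, x). G t x) \<in> borel_measurable (lebesgue_on ({0..} \<times> D)) \<and>
          (AE t in lebesgue_on {0..}. H10_with_grad D (v t) (G t)) \<and>
          (\<forall>T>0. integrable (lebesgue_on {0..T}) (\<lambda>t. (L2_norm_on D (G t))\<^sup>2)) \<and>
          (\<forall>\<phi>. test_function D \<phi> \<longrightarrow> (\<forall>x. divergence \<phi> x = 0) \<longrightarrow>
             (\<forall>t\<ge>0. (\<integral>x. v t x \<bullet> \<phi> x \<partial>lebesgue_on D) =
                (\<integral>x. v\<^sub>0 x \<bullet> \<phi> x \<partial>lebesgue_on D) +
                (\<integral>s. (\<integral>x. tensor (u s x) (u s x) \<bullet> grad \<phi> x - \<nu> * (G s x \<bullet> grad \<phi> x)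
                        \<partial>lebesgue_on D) \<partial>lebesgue_on {0..t}))) \<and>
          (\<forall>t\<ge>0. (L2_norm_on D (v t))\<^sup>2 / 2
                  + \<nu> * (\<integral>s. (L2_norm_on D (G s))\<^sup>2 \<partial>lebesgue_on {0..t})
                \<le> (L2_norm_on D v\<^sub>0)\<^sup>2 / 2)))"

end

theory Submission
  imports Defs "HOL-Real_Asymp.Real_Asymp"
begin

text \<open>Put \<open>v = u - u\<^sub>s\<^sub>b\<close>. The convection term vanishes when tested with \<open>v\<close> itself: \<open>v\<close> is
  solenoidal and the gradient of \<open>u\<^sub>s\<^sub>b\<close> is antisymmetric. So the energy balance
  \<open>\<bar>v(t)\<bar>\<^sup>2 + 2 \<nu> \<integral>\<^sub>s\<^sup>t \<bar>\<nabla>v\<bar>\<^sup>2 \<le> \<bar>v(s)\<bar>\<^sup>2\<close> and Poincare's inequality with the sharp constant \<open>\<lambda>\<^sub>1\<close> give the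
  exponential decay.

  The energy inequality in the definition of a solution starts at time \<open>0\<close> only, and this alone does not
  imply decay; for \<open>s > 0\<close> the inequality is derived from the weak formulation. In two dimensions
  Ladyzhenskaya's inequality puts \<open>u \<otimes> u\<close> into \<open>L\<^sup>2\<close> in space and time, so that \<open>v(\<tau>)\<close>, a limit of
  solenoidal test functions, is admissible as a test function for almost every \<open>\<tau>\<close>; averaging the
  resulting bounds of \<open>\<bar>v(\<tau>)\<bar>\<^sup>2 - \<bar>v(\<tau> - h)\<bar>\<^sup>2\<close> over \<open>\<tau>\<close> and letting \<open>h\<close> tend to \<open>0\<close> yields the claim.

  The sharp Poincare inequality needs no compactness: the explicit positive radial eigenfunction
  (a Bessel function) proves it through Picone's identity, and the same inequality shows that no
  smaller eigenvalue exists.\<close>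

section \<open>Calculus of \<open>C\<^sup>k\<close> functions\<close>

text \<open>An energy inequality started at time 0 only would permit a flow that loses its energy
  early, dissipates little and regains its initial size much later; decay needs restarts at every
  time. Two obstacles shape the restart. First, testing with \<open>v(\<tau>)\<close> freezes the
  gradient at \<open>G \<tau>\<close>, whereas the dissipation at an earlier time \<open>r\<close>
  is the pairing with \<open>G r\<close>, and \<open>G\<close> has no continuity in time. Both are
  compared with a continuous field close to \<open>G\<close> in L2 of space-time, whose uniform
  continuity absorbs a short step. Second, the prescribed times \<open>s\<close> and
  \<open>t\<close> may be exceptional ones at which \<open>v\<close> is not known to lie in
  \<open>H10\<close>, and \<open>v\<close> is only weakly continuous there. Averages over short
  intervals to their right replace the values: next to \<open>t\<close> the energy is bounded below
  by a continuous function touching it, next to \<open>s\<close> a crude increment bound suffices.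
  Density of solenoidal test functions rests on the disk being star-shaped: mollifying a slightly
  contracted field keeps it solenoidal and compactly supported, so that no divergence has to be
  corrected.\<close>

lemma partial_eq: "(f has_derivative f') (at x) \<Longrightarrow> partial i f x = f' (axis i 1)"
  by (simp add: partial_def frechet_derivative_at[symmetric])

lemma has_derivative_partials:
  assumes "f differentiable (at x)"
  shows "(f has_derivative (\<lambda>h. \<Sum>i\<in>UNIV. (h $ i) *\<^sub>R partial i f x)) (at x)"
proof -
  define f' where "f' = frechet_derivative f (at x)"
  have d: "(f has_derivative f') (at x)"
    using assms frechet_derivative_works f'_def by blast
  then interpret bounded_linear f' by (rule has_derivative_bounded_linear)
  have "f' h = (\<Sum>i\<in>UNIV. (h $ i) *\<^sub>R partial i f x)" for h
  proof -
    have "f' h = f' (\<Sum>i\<in>UNIV. (h $ i) *\<^sub>R axis i 1)"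
      using basis_expansion[of h] by (simp add: scalar_mult_eq_scaleR)
    also have "\<dots> = (\<Sum>i\<in>UNIV. (h $ i) *\<^sub>R partial i f x)"
      by (simp add: sum scaleR partial_eq[OF d])
    finally show ?thesis .
  qed
  then show ?thesis using d by (metis (no_types, lifting) ext)
qed

lemma Ck_continuous: "Ck k f \<Longrightarrow> continuous_on UNIV f"
  by (cases k) (auto simp: continuous_on_eq_continuous_at differentiable_imp_continuous_within)

lemma Ck_SucD: "Ck (Suc k) f \<Longrightarrow> Ck k f"
proof (induction k arbitrary: f)
  case 0 then show ?case using Ck_continuous Ck.simps(1) by blast
next
  case (Suc k) then show ?case by (metis Ck.simps(2))
qed

lemma Ck_const: "Ck k (\<lambda>x. c)"
proof (induction k arbitrary: c)
  case (Suc k)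
  have "partial i (\<lambda>x. c) = (\<lambda>x. 0)" for i
    by (rule ext) (simp add: partial_eq[OF has_derivative_const])
  then show ?case using Suc by simp
qed simp

lemma partial_add:
  assumes "f differentiable (at x)" "g differentiable (at x)"
  shows "partial i (\<lambda>x. f x + g x) x = partial i f x + partial i g x"
  using partial_eq[OF has_derivative_add[OF assms[THEN frechet_derivative_works[THEN iffD1]]], of i]
  by (simp add: partial_def)

lemma partial_bilinear:
  assumes "bounded_bilinear b" "f differentiable (at x)" "g differentiable (at x)"
  shows "partial i (\<lambda>x. b (f x) (g x)) x = b (f x) (partial i g x) + b (partial i f x) (g x)"
  using partial_eq[OF bounded_bilinear.FDERIV[OF assms(1) assms(2,3)[THEN frechet_derivative_works[THEN iffD1]]], of i]
  by (simp add: partial_def)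

lemma partial_linear:
  assumes "bounded_linear b" "f differentiable (at x)"
  shows "partial i (\<lambda>x. b (f x)) x = b (partial i f x)"
  using partial_eq[OF bounded_linear.has_derivative[OF assms(1) assms(2)[THEN frechet_derivative_works[THEN iffD1]]], of i]
  by (simp add: partial_def)

lemma partial_real_compose:
  assumes "(F has_real_derivative F') (at (f x))" "f differentiable (at x)"
  shows "partial i (\<lambda>x. F (f x)) x = F' * partial i f x"
  using partial_eq[OF has_derivative_compose[OF assms(2)[THEN frechet_derivative_works[THEN iffD1]] assms(1)[unfolded has_field_derivative_def]], of i]
  by (simp add: partial_def)

lemma differentiable_bilinear:
  assumes "bounded_bilinear b" "f differentiable (at x)" "g differentiable (at x)"
  shows "(\<lambda>x. b (f x) (g x)) differentiable (at x)"
  using assms bounded_bilinear.FDERIV unfolding differentiable_def by blast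

lemma differentiable_linear:
  assumes "bounded_linear b" "f differentiable (at x)"
  shows "(\<lambda>x. b (f x)) differentiable (at x)"
  using assms bounded_linear.has_derivative unfolding differentiable_def by blast

lemma differentiable_real_compose:
  assumes "(F has_real_derivative F') (at (f x))" "f differentiable (at x)"
  shows "(\<lambda>x. F (f x)) differentiable (at x)"
  using has_derivative_compose assms unfolding differentiable_def has_field_derivative_def by blast

lemma Ck_add: "Ck k f \<Longrightarrow> Ck k g \<Longrightarrow> Ck k (\<lambda>x. f x + g x)"
proof (induction k arbitrary: f g)
  case (Suc k)
  have "partial i (\<lambda>x. f x + g x) = (\<lambda>x. partial i f x + partial i g x)" for i
    using Suc by (intro ext partial_add) auto
  then show ?case using Suc by auto
qed (auto intro: continuous_intros)

lemma Ck_bilinear: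
  assumes b: "bounded_bilinear b"
  shows "Ck k f \<Longrightarrow> Ck k g \<Longrightarrow> Ck k (\<lambda>x. b (f x) (g x))"
proof (induction k arbitrary: f g)
  case 0 then show ?case using bounded_bilinear.continuous_on[OF b] by auto
next
  case (Suc k)
  have "partial i (\<lambda>x. b (f x) (g x)) = (\<lambda>x. b (f x) (partial i g x) + b (partial i f x) (g x))" for i
    using Suc by (intro ext partial_bilinear[OF b]) auto
  moreover have "Ck k f" "Ck k g" using Suc Ck_SucD by blast+
  ultimately show ?case using Suc by (auto intro!: Ck_add differentiable_bilinear[OF b])
qed

lemma Ck_linear:
  assumes b: "bounded_linear b"
  shows "Ck k f \<Longrightarrow> Ck k (\<lambda>x. b (f x))"
proof (induction k arbitrary: f)
  case 0 then show ?case using bounded_linear.continuous_on[OF b] by auto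
next
  case (Suc k)
  have "partial i (\<lambda>x. b (f x)) = (\<lambda>x. b (partial i f x))" for i
    using Suc by (intro ext partial_linear[OF b]) auto
  then show ?case using Suc by (auto intro!: differentiable_linear[OF b])
qed

lemma Ck_bounded_linear:
  assumes b: "bounded_linear b"
  shows "Ck k b"
proof (cases k)
  case 0 then show ?thesis using linear_continuous_on[OF b] by simp
next
  case (Suc k)
  have "partial i b = (\<lambda>x. b (axis i 1))" for i
    by (intro ext partial_eq bounded_linear_imp_has_derivative b)
  then show ?thesis unfolding Suc
    using bounded_linear_imp_differentiable[OF b] by (auto simp: Ck_const)
qed

text \<open>\<open>Ck\<close> speaks of functions on the plane only, so smoothness of the outer
  function is given by the sequence of its successive derivatives. The induction varies
  \<open>n\<close>, because differentiating \<open>F n (f x)\<close> leads to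
  \<open>F (Suc n)\<close>.\<close>

lemma Ck_real_compose:
  assumes F: "\<And>n x. (F n has_real_derivative F (Suc n) x) (at x)"
  shows "Ck k f \<Longrightarrow> Ck k (\<lambda>x. F n (f x))"
proof (induction k arbitrary: f n)
  case 0
  have "continuous_on UNIV (F n)" using F DERIV_continuous_on by blast
  then show ?case using 0 continuous_on_compose2[of UNIV "F n" UNIV f] by auto
next
  case (Suc k)
  have "partial i (\<lambda>x. F n (f x)) = (\<lambda>x. F (Suc n) (f x) * partial i f x)" for i
    using Suc by (intro ext partial_real_compose[OF F]) auto
  moreover have "Ck k (\<lambda>x. F (Suc n) (f x) * partial i f x)" for i
    using Suc Ck_SucD by (intro Ck_bilinear[OF bounded_bilinear_mult]) auto
  ultimately show ?case using Suc by (auto intro!: differentiable_real_compose[OF F])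
qed

definition smooth :: "(real^2 \<Rightarrow> 'b::real_normed_vector) \<Rightarrow> bool" where
  "smooth f \<longleftrightarrow> (\<forall>k. Ck k f)"

lemma smooth_differentiable: "smooth f \<Longrightarrow> f differentiable (at x)"
  unfolding smooth_def by (metis Ck.simps(2))

lemma smooth_partial: "smooth f \<Longrightarrow> smooth (partial i f)"
  unfolding smooth_def by (metis Ck.simps(2))

lemma smooth_continuous: "smooth f \<Longrightarrow> continuous_on S f"
  unfolding smooth_def using Ck.simps(1) continuous_on_subset by blast

lemma smooth_const: "smooth (\<lambda>x. c)" by (simp add: smooth_def Ck_const)

lemma smooth_add: "smooth f \<Longrightarrow> smooth g \<Longrightarrow> smooth (\<lambda>x. f x + g x)"
  by (simp add: smooth_def Ck_add)

lemma smooth_bilinear: "bounded_bilinear b \<Longrightarrow> smooth f \<Longrightarrow> smooth g \<Longrightarrow> smooth (\<lambda>x. b (f x) (g x))"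
  by (simp add: smooth_def Ck_bilinear)

lemmas smooth_mult = smooth_bilinear[OF bounded_bilinear_mult]
lemmas smooth_scaleR = smooth_bilinear[OF bounded_bilinear_scaleR]
lemmas smooth_inner = smooth_bilinear[OF bounded_bilinear_inner]

lemma smooth_linear: "bounded_linear b \<Longrightarrow> smooth f \<Longrightarrow> smooth (\<lambda>x. b (f x))"
  by (simp add: smooth_def Ck_linear)

lemma smooth_bounded_linear: "bounded_linear b \<Longrightarrow> smooth b"
  by (simp add: smooth_def Ck_bounded_linear)

lemma smooth_real_compose:
  "(\<And>n x. (F n has_real_derivative F (Suc n) x) (at x)) \<Longrightarrow> smooth f \<Longrightarrow> smooth (\<lambda>x. F n (f x))"
  by (simp add: smooth_def Ck_real_compose)

lemma smooth_diff: "smooth f \<Longrightarrow> smooth g \<Longrightarrow> smooth (\<lambda>x. f x - g x)"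
  using smooth_add[of f "\<lambda>x. - g x"] smooth_linear[OF bounded_linear_minus[OF bounded_linear_ident], of g] by simp

lemma smooth_ident: "smooth (\<lambda>x. x)"
  by (rule smooth_bounded_linear[OF bounded_linear_ident])

lemma smooth_grad: "smooth f \<Longrightarrow> continuous_on S (grad f)"
  unfolding grad_def[abs_def]
  by (intro continuous_on_vec_lambda smooth_continuous smooth_partial)

lemma partial_nth: "f differentiable (at x) \<Longrightarrow> partial i (\<lambda>x. f x $ j) x = partial i f x $ j"
  by (rule partial_linear[OF bounded_linear_vec_nth])

lemma partial_diff:
  assumes "f differentiable (at x)" "g differentiable (at x)"
  shows "partial i (\<lambda>x. f x - g x) x = partial i f x - partial i g x"
  using partial_eq[OF has_derivative_diff[OF assms[THEN frechet_derivative_works[THEN iffD1]]], of i]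
  by (simp add: partial_def)

lemma grad_diff:
  assumes "f differentiable (at x)" "g differentiable (at x)"
  shows "grad (\<lambda>x. f x - g x) x = grad f x - grad g x"
  by (simp add: grad_def vec_eq_iff partial_diff[OF assms])

lemma partial_zero_outside:
  assumes "closed K" "\<And>y. y \<notin> K \<Longrightarrow> f y = 0" "x \<notin> K"
  shows "partial i f x = 0"
proof -
  have "(f has_derivative (\<lambda>h. 0)) (at x)"
    by (rule has_derivative_transform_within_open[of "\<lambda>x. 0" _ _ _ "- K"])
       (use assms in \<open>auto intro: open_Compl\<close>)
  then show ?thesis by (simp add: partial_eq)
qed

lemma test_functionI:
  assumes "smooth \<phi>" "compact K" "K \<subseteq> S" "\<And>x. x \<notin> K \<Longrightarrow> \<phi> x = 0"
  shows "test_function S \<phi>"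
proof -
  have "closure {x. \<phi> x \<noteq> 0} \<subseteq> K"
    using assms by (intro closure_minimal compact_imp_closed) auto
  then show ?thesis
    using assms unfolding test_function_def smooth_def
    by (metis compact_closure bounded_subset compact_imp_bounded closure_closure dual_order.trans)
qed

lemma test_functionE:
  assumes "test_function S \<phi>"
  obtains K where "compact K" "K \<subseteq> S" "\<And>x. x \<notin> K \<Longrightarrow> \<phi> x = 0"
  using assms closure_subset[of "{x. \<phi> x \<noteq> 0}"] unfolding test_function_def by blast

lemma test_function_smooth: "test_function S \<phi> \<Longrightarrow> smooth \<phi>"
  by (simp add: test_function_def smooth_def)

lemma test_function_zero: "test_function S \<phi> \<Longrightarrow> x \<notin> S \<Longrightarrow> \<phi> x = 0"
  by (metis test_functionE subsetD)

lemma test_function_partial: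
  assumes "test_function S \<phi>" shows "test_function S (partial i \<phi>)"
proof -
  obtain K where K: "compact K" "K \<subseteq> S" "\<And>x. x \<notin> K \<Longrightarrow> \<phi> x = 0"
    using test_functionE[OF assms] by metis
  show ?thesis
    by (rule test_functionI[OF _ K(1,2)])
      (use assms K in \<open>auto intro!: smooth_partial intro: test_function_smooth partial_zero_outside compact_imp_closed\<close>)
qed

lemma compact_support_bounded:
  assumes "continuous_on UNIV f" "compact K" "\<And>x. x \<notin> K \<Longrightarrow> f x = (0::'b::real_normed_vector)"
  obtains B where "B > 0" "\<And>x. norm (f x) \<le> B"
proof -
  have "bounded (f ` K)"
    using assms continuous_on_subset by (intro compact_imp_bounded compact_continuous_image) blast+
  then obtain B where "B > 0" "\<And>x. x \<in> K \<Longrightarrow> norm (f x) \<le> B"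
    by (auto simp: bounded_pos)
  then show ?thesis using that assms(3) by (metis less_imp_le norm_zero)
qed

lemma test_function_bounded:
  assumes "test_function S \<phi>"
  obtains B where "B > 0" "\<And>x. norm (\<phi> x) \<le> B"
  using compact_support_bounded[of \<phi>] test_functionE[OF assms] smooth_continuous[OF test_function_smooth[OF assms]]
  by metis

lemma test_function_diff:
  assumes "test_function S \<phi>" "test_function S \<psi>"
  shows "test_function S (\<lambda>x. \<phi> x - \<psi> x)"
proof -
  obtain K L where "compact K" "K \<subseteq> S" "\<And>x. x \<notin> K \<Longrightarrow> \<phi> x = 0" "compact L" "L \<subseteq> S" "\<And>x. x \<notin> L \<Longrightarrow> \<psi> x = 0"
    using test_functionE[OF assms(1)] test_functionE[OF assms(2)] by metis
  then show ?thesis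
    by (intro test_functionI[of _ "K \<union> L"] smooth_diff assms[THEN test_function_smooth]) auto
qed

section \<open>Integration by parts\<close>

lemma partial_line_derivative:
  fixes f :: "real^2 \<Rightarrow> real"
  assumes "\<And>x. f differentiable (at x)"
  shows "((\<lambda>s. f (x + s *\<^sub>R axis i 1)) has_real_derivative partial i f (x + s *\<^sub>R axis i 1)) (at s)"
proof -
  let ?g = "frechet_derivative f (at (x + s *\<^sub>R axis i 1))"
  have d: "(f has_derivative ?g) (at (x + s *\<^sub>R axis i 1))"
    using assms frechet_derivative_works by blast
  have l: "((\<lambda>s. x + s *\<^sub>R axis i 1) has_derivative (\<lambda>h. h *\<^sub>R axis i (1::real))) (at s)"
    by (auto intro!: derivative_eq_intros)
  have "((\<lambda>s. f (x + s *\<^sub>R axis i 1)) has_derivative (\<lambda>h. ?g (h *\<^sub>R axis i 1))) (at s)"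
    by (rule has_derivative_compose[OF l d])
  moreover have "?g (h *\<^sub>R axis i 1) = partial i f (x + s *\<^sub>R axis i 1) * h" for h
    using linear_frechet_derivative[OF assms] by (simp add: partial_def linear_cmul)
  ultimately show ?thesis by (simp add: has_field_derivative_def)
qed

lemma continuous_compact_support_integrable:
  fixes f :: "real^2 \<Rightarrow> 'b::euclidean_space"
  assumes "continuous_on UNIV f" "\<And>x. norm x > r \<Longrightarrow> f x = 0"
  shows "integrable lborel f"
proof -
  have "set_integrable lborel (cball 0 r) f"
    unfolding set_integrable_def by (intro borel_integrable_compact compact_cball continuous_on_subset[OF assms(1)]) simp
  moreover have "(\<lambda>x. indicator (cball 0 r) x *\<^sub>R f x) = f"
    using assms(2) by (force simp: indicator_def)
  ultimately show ?thesis by (simp add: set_integrable_def)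
qed

text \<open>Translation invariance makes the integral of every difference quotient of
  \<open>f\<close> vanish. By the mean value theorem the quotients are values of
  \<open>partial i f\<close>, hence uniformly bounded and supported in one ball, and dominated
  convergence gives the claim without iterated integrals.\<close>

lemma integral_partial_zero:
  fixes f :: "real^2 \<Rightarrow> real"
  assumes d: "\<And>x. f differentiable (at x)" and c: "continuous_on UNIV (partial i f)"
    and z: "\<And>x. norm x > r \<Longrightarrow> f x = 0"
  shows "(\<integral>x. partial i f x \<partial>lborel) = 0"
proof -
  have cf: "continuous_on UNIV f"
    using d by (simp add: continuous_on_eq_continuous_at differentiable_imp_continuous_within)
  have pz: "partial i f x = 0" if "norm x > r" for x
    by (rule partial_zero_outside[of "cball 0 r"]) (use z that in auto)
  obtain B where B: "B > 0" "\<And>x. norm (partial i f x) \<le> B"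
    by (rule compact_support_bounded[OF c, of "cball 0 r"]) (use pz in auto)
  define q where "q n x = (f (x + (1 / real (Suc n)) *\<^sub>R axis i 1) - f x) / (1 / real (Suc n))" for n x
  have fi: "integrable lborel f"
    by (rule continuous_compact_support_integrable[OF cf z])
  have fin: "has_bochner_integral lborel (\<lambda>x. f (x + c)) (\<integral>x. f x \<partial>lborel)" for c
  proof -
    have "has_bochner_integral (distr lborel borel ((+) c)) f (\<integral>x. f x \<partial>lborel)"
      by (metis fi lborel_distr_plus has_bochner_integral_integrable)
    then show ?thesis
      using borel_measurable_continuous_onI[OF cf]
      by (simp add: has_bochner_integral_iff integrable_distr_eq integral_distr add.commute)
  qed
  have q0: "(\<integral>x. q n x \<partial>lborel) = 0" for n
    unfolding q_def using fin[of "(1 / real (Suc n)) *\<^sub>R axis i 1"] fi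
    by (simp add: has_bochner_integral_iff)
  \<comment> \<open>The step lengths \<open>1 / Suc n\<close> are at most 1, which explains the
    enlarged radius; the absolute value covers negative \<open>r\<close>.\<close>
  have qb: "norm (q n x) \<le> B * indicator (cball 0 (\<bar>r\<bar> + 1)) x" for n x
  proof -
    have "\<exists>\<xi>. 0 < \<xi> \<and> \<xi> < 1 / real (Suc n) \<and> f (x + (1 / real (Suc n)) *\<^sub>R axis i 1) - f (x + 0 *\<^sub>R axis i 1)
        = (1 / real (Suc n) - 0) * partial i f (x + \<xi> *\<^sub>R axis i 1)"
      by (rule MVT2) (auto intro: partial_line_derivative d)
    then obtain \<xi> where xi: "0 < \<xi>" "\<xi> < 1 / real (Suc n)" "q n x = partial i f (x + \<xi> *\<^sub>R axis i 1)"
      unfolding q_def by auto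
    have "\<xi> < 1" using xi(2) by (smt (verit) divide_le_eq_1 of_nat_Suc of_nat_0_le_iff)
    then have "norm (\<xi> *\<^sub>R (axis i 1 :: real^2)) \<le> 1" using xi(1) by (simp add: norm_axis_1)
    then have "norm x > \<bar>r\<bar> + 1 \<Longrightarrow> norm (x + \<xi> *\<^sub>R axis i 1) > r"
      using norm_triangle_ineq4[of "x + \<xi> *\<^sub>R axis i 1" "\<xi> *\<^sub>R axis i 1"] by simp
    then show ?thesis using xi(3) B pz by (auto simp: indicator_def)
  qed
  have "(\<lambda>n. \<integral>x. q n x \<partial>lborel) \<longlonglongrightarrow> (\<integral>x. partial i f x \<partial>lborel)"
  proof (rule integral_dominated_convergence)
    show "integrable lborel (\<lambda>x::real^2. B * indicator (cball 0 (\<bar>r\<bar> + 1)) x)"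
      by (intro integrable_mult_right integrable_real_indicator) (auto simp: emeasure_bounded_finite[simplified])
    show "partial i f \<in> borel_measurable lborel" using c by (simp add: borel_measurable_continuous_onI)
    show "q n \<in> borel_measurable lborel" for n
      unfolding q_def using borel_measurable_continuous_onI[OF cf] by simp
    show "AE x in lborel. (\<lambda>n. q n x) \<longlonglongrightarrow> partial i f x"
    proof (rule AE_I2)
      fix x :: "real^2"
      have "((\<lambda>s. (f (x + s *\<^sub>R axis i 1) - f x) / s) \<longlongrightarrow> partial i f x) (at 0)"
        using partial_line_derivative[OF d, of x i 0] by (simp add: has_field_derivative_iff)
      moreover have "filterlim (\<lambda>n. 1 / real (Suc n)) (at 0) sequentially"
        unfolding filterlim_at using LIMSEQ_inverse_real_of_nat
        by (auto simp: inverse_eq_divide)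
      ultimately show "(\<lambda>n. q n x) \<longlonglongrightarrow> partial i f x"
        unfolding q_def by (rule filterlim_compose)
    qed
    show "AE x in lborel. norm (q n x) \<le> B * indicator (cball 0 (\<bar>r\<bar> + 1)) x" for n
      using qb by simp
  qed
  moreover have "(\<lambda>n. \<integral>x. q n x \<partial>lborel) = (\<lambda>n. 0)" using q0 by simp
  ultimately show ?thesis by (simp add: LIMSEQ_const_iff)
qed

lemma integral_lebesgue_on_zero_outside:
  fixes f :: "real^2 \<Rightarrow> 'b::euclidean_space"
  assumes "f \<in> borel_measurable borel" "S \<in> sets borel" "\<And>x. x \<notin> S \<Longrightarrow> f x = 0"
  shows "(\<integral>x. f x \<partial>lebesgue_on S) = (\<integral>x. f x \<partial>lborel)"
proof -
  have "(\<integral>x. f x \<partial>lebesgue_on S) = (\<integral>x. indicator S x *\<^sub>R f x \<partial>lebesgue)"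
    using assms by (intro integral_restrict_space) auto
  also have "(\<lambda>x. indicator S x *\<^sub>R f x) = f" using assms(3) by (force simp: indicator_def)
  finally show ?thesis using assms by (simp add: integral_completion)
qed

text \<open>Each component is covered by \<open>integral_partial_zero\<close> once the integral over
  the disk is replaced by the one over the plane. For this the derivatives have to vanish on the
  circle too, where \<open>X\<close> is known to be zero on the outer side only.\<close>

lemma integral_divergence_zero:
  fixes X :: "real^2 \<Rightarrow> real^2"
  assumes d: "\<And>x. X differentiable (at x)" and c: "\<And>i. continuous_on UNIV (partial i X)"
    and z: "\<And>x. x \<notin> ball 0 R \<Longrightarrow> X x = 0"
  shows "(\<integral>x. divergence X x \<partial>lebesgue_on (ball 0 R)) = 0"
proof -
  have p: "partial i (\<lambda>x. X x $ i) = (\<lambda>x. partial i X x $ i)" for i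
    by (intro ext partial_nth d)
  have ci: "continuous_on UNIV (\<lambda>x. partial i X x $ i)" for i
    using c by (intro continuous_intros)
  have pz: "norm x > R \<Longrightarrow> partial i X x = 0" for x i
    by (rule partial_zero_outside[of "cball 0 R"]) (use z in auto)
  \<comment> \<open>A point of the circle is the limit of the points
    \<open>(1 + 1 / Suc n) x\<close>, which lie outside the closed disk, so continuity of the
    derivative applies. For \<open>R \<le> 0\<close> the disk is empty and \<open>X\<close> is
    zero.\<close>
  have pb: "partial i X x = 0" if "norm x = R" for x i
  proof (cases "R > 0")
    case True
    have "partial i X x \<in> {0}"
    proof (rule Lim_in_closed_set[of "{0}" "\<lambda>n::nat. partial i X ((1 + 1 / real (Suc n)) *\<^sub>R x)" sequentially])
      have "(\<lambda>n. (1 + 1 / real (Suc n)) *\<^sub>R x) \<longlonglongrightarrow> (1 + 0) *\<^sub>R x"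
        using LIMSEQ_inverse_real_of_nat by (intro tendsto_intros) (simp add: inverse_eq_divide)
      then show "(\<lambda>n. partial i X ((1 + 1 / real (Suc n)) *\<^sub>R x)) \<longlonglongrightarrow> partial i X x"
        using continuous_on_tendsto_compose[OF c, of _ x] by simp
      show "\<forall>\<^sub>F n in sequentially. partial i X ((1 + 1 / real (Suc n)) *\<^sub>R x) \<in> {0}"
        using that True by (intro always_eventually allI) (auto intro!: pz simp: add_pos_pos mult_less_cancel_right1)
    qed auto
    then show ?thesis by simp
  next
    case False
    then have "X = (\<lambda>x. 0)" using z by (intro ext) (smt (verit) mem_ball dist_0_norm norm_ge_zero)
    then show ?thesis by (simp add: partial_eq[OF has_derivative_const])
  qed
  have z': "x \<notin> ball 0 R \<Longrightarrow> partial i X x = 0" for x i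
    using pz[of x i] pb[of x i] by (cases "norm x = R") auto
  have "(\<integral>x. divergence X x \<partial>lebesgue_on (ball 0 R)) = (\<integral>x. divergence X x \<partial>lborel)"
    unfolding divergence_def
    by (rule integral_lebesgue_on_zero_outside)
       (use z' ci in \<open>auto intro!: borel_measurable_continuous_onI continuous_on_sum\<close>)
  also have "\<dots> = (\<Sum>i\<in>UNIV. \<integral>x. partial i X x $ i \<partial>lborel)"
    unfolding divergence_def
    by (intro Bochner_Integration.integral_sum continuous_compact_support_integrable[of _ R] ci) (use pz in auto)
  also have "\<dots> = 0"
  proof (rule sum.neutral, rule ballI)
    fix i :: 2
    have "(\<integral>x. partial i (\<lambda>x. X x $ i) x \<partial>lborel) = 0"
      by (rule integral_partial_zero[of _ _ R])
        (use d z ci in \<open>auto simp: p intro: differentiable_linear[OF bounded_linear_vec_nth]\<close>)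
    then show "(\<integral>x. partial i X x $ i \<partial>lborel) = 0" unfolding p .
  qed
  finally show ?thesis .
qed

section \<open>The space \<open>L\<^sup>2\<close>\<close>

lemma L2_norm_on_nonneg [simp]: "0 \<le> L2_norm_on S f"
  by (simp add: L2_norm_on_def)

lemma L2_norm_on_power2: "(L2_norm_on S f)\<^sup>2 = (\<integral>x. (norm (f x))\<^sup>2 \<partial>lebesgue_on S)"
  by (simp add: L2_norm_on_def)

lemma norm_add_square_le: "(norm (a + b))\<^sup>2 \<le> 2 * (norm a)\<^sup>2 + 2 * (norm (b::'a::real_normed_vector))\<^sup>2"
proof -
  have "(norm (a + b))\<^sup>2 \<le> (norm a + norm b)\<^sup>2"
    by (intro power_mono norm_triangle_ineq) simp
  also have "\<dots> \<le> 2 * (norm a)\<^sup>2 + 2 * (norm b)\<^sup>2"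
    using sum_squares_bound[of "norm a" "norm b"] by (simp add: power2_sum)
  finally show ?thesis .
qed

text \<open>Young's inequality; the weight is later either balanced between two norms or made small
  to absorb a term.\<close>

lemma abs_inner_le_weighted:
  fixes a b :: "'a::real_inner"
  assumes "\<epsilon> > 0"
  shows "\<bar>a \<bullet> b\<bar> \<le> \<epsilon> / 2 * (norm a)\<^sup>2 + 1 / (2 * \<epsilon>) * (norm b)\<^sup>2"
proof -
  have "0 \<le> (\<epsilon> * norm a - norm b)\<^sup>2 / (2 * \<epsilon>)" using assms by simp
  also have "\<dots> = \<epsilon> / 2 * (norm a)\<^sup>2 + 1 / (2 * \<epsilon>) * (norm b)\<^sup>2 - norm a * norm b"
    using assms by (simp add: field_simps power2_eq_square)
  finally show ?thesis using Cauchy_Schwarz_ineq2[of a b] by linarith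
qed

lemma in_L2_add:
  assumes "in_L2 S f" "in_L2 S g" shows "in_L2 S (\<lambda>x. f x + g x)"
proof -
  have "integrable (lebesgue_on S) (\<lambda>x. (norm (f x + g x))\<^sup>2)"
  proof (rule Bochner_Integration.integrable_bound[where f="\<lambda>x. 2 * (norm (f x))\<^sup>2 + 2 * (norm (g x))\<^sup>2"])
  show "AE x in lebesgue_on S. norm ((norm (f x + g x))\<^sup>2) \<le> norm (2 * (norm (f x))\<^sup>2 + 2 * (norm (g x))\<^sup>2)"
    by (auto intro!: AE_I2 order_trans[OF norm_add_square_le] abs_ge_self)
  qed (use assms in \<open>auto simp: in_L2_def\<close>)
  moreover have "(\<lambda>x. f x + g x) \<in> borel_measurable (lebesgue_on S)"
    using assms by (intro borel_measurable_add) (auto simp: in_L2_def)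
  ultimately show ?thesis by (simp add: in_L2_def)
qed

lemma in_L2_scaleR:
  assumes "in_L2 S f" shows "in_L2 S (\<lambda>x. c *\<^sub>R f x)"
  using assms by (auto simp: in_L2_def power_mult_distrib)

lemma in_L2_diff:
  assumes "in_L2 S f" "in_L2 S g" shows "in_L2 S (\<lambda>x. f x - g x)"
  using in_L2_add[OF assms(1) in_L2_scaleR[OF assms(2), of "-1"]] by simp

lemma in_L2_inner_integrable:
  assumes "in_L2 S f" "in_L2 S g" shows "integrable (lebesgue_on S) (\<lambda>x. f x \<bullet> g x)"
proof (rule Bochner_Integration.integrable_bound[where f="\<lambda>x. 1 / 2 * (norm (f x))\<^sup>2 + 1 / (2 * 1) * (norm (g x))\<^sup>2"])
  show "AE x in lebesgue_on S. norm (f x \<bullet> g x) \<le> norm (1 / 2 * (norm (f x))\<^sup>2 + 1 / (2 * 1) * (norm (g x))\<^sup>2)"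
    using abs_inner_le_weighted[of 1 "f _" "g _"] by (intro AE_I2) auto
qed (use assms in \<open>auto simp: in_L2_def intro!: borel_measurable_inner\<close>)

text \<open>Integrating Young's inequality with the ratio of the norms as weight gives their
  product. Adding \<open>\<epsilon>\<close> to both norms keeps the ratio positive and finite when
  one of them is zero.\<close>

lemma L2_Cauchy_Schwarz:
  assumes "in_L2 S f" "in_L2 S g"
  shows "\<bar>\<integral>x. f x \<bullet> g x \<partial>lebesgue_on S\<bar> \<le> L2_norm_on S f * L2_norm_on S g"
proof -
  let ?a = "L2_norm_on S f" and ?b = "L2_norm_on S g"
  have "\<bar>\<integral>x. f x \<bullet> g x \<partial>lebesgue_on S\<bar> \<le> (?a + \<epsilon>) * (?b + \<epsilon>)" if e: "\<epsilon> > 0" for \<epsilon>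
  proof -
    have p: "?a + \<epsilon> > 0" "?b + \<epsilon> > 0" using e by (simp_all add: add_nonneg_pos)
    define \<eta> where "\<eta> = (?b + \<epsilon>) / (?a + \<epsilon>)"
    have eta: "\<eta> > 0" using p by (simp add: \<eta>_def)
    have "\<bar>\<integral>x. f x \<bullet> g x \<partial>lebesgue_on S\<bar> \<le> (\<integral>x. \<bar>f x \<bullet> g x\<bar> \<partial>lebesgue_on S)"
      by (rule integral_abs_bound)
    also have "\<dots> \<le> (\<integral>x. \<eta> / 2 * (norm (f x))\<^sup>2 + 1 / (2 * \<eta>) * (norm (g x))\<^sup>2 \<partial>lebesgue_on S)"
      by (intro integral_mono abs_inner_le_weighted eta integrable_abs in_L2_inner_integrable assms)
         (use assms in \<open>auto simp: in_L2_def\<close>)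
    also have "\<dots> = \<eta> / 2 * ?a\<^sup>2 + 1 / (2 * \<eta>) * ?b\<^sup>2"
      using assms by (simp add: in_L2_def L2_norm_on_power2)
    also have "\<dots> \<le> \<eta> / 2 * (?a + \<epsilon>)\<^sup>2 + 1 / (2 * \<eta>) * (?b + \<epsilon>)\<^sup>2"
      using e eta by (intro add_mono mult_left_mono power_mono) auto
    also have "\<dots> = (?a + \<epsilon>) * (?b + \<epsilon>)"
    proof -
      have "b / a / 2 * a\<^sup>2 + 1 / (2 * (b / a)) * b\<^sup>2 = a * b" if "a > 0" "b > 0" for a b :: real
        using that by (simp add: field_simps power2_eq_square)
      then show ?thesis using p unfolding \<eta>_def by blast
    qed
    finally show ?thesis .
  qed
  moreover have "((\<lambda>\<epsilon>. (?a + \<epsilon>) * (?b + \<epsilon>)) \<longlongrightarrow> (?a + 0) * (?b + 0)) (at_right 0)"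
    by (intro tendsto_intros)
  ultimately show ?thesis
    by (intro tendsto_lowerbound[of _ _ "at_right 0"]) (auto simp: eventually_at_right_less eventually_at_filter)
qed

lemma L2_triangle:
  assumes "in_L2 S f" "in_L2 S g"
  shows "L2_norm_on S (\<lambda>x. f x + g x) \<le> L2_norm_on S f + L2_norm_on S g"
proof (rule power2_le_imp_le)
  have "(L2_norm_on S (\<lambda>x. f x + g x))\<^sup>2
      = (\<integral>x. (norm (f x))\<^sup>2 + 2 * (f x \<bullet> g x) + (norm (g x))\<^sup>2 \<partial>lebesgue_on S)"
    unfolding L2_norm_on_power2
    by (intro Bochner_Integration.integral_cong) (auto simp: power2_norm_eq_inner inner_add_left inner_add_right inner_commute)
  also have "\<dots> = (L2_norm_on S f)\<^sup>2 + 2 * (\<integral>x. f x \<bullet> g x \<partial>lebesgue_on S) + (L2_norm_on S g)\<^sup>2"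
    using assms in_L2_inner_integrable[OF assms] by (simp add: in_L2_def L2_norm_on_power2)
  also have "\<dots> \<le> (L2_norm_on S f + L2_norm_on S g)\<^sup>2"
    using L2_Cauchy_Schwarz[OF assms] by (simp add: power2_sum)
  finally show "(L2_norm_on S (\<lambda>x. f x + g x))\<^sup>2 \<le> (L2_norm_on S f + L2_norm_on S g)\<^sup>2" .
qed simp

lemma L2_norm_on_minus: "L2_norm_on S (\<lambda>x. f x - g x) = L2_norm_on S (\<lambda>x. g x - f x)"
  by (simp add: L2_norm_on_def norm_minus_commute)

lemma L2_norm_on_scaleR: "L2_norm_on S (\<lambda>x. c *\<^sub>R f x) = \<bar>c\<bar> * L2_norm_on S f"
  by (simp add: L2_norm_on_def power_mult_distrib real_sqrt_mult)

lemma L2_triangle_diff: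
  assumes "in_L2 S f" "in_L2 S g" "in_L2 S h"
  shows "L2_norm_on S (\<lambda>x. f x - h x) \<le> L2_norm_on S (\<lambda>x. f x - g x) + L2_norm_on S (\<lambda>x. g x - h x)"
  using L2_triangle[OF in_L2_diff[OF assms(1,2)] in_L2_diff[OF assms(2,3)]] by simp

lemma L2_norm_diff_le:
  assumes "in_L2 S f" "in_L2 S g"
  shows "\<bar>L2_norm_on S f - L2_norm_on S g\<bar> \<le> L2_norm_on S (\<lambda>x. f x - g x)"
  using L2_triangle[OF in_L2_diff[OF assms] assms(2)] L2_triangle[OF in_L2_diff[OF assms(2,1)] assms(1)]
    L2_norm_on_minus[of S f g] by simp

lemma L2_tendsto_norm:
  assumes "\<And>n::nat. in_L2 S (f n)" "in_L2 S g" "(\<lambda>n. L2_norm_on S (\<lambda>x. f n x - g x)) \<longlonglongrightarrow> 0"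
  shows "(\<lambda>n. L2_norm_on S (f n)) \<longlonglongrightarrow> L2_norm_on S g"
  using L2_norm_diff_le[OF assms(1,2)]
  by (intro LIM_zero_cancel[of _ "L2_norm_on S g"] Lim_null_comparison[OF _ assms(3)]) auto

lemma L2_tendsto_inner:
  assumes "\<And>n::nat. in_L2 S (f n)" "in_L2 S g" "in_L2 S h" "(\<lambda>n. L2_norm_on S (\<lambda>x. f n x - g x)) \<longlonglongrightarrow> 0"
  shows "(\<lambda>n. \<integral>x. h x \<bullet> f n x \<partial>lebesgue_on S) \<longlonglongrightarrow> (\<integral>x. h x \<bullet> g x \<partial>lebesgue_on S)"
proof (rule LIM_zero_cancel, rule Lim_null_comparison)
  show "\<forall>\<^sub>F n in sequentially. norm ((\<integral>x. h x \<bullet> f n x \<partial>lebesgue_on S) - (\<integral>x. h x \<bullet> g x \<partial>lebesgue_on S))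
      \<le> L2_norm_on S h * L2_norm_on S (\<lambda>x. f n x - g x)"
  proof (intro always_eventually allI)
    fix n
    have "(\<integral>x. h x \<bullet> f n x \<partial>lebesgue_on S) - (\<integral>x. h x \<bullet> g x \<partial>lebesgue_on S)
        = (\<integral>x. h x \<bullet> (f n x - g x) \<partial>lebesgue_on S)"
      using assms by (simp add: inner_diff_right in_L2_inner_integrable)
    then show "norm ((\<integral>x. h x \<bullet> f n x \<partial>lebesgue_on S) - (\<integral>x. h x \<bullet> g x \<partial>lebesgue_on S))
      \<le> L2_norm_on S h * L2_norm_on S (\<lambda>x. f n x - g x)"
      using L2_Cauchy_Schwarz[OF assms(3) in_L2_diff[OF assms(1,2)]] by simp
  qed
  show "(\<lambda>n. L2_norm_on S h * L2_norm_on S (\<lambda>x. f n x - g x)) \<longlonglongrightarrow> 0"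
    using tendsto_mult_left[OF assms(4), of "L2_norm_on S h"] by simp
qed

lemma finite_measure_ball: "finite_measure (lebesgue_on (ball (0::real^2) R))"
  by (intro finite_measure_lebesgue_on lmeasurable_ball)

lemma in_L2_bounded:
  assumes "f \<in> borel_measurable (lebesgue_on (ball 0 R))" "\<And>x. x \<in> ball 0 R \<Longrightarrow> norm (f x) \<le> B"
  shows "in_L2 (ball 0 R) f"
proof -
  interpret finite_measure "lebesgue_on (ball (0::real^2) R)" by (rule finite_measure_ball)
  have "integrable (lebesgue_on (ball 0 R)) (\<lambda>x. (norm (f x))\<^sup>2)"
    by (rule integrable_const_bound[of _ "B\<^sup>2"]) (use assms in \<open>auto intro!: AE_I2 power_mono\<close>)
  then show ?thesis using assms by (simp add: in_L2_def)
qed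

lemma borel_measurable_lebesgue_on_continuous:
  fixes f :: "'a::euclidean_space \<Rightarrow> 'b::euclidean_space"
  assumes "continuous_on UNIV f"
  shows "f \<in> borel_measurable (lebesgue_on S)"
  using borel_measurable_continuous_onI[OF assms]
  by (intro measurable_restrict_space1 measurable_completion) simp

lemma in_L2_continuous:
  fixes f :: "real^2 \<Rightarrow> 'b::euclidean_space"
  assumes "continuous_on UNIV f"
  shows "in_L2 (ball 0 R) f"
proof -
  have "bounded (f ` cball 0 R)"
    by (intro compact_imp_bounded compact_continuous_image continuous_on_subset[OF assms]) auto
  then obtain B where "\<And>x. x \<in> cball 0 R \<Longrightarrow> norm (f x) \<le> B" unfolding bounded_iff by blast
  then show ?thesis by (intro in_L2_bounded[of _ _ B] borel_measurable_lebesgue_on_continuous[OF assms]) auto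
qed

lemma in_L2_smooth: "smooth f \<Longrightarrow> in_L2 (ball 0 R) f"
  by (intro in_L2_continuous smooth_continuous)

lemma in_L2_grad: "smooth f \<Longrightarrow> in_L2 (ball 0 R) (grad f)"
  by (intro in_L2_continuous smooth_grad)

section \<open>The space \<open>H\<^sup>1\<^sub>0\<close>\<close>

lemma H10_with_gradE:
  assumes "H10_with_grad (ball 0 R) f g"
  obtains \<phi> :: "nat \<Rightarrow> real^2 \<Rightarrow> 'b::euclidean_space" where "\<And>n. test_function (ball 0 R) (\<phi> n)"
    "(\<lambda>n. L2_norm_on (ball 0 R) (\<lambda>x. \<phi> n x - f x)) \<longlonglongrightarrow> 0"
    "(\<lambda>n. L2_norm_on (ball 0 R) (\<lambda>x. grad (\<phi> n) x - g x)) \<longlonglongrightarrow> 0"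
    "\<And>n. in_L2 (ball 0 R) (\<phi> n)" "\<And>n. in_L2 (ball 0 R) (grad (\<phi> n))"
    "in_L2 (ball 0 R) f" "in_L2 (ball 0 R) g"
proof -
  obtain \<phi> :: "nat \<Rightarrow> real^2 \<Rightarrow> 'b" where p: "\<And>n. test_function (ball 0 R) (\<phi> n)"
    "(\<lambda>n. L2_norm_on (ball 0 R) (\<lambda>x. \<phi> n x - f x)) \<longlonglongrightarrow> 0"
    "(\<lambda>n. L2_norm_on (ball 0 R) (\<lambda>x. grad (\<phi> n) x - g x)) \<longlonglongrightarrow> 0"
    and f: "in_L2 (ball 0 R) f" "in_L2 (ball 0 R) g"
    using assms unfolding H10_with_grad_def by blast
  show thesis
    by (rule that[OF p in_L2_smooth[OF test_function_smooth[OF p(1)]] in_L2_grad[OF test_function_smooth[OF p(1)]] f])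
qed

lemma H10_test_function:
  assumes "test_function (ball 0 R) \<phi>" shows "H10_with_grad (ball 0 R) \<phi> (grad \<phi>)"
  unfolding H10_with_grad_def using assms
  by (auto simp: L2_norm_on_def intro!: in_L2_smooth in_L2_grad test_function_smooth exI[of _ "\<lambda>n. \<phi>"])

lemma H10_diff:
  assumes "H10_with_grad (ball 0 R) f g" "H10_with_grad (ball 0 R) f' g'"
  shows "H10_with_grad (ball 0 R) (\<lambda>x. f x - f' x) (\<lambda>x. g x - g' x)"
proof -
  obtain \<phi> where p: "\<And>n::nat. test_function (ball 0 R) (\<phi> n)"
    "(\<lambda>n. L2_norm_on (ball 0 R) (\<lambda>x. \<phi> n x - f x)) \<longlonglongrightarrow> 0"
    "(\<lambda>n. L2_norm_on (ball 0 R) (\<lambda>x. grad (\<phi> n) x - g x)) \<longlonglongrightarrow> 0"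
    "\<And>n. in_L2 (ball 0 R) (\<phi> n)" "\<And>n. in_L2 (ball 0 R) (grad (\<phi> n))"
    "in_L2 (ball 0 R) f" "in_L2 (ball 0 R) g"
    by (rule H10_with_gradE[OF assms(1)]) blast
  obtain \<psi> where q: "\<And>n::nat. test_function (ball 0 R) (\<psi> n)"
    "(\<lambda>n. L2_norm_on (ball 0 R) (\<lambda>x. \<psi> n x - f' x)) \<longlonglongrightarrow> 0"
    "(\<lambda>n. L2_norm_on (ball 0 R) (\<lambda>x. grad (\<psi> n) x - g' x)) \<longlonglongrightarrow> 0"
    "\<And>n. in_L2 (ball 0 R) (\<psi> n)" "\<And>n. in_L2 (ball 0 R) (grad (\<psi> n))"
    "in_L2 (ball 0 R) f'" "in_L2 (ball 0 R) g'"
    by (rule H10_with_gradE[OF assms(2)]) blast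
  have l: "(\<lambda>n. L2_norm_on (ball 0 R) (\<lambda>x. (a n x - b n x) - (h x - k x))) \<longlonglongrightarrow> 0"
    if "\<And>n::nat. in_L2 (ball 0 R) (a n)" "\<And>n. in_L2 (ball 0 R) (b n)" "in_L2 (ball 0 R) h" "in_L2 (ball 0 R) k"
      "(\<lambda>n. L2_norm_on (ball 0 R) (\<lambda>x. a n x - h x)) \<longlonglongrightarrow> 0" "(\<lambda>n. L2_norm_on (ball 0 R) (\<lambda>x. b n x - k x)) \<longlonglongrightarrow> 0"
    for a b :: "nat \<Rightarrow> real^2 \<Rightarrow> 'z::euclidean_space" and h k
  proof (rule Lim_null_comparison[OF always_eventually])
    show "\<forall>n. norm (L2_norm_on (ball 0 R) (\<lambda>x. (a n x - b n x) - (h x - k x)))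
       \<le> L2_norm_on (ball 0 R) (\<lambda>x. a n x - h x) + L2_norm_on (ball 0 R) (\<lambda>x. b n x - k x)"
    proof
      fix n
      have "(\<lambda>x. (a n x - b n x) - (h x - k x)) = (\<lambda>x. (a n x - h x) + (k x - b n x))" by (auto simp: algebra_simps)
      then show "norm (L2_norm_on (ball 0 R) (\<lambda>x. (a n x - b n x) - (h x - k x)))
       \<le> L2_norm_on (ball 0 R) (\<lambda>x. a n x - h x) + L2_norm_on (ball 0 R) (\<lambda>x. b n x - k x)"
        using L2_triangle[OF in_L2_diff[OF that(1,3), of n] in_L2_diff[OF that(4,2), of n]] L2_norm_on_minus[of _ k "b n"]
        by (simp del: diff_add_eq)
    qed
    show "(\<lambda>n. L2_norm_on (ball 0 R) (\<lambda>x. a n x - h x) + L2_norm_on (ball 0 R) (\<lambda>x. b n x - k x)) \<longlonglongrightarrow> 0"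
      using tendsto_add[OF that(5,6)] by simp
  qed
  have g: "grad (\<lambda>x. \<phi> n x - \<psi> n x) = (\<lambda>x. grad (\<phi> n) x - grad (\<psi> n) x)" for n
    by (intro ext grad_diff smooth_differentiable[OF test_function_smooth[OF p(1)]] smooth_differentiable[OF test_function_smooth[OF q(1)]])
  have "(\<lambda>n. L2_norm_on (ball 0 R) (\<lambda>x. (\<phi> n x - \<psi> n x) - (f x - f' x))) \<longlonglongrightarrow> 0"
    by (rule l) (use p q in auto)
  moreover have "(\<lambda>n. L2_norm_on (ball 0 R) (\<lambda>x. grad (\<lambda>x. \<phi> n x - \<psi> n x) x - (g x - g' x))) \<longlonglongrightarrow> 0"
    unfolding g by (rule l) (use p q in auto)
  ultimately show ?thesis
    unfolding H10_with_grad_def using p q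
    by (intro conjI in_L2_diff exI[of _ "\<lambda>n x. \<phi> n x - \<psi> n x"] allI test_function_diff) auto
qed

section \<open>A smooth cutoff\<close>

text \<open>The derivatives of \<open>exp (- 1 / s)\<close>, \<open>s > 0\<close>, are of the form \<open>p (1 / s) exp (- 1 / s)\<close>
  with polynomials \<open>p\<close>.\<close>

definition flat :: "real poly \<Rightarrow> real \<Rightarrow> real" where
  "flat p s = (if s > 0 then poly p (1 / s) * exp (- (1 / s)) else 0)"

text \<open>With \<open>y = 1 / s\<close> the chain rule gives
  \<open>y^2 (p y - p' y) exp (- y)\<close> as the derivative of \<open>p y exp (- y)\<close> in
  \<open>s\<close>; the polynomial \<open>[:0, 0, 1:]\<close> is \<open>y^2\<close>.\<close>

definition flat_deriv :: "real poly \<Rightarrow> real poly" where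
  "flat_deriv p = [:0, 0, 1:] * (p - pderiv p)"

text \<open>The free power \<open>k\<close> makes the induction on \<open>p\<close> go through:
  splitting off the constant coefficient turns \<open>y ^ k\<close> into \<open>y ^ Suc k\<close>.
  The difference quotient at 0 in \<open>flat_has_derivative\<close> needs
  \<open>k = 1\<close>.\<close>

lemma poly_times_exp_tendsto_0:
  "((\<lambda>y::real. y ^ k * poly p y * exp (- y)) \<longlongrightarrow> 0) at_top"
proof (induction p arbitrary: k)
  case (pCons a p)
  have "((\<lambda>y::real. a * (y ^ k / exp y) + y ^ Suc k * poly p y * exp (- y)) \<longlongrightarrow> a * 0 + 0) at_top"
    by (intro tendsto_intros pCons tendsto_power_div_exp_0)
  moreover have "(\<lambda>y::real. a * (y ^ k / exp y) + y ^ Suc k * poly p y * exp (- y))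
      = (\<lambda>y. y ^ k * poly (pCons a p) y * exp (- y))"
    by (auto simp: exp_minus field_simps)
  ultimately show ?case by simp
qed simp

lemma flat_has_derivative: "(flat p has_real_derivative flat (flat_deriv p) x) (at x)"
proof -
  consider "x > 0" | "x < 0" | "x = 0" by linarith
  then show ?thesis
  proof cases
    case 1
    have "((\<lambda>s. poly p (1 / s) * exp (- (1 / s))) has_real_derivative flat (flat_deriv p) x) (at x)"
      using 1 by (auto intro!: derivative_eq_intros DERIV_chain2[of "poly p"] poly_DERIV
          simp: flat_def flat_deriv_def field_simps power2_eq_square)
    then show ?thesis
      by (rule has_field_derivative_transform_within_open[of _ _ _ "{0<..}"]) (use 1 in \<open>auto simp: flat_def\<close>)
  next
    case 2
    show ?thesis
      by (rule has_field_derivative_transform_within_open[of "\<lambda>s. 0" _ _ "{..<0}"]) (use 2 in \<open>auto simp: flat_def\<close>)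
  next
    case 3
    \<comment> \<open>With \<open>y = 1 / h\<close> the right difference quotient at 0 is
      \<open>y p(y) exp (- y)\<close>; the left one is identically 0.\<close>
    have r: "((\<lambda>h. flat p h / h) \<longlongrightarrow> 0) (at_right 0)"
      unfolding filterlim_at_right_to_top
    proof (rule Lim_transform_eventually)
      show "((\<lambda>y::real. y ^ 1 * poly p y * exp (- y)) \<longlongrightarrow> 0) at_top" by (rule poly_times_exp_tendsto_0)
      show "\<forall>\<^sub>F x in at_top. x ^ 1 * poly p x * exp (- x) = flat p (inverse x) / inverse x"
        using eventually_gt_at_top[of 0] by eventually_elim (auto simp: flat_def field_simps)
    qed
    have l: "((\<lambda>h. flat p h / h) \<longlongrightarrow> 0) (at_left 0)"
      by (rule tendsto_eventually) (auto simp: flat_def eventually_at_filter)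
    have "((\<lambda>h. flat p h / h) \<longlongrightarrow> 0) (at 0)"
      using l r by (simp add: filterlim_at_split)
    then show ?thesis using 3 by (simp add: has_field_derivative_iff flat_def)
  qed
qed

lemma smooth_flat:
  assumes "smooth f" shows "smooth (\<lambda>x. flat p (f x))"
  using smooth_real_compose[of "\<lambda>n. flat ((flat_deriv ^^ n) p)" f 0] flat_has_derivative assms by simp

definition cutoff :: "real \<Rightarrow> real" where "cutoff = flat 1"

lemma cutoff_eq: "cutoff s = (if s > 0 then exp (- (1 / s)) else 0)"
  by (simp add: cutoff_def flat_def)

lemma cutoff_bounds: "0 \<le> cutoff s" "cutoff s \<le> 1"
  by (auto simp: cutoff_eq)

lemma smooth_cutoff: "smooth f \<Longrightarrow> smooth (\<lambda>x. cutoff (f x))"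
  by (simp add: cutoff_def smooth_flat)

definition cutoff' :: "real \<Rightarrow> real" where "cutoff' s = (if s > 0 then exp (- (1 / s)) / s\<^sup>2 else 0)"

lemma cutoff_has_derivative: "(cutoff has_real_derivative cutoff' x) (at x)"
proof -
  have "flat (flat_deriv 1) = cutoff'"
    by (auto simp: flat_def flat_deriv_def cutoff'_def power2_eq_square fun_eq_iff pderiv_1)
  then show ?thesis using flat_has_derivative[of 1 x] by (simp add: cutoff_def)
qed

lemma smooth_norm_square: "smooth (\<lambda>x::real^2. (norm x)\<^sup>2)"
  using smooth_inner[OF smooth_ident smooth_ident] by (simp add: power2_norm_eq_inner)

text \<open>The argument is positive only where \<open>R\<^sup>2 - (norm x)\<^sup>2 > 1 / n\<close>,
  so the support is compact in the disk, and it tends to infinity at every interior point, where the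
  cutoff therefore tends to 1. Using the squared norm keeps the function smooth at the
  origin.\<close>

definition disk_cutoff :: "real \<Rightarrow> nat \<Rightarrow> real^2 \<Rightarrow> real" where
  "disk_cutoff R n x = cutoff (real n * (R\<^sup>2 - (norm x)\<^sup>2) - 1)"

lemma smooth_disk_cutoff: "smooth (disk_cutoff R n)"
  unfolding disk_cutoff_def[abs_def]
  by (intro smooth_cutoff smooth_diff smooth_mult smooth_const smooth_norm_square)

lemma test_function_disk_cutoff:
  fixes f :: "real^2 \<Rightarrow> 'b::real_normed_vector"
  assumes "smooth f" "R > 0"
  shows "test_function (ball 0 R) (\<lambda>x. disk_cutoff R n x *\<^sub>R f x)"
proof (rule test_functionI)
  let ?K = "{x::real^2. 1 \<le> real n * (R\<^sup>2 - (norm x)\<^sup>2)}"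
  have s: "?K \<subseteq> ball 0 R"
  proof
    fix x assume "x \<in> ?K"
    then have "R\<^sup>2 - (norm x)\<^sup>2 > 0" by (smt (verit) mem_Collect_eq mult_nonneg_nonpos of_nat_0_le_iff)
    then show "x \<in> ball 0 R" using assms(2) by (simp add: power_less_imp_less_base)
  qed
  then have "bounded ?K" using bounded_ball bounded_subset by blast
  moreover have "closed ?K" by (intro closed_Collect_le continuous_intros)
  ultimately show "compact ?K" by (simp add: compact_eq_bounded_closed)
  show "?K \<subseteq> ball 0 R" by fact
  show "smooth (\<lambda>x. disk_cutoff R n x *\<^sub>R f x)"
    by (intro smooth_scaleR smooth_disk_cutoff assms)
  show "x \<notin> ?K \<Longrightarrow> disk_cutoff R n x *\<^sub>R f x = 0" for x
    by (auto simp: disk_cutoff_def cutoff_eq)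
qed

lemma cutoff_tendsto_1: "(cutoff \<longlongrightarrow> 1) at_top"
proof (rule Lim_transform_eventually)
  show "((\<lambda>s::real. exp (- (1 / s))) \<longlongrightarrow> 1) at_top" by real_asymp
  show "\<forall>\<^sub>F s in at_top. exp (- (1 / s)) = cutoff s"
    using eventually_gt_at_top[of 0] by eventually_elim (simp add: cutoff_eq)
qed

lemma disk_cutoff_arg_at_top:
  assumes "x \<in> ball 0 R"
  shows "filterlim (\<lambda>n::nat. real n * (R\<^sup>2 - (norm x)\<^sup>2) - 1) at_top sequentially"
proof -
  have "R\<^sup>2 - (norm x)\<^sup>2 > 0" using assms by (simp add: power_strict_mono)
  then show ?thesis by real_asymp
qed

lemma disk_cutoff_tendsto: "x \<in> ball 0 R \<Longrightarrow> (\<lambda>n. disk_cutoff R n x) \<longlonglongrightarrow> 1"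
  unfolding disk_cutoff_def by (rule filterlim_compose[OF cutoff_tendsto_1 disk_cutoff_arg_at_top])

section \<open>The first Dirichlet eigenvalue of the disk\<close>

text \<open>The radial eigenfunction is \<open>J\<^sub>0 (sqrt \<mu> \<bar>x\<bar>) = F (\<mu> \<bar>x\<bar>\<^sup>2 / 4)\<close> with
  \<open>F s = \<Sum>k. (- s) ^ k / (k!)\<^sup>2\<close>; \<open>bessel n\<close> is the \<open>n\<close>-th derivative of \<open>F\<close>.\<close>

definition bessel_coeff :: "nat \<Rightarrow> real" where
  "bessel_coeff k = (-1) ^ k / (fact k)\<^sup>2"

definition bessel :: "nat \<Rightarrow> real \<Rightarrow> real" where
  "bessel n s = (\<Sum>k. (diffs ^^ n) bessel_coeff k * s ^ k)"

lemma summable_bessel_coeff: "summable (\<lambda>k. bessel_coeff k * s ^ k)"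
proof (rule summable_comparison_test')
  show "summable (\<lambda>k. \<bar>s\<bar> ^ k /\<^sub>R fact k)" by (rule summable_exp_generic)
  show "norm (bessel_coeff k * s ^ k) \<le> \<bar>s\<bar> ^ k /\<^sub>R fact k" if "k \<ge> 0" for k
  proof -
    have "(fact k :: real) \<le> (fact k)\<^sup>2" by (simp add: power2_eq_square mult_le_cancel_left1)
    then have "1 / (fact k)\<^sup>2 \<le> 1 / (fact k :: real)" by (intro divide_left_mono) auto
    then have "1 / (fact k)\<^sup>2 * \<bar>s\<bar> ^ k \<le> 1 / (fact k :: real) * \<bar>s\<bar> ^ k" by (rule mult_right_mono) simp
    then show ?thesis by (simp add: bessel_coeff_def abs_mult power_abs divide_inverse)
  qed
qed

lemma summable_bessel: "summable (\<lambda>k. (diffs ^^ n) bessel_coeff k * s ^ k)"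
proof (induction n arbitrary: s)
  case 0 then show ?case by (simp add: summable_bessel_coeff)
next
  case (Suc n) then show ?case using termdiff_converges_all[of "(diffs ^^ n) bessel_coeff" s] by simp
qed

lemma bessel_has_derivative: "(bessel n has_real_derivative bessel (Suc n) s) (at s)"
  using termdiffs_strong_converges_everywhere[OF summable_bessel, of n s] by (simp add: bessel_def[abs_def])

lemma isCont_bessel: "isCont (bessel n) s"
  using bessel_has_derivative by (rule DERIV_isCont)

text \<open>In the form \<open>(s F')' = - F\<close> this is the recursion
  \<open>(k + 1)^2 c (k + 1) = - c k\<close> of the coefficients of \<open>F\<close>: the sequence
  \<open>d\<close> holds the coefficients of \<open>s F'(s)\<close>, and \<open>diffs d\<close>
  those of its derivative.\<close>

lemma bessel_ode: "s * bessel 2 s + bessel 1 s + bessel 0 s = 0"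
proof -
  define d where "d k = (case k of 0 \<Rightarrow> 0 | Suc j \<Rightarrow> diffs bessel_coeff j)" for k
  have sd: "(\<lambda>k. d k * x ^ k) sums (x * bessel 1 x)" for x
  proof -
    have "(\<lambda>k. x * (diffs bessel_coeff k * x ^ k)) sums (x * bessel 1 x)"
      using summable_sums[OF summable_bessel[of 1 x]] by (intro sums_mult) (simp add: bessel_def)
    then have "(\<lambda>k. d (Suc k) * x ^ Suc k) sums (x * bessel 1 x)"
      by (simp add: d_def mult.left_commute)
    then show ?thesis using sums_Suc_iff[of "\<lambda>k. d k * x ^ k" "x * bessel 1 x"] by (simp add: d_def)
  qed
  have dd: "diffs d k = - bessel_coeff k" for k
  proof -
    have f: "(fact (Suc k) :: real) = real (Suc k) * fact k" by (subst fact_Suc) simp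
    have "a * (a * (- x / (a * F)\<^sup>2)) = - (x / F\<^sup>2)" if "a \<noteq> 0" for a x F :: real
      using that by (simp add: power_mult_distrib power2_eq_square)
    from this[of "real (Suc k)" "(-1) ^ k" "fact k"] show ?thesis
      unfolding diffs_def d_def bessel_coeff_def f by simp
  qed
  have "((\<lambda>x. x * bessel 1 x) has_real_derivative (\<Sum>k. diffs d k * s ^ k)) (at s)"
    using termdiffs_strong_converges_everywhere[OF sums_summable[OF sd], of s] sums_unique[OF sd] by simp
  moreover have "(\<Sum>k. diffs d k * s ^ k) = - bessel 0 s"
    using suminf_minus[OF summable_bessel_coeff] by (simp add: dd bessel_def)
  moreover have "((\<lambda>x. x * bessel 1 x) has_real_derivative bessel 1 s + s * bessel 2 s) (at s)"
    using bessel_has_derivative[of 1 s] by (auto intro!: derivative_eq_intros simp: numeral_2_eq_2)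
  ultimately have "bessel 1 s + s * bessel 2 s = - bessel 0 s"
    using DERIV_unique by metis
  then show ?thesis by linarith
qed

lemma bessel_0: "bessel 0 0 = 1"
proof -
  have "bessel 0 0 = bessel_coeff 0" by (simp add: bessel_def)
  then show ?thesis by (simp add: bessel_coeff_def)
qed

text \<open>The series of \<open>1 - F(2)\<close> alternates with decreasing terms 2, 1, 2/9, 1/36,
  ..., so its even partial sums are lower bounds. Two terms give only \<open>2 - 1 = 1\<close>,
  hence \<open>F(2) \<le> 0\<close>; four terms exceed 1.\<close>

lemma bessel_2_neg: "bessel 0 2 < 0"
proof -
  define a where "a k = 2 ^ Suc k / (fact (Suc k) :: real)\<^sup>2" for k
  have mono: "a (Suc n) \<le> a n" for n
  proof -
    have f: "(fact (Suc (Suc n)) :: real) = (real n + 2) * fact (Suc n)" by (subst fact_Suc) simp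
    have "a (Suc n) = 2 / (real n + 2)\<^sup>2 * a n" unfolding a_def f power_mult_distrib by simp
    also have "\<dots> \<le> 1 * a n"
      by (rule mult_right_mono) (auto simp: a_def divide_le_eq_1 power2_eq_square algebra_simps)
    finally show ?thesis by simp
  qed
  have c: "bessel_coeff (Suc k) * 2 ^ Suc k = - ((-1) ^ k * a k)" for k
    by (simp add: bessel_coeff_def a_def)
  have s1: "(\<lambda>k. bessel_coeff (Suc k) * 2 ^ Suc k) sums (bessel 0 2 - bessel_coeff 0 * 2 ^ 0)"
    using summable_sums[OF summable_bessel_coeff[of 2]] sums_Suc_iff[of "\<lambda>k. bessel_coeff k * 2 ^ k" "bessel 0 2 - bessel_coeff 0 * 2 ^ 0"]
    by (simp add: bessel_def)
  then have s2: "(\<lambda>k. (-1) ^ k * a k) sums (1 - bessel 0 2)"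
    using sums_minus[OF s1] unfolding c by (simp add: bessel_coeff_def)
  have "a \<longlonglongrightarrow> 0"
  proof -
    have "(\<lambda>k. - bessel_coeff (Suc k) * 2 ^ Suc k) \<longlonglongrightarrow> 0"
      using summable_LIMSEQ_zero[OF sums_summable[OF sums_minus[OF s1]]] by simp
    then have "(\<lambda>k. (-1) ^ k * a k) \<longlonglongrightarrow> 0" using c by simp
    then have "(\<lambda>k. \<bar>(-1) ^ k * a k\<bar>) \<longlonglongrightarrow> 0" by (rule tendsto_rabs_zero)
    moreover have "\<bar>(-1) ^ k * a k\<bar> = a k" for k by (simp add: abs_mult a_def)
    ultimately show ?thesis by simp
  qed
  then have "(\<Sum>i<2 * 2. (-1) ^ i * a i) \<le> (\<Sum>i. (-1) ^ i * a i)"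
    by (rule summable_Leibniz'(2)[of a, OF _ _ mono]) (simp add: a_def)
  also have "\<dots> = 1 - bessel 0 2" using s2 by (rule sums_unique[symmetric])
  finally have "(\<Sum>i<4. (-1) ^ i * a i) \<le> 1 - bessel 0 2" by simp
  moreover have "(\<Sum>i<4. (-1) ^ i * a i) > 1"
    by (simp add: a_def eval_nat_numeral fact_Suc)
  ultimately show ?thesis by linarith
qed

lemma bessel_first_zero: "\<exists>z>0. bessel 0 z = 0 \<and> (\<forall>s. 0 \<le> s \<longrightarrow> s < z \<longrightarrow> bessel 0 s > 0)"
proof -
  have c: "continuous_on A (bessel 0)" for A
    by (simp add: continuous_at_imp_continuous_on isCont_bessel)
  have ivt: "\<exists>x\<ge>0. x \<le> b \<and> bessel 0 x = 0" if "0 \<le> b" "bessel 0 b \<le> 0" for b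
    using IVT2'[of "bessel 0" b 0 0] that c bessel_0 by auto
  let ?Z = "{s. bessel 0 s = 0} \<inter> {0..2}"
  have "closed {s. bessel 0 s = 0}" by (intro closed_Collect_eq c continuous_on_const)
  then have "compact ?Z" by (intro closed_Int_compact) auto
  moreover have "?Z \<noteq> {}" using ivt[of 2] bessel_2_neg by force
  ultimately obtain z where z: "z \<in> ?Z" "\<And>s. s \<in> ?Z \<Longrightarrow> z \<le> s"
    using compact_attains_inf by metis
  have "z \<noteq> 0" using z bessel_0 by auto
  moreover have "bessel 0 s > 0" if "0 \<le> s" "s < z" for s
  proof (rule ccontr)
    assume "\<not> bessel 0 s > 0"
    then have "bessel 0 s \<le> 0" by simp
    from ivt[OF that(1) this] obtain x where x: "0 \<le> x" "x \<le> s" "bessel 0 x = 0" by (elim exE conjE)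
    have "x \<in> ?Z" using x that(2) z(1) by simp
    then have "z \<le> x" by (rule z(2))
    then show False using x(2) that(2) by linarith
  qed
  ultimately show ?thesis using z(1) by (intro exI[of _ z]) auto
qed

text \<open>As \<open>F s = J\<^sub>0 (2 sqrt s)\<close>, this is a quarter of the square of the
  first positive zero of \<open>J\<^sub>0\<close>, about 1.446.\<close>

definition bessel_zero :: real where
  "bessel_zero = (SOME z. 0 < z \<and> bessel 0 z = 0 \<and> (\<forall>s. 0 \<le> s \<longrightarrow> s < z \<longrightarrow> bessel 0 s > 0))"

lemma bessel_zero: "0 < bessel_zero" "bessel 0 bessel_zero = 0"
    "\<And>s. 0 \<le> s \<Longrightarrow> s < bessel_zero \<Longrightarrow> bessel 0 s > 0"
  using someI_ex[OF bessel_first_zero] unfolding bessel_zero_def by blast+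

section \<open>The radial eigenfunction and its gradient field\<close>

definition disk_scale :: "real \<Rightarrow> real" where "disk_scale R = bessel_zero / R\<^sup>2"

text \<open>With \<open>j\<close> the first positive zero of \<open>J\<^sub>0\<close> this is
  \<open>(j / R)\<^sup>2\<close>, since \<open>disk_scale R\<close> is the factor
  \<open>\<mu> / 4\<close> in front of the squared norm.\<close>

definition disk_eigenvalue :: "real \<Rightarrow> real" where "disk_eigenvalue R = 4 * disk_scale R"

definition disk_eigenfunction :: "real \<Rightarrow> real^2 \<Rightarrow> real" where
  "disk_eigenfunction R x = bessel 0 (disk_scale R * (norm x)\<^sup>2)"

definition disk_eigenfield :: "real \<Rightarrow> real^2 \<Rightarrow> real^2" where
  "disk_eigenfield R x = (bessel 1 (disk_scale R * (norm x)\<^sup>2) * (2 * disk_scale R)) *\<^sub>R x"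

lemma disk_scale_pos: "R > 0 \<Longrightarrow> disk_scale R > 0"
  by (simp add: disk_scale_def bessel_zero)

lemma disk_eigenvalue_pos: "R > 0 \<Longrightarrow> disk_eigenvalue R > 0"
  by (simp add: disk_eigenvalue_def disk_scale_pos)

lemma smooth_bessel: "smooth f \<Longrightarrow> smooth (\<lambda>x. bessel n (f x))"
  by (rule smooth_real_compose[where F=bessel]) (rule bessel_has_derivative)

lemma smooth_disk_eigenfunction: "smooth (disk_eigenfunction R)"
  unfolding disk_eigenfunction_def[abs_def]
  by (intro smooth_bessel smooth_mult smooth_const smooth_norm_square)

lemma smooth_disk_eigenfield: "smooth (disk_eigenfield R)"
  unfolding disk_eigenfield_def[abs_def]
  by (intro smooth_scaleR smooth_bessel smooth_mult smooth_const smooth_norm_square smooth_ident)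

lemma partial_norm_square: "partial i (\<lambda>x::real^2. (norm x)\<^sup>2) x = 2 * x $ i"
proof -
  have "((\<lambda>x::real^2. x \<bullet> x) has_derivative (\<lambda>h. x \<bullet> h + h \<bullet> x)) (at x)"
    by (intro derivative_intros)
  from partial_eq[OF this, of i] show ?thesis
    by (simp add: power2_norm_eq_inner inner_axis inner_axis')
qed

lemma partial_bessel:
  "partial i (\<lambda>x::real^2. bessel n (c * (norm x)\<^sup>2)) x = bessel (Suc n) (c * (norm x)\<^sup>2) * (c * (2 * x $ i))"
proof -
  have "partial i (\<lambda>x::real^2. c * (norm x)\<^sup>2) x = c * (2 * x $ i)"
    using partial_linear[OF bounded_linear_mult_right smooth_differentiable[OF smooth_norm_square], of i c x]
    by (simp add: partial_norm_square)
  moreover have "(\<lambda>x::real^2. c * (norm x)\<^sup>2) differentiable (at x)"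
    by (intro smooth_differentiable smooth_mult smooth_const smooth_norm_square)
  ultimately show ?thesis
    using partial_real_compose[OF bessel_has_derivative, where f="\<lambda>x::real^2. c * (norm x)\<^sup>2"] by simp
qed

lemma grad_disk_eigenfunction: "grad (disk_eigenfunction R) x = disk_eigenfield R x"
  by (simp add: grad_def vec_eq_iff disk_eigenfunction_def[abs_def] partial_bessel disk_eigenfield_def)

text \<open>With \<open>a = disk_scale R\<close> and \<open>s = a (norm x)\<^sup>2\<close>, the
  planar Laplacian of \<open>F(s)\<close> is \<open>4 a (s F'' + F')\<close>, and the Bessel
  equation evaluates the bracket to \<open>- F\<close>.\<close>

lemma divergence_disk_eigenfield:
  "divergence (disk_eigenfield R) x = - disk_eigenvalue R * disk_eigenfunction R x"
proof -
  let ?a = "disk_scale R" and ?s = "disk_scale R * (norm x)\<^sup>2"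
  have p: "partial i (disk_eigenfield R) x
      = (bessel 1 ?s * (2 * ?a)) *\<^sub>R axis i 1 + (bessel 2 ?s * (?a * (2 * x $ i)) * (2 * ?a)) *\<^sub>R x" for i
  proof -
    have d: "(\<lambda>x::real^2. bessel 1 (?a * (norm x)\<^sup>2) * (2 * ?a)) differentiable (at x)"
      by (intro smooth_differentiable smooth_mult smooth_bessel smooth_const smooth_norm_square)
    have d': "(\<lambda>x::real^2. bessel 1 (?a * (norm x)\<^sup>2)) differentiable (at x)"
      by (intro smooth_differentiable smooth_mult smooth_bessel smooth_const smooth_norm_square)
    have "partial i (\<lambda>x::real^2. bessel 1 (?a * (norm x)\<^sup>2) * (2 * ?a)) x
        = bessel 2 ?s * (?a * (2 * x $ i)) * (2 * ?a)"
      using partial_linear[OF bounded_linear_mult_left d', of i "2 * ?a"] partial_bessel[of i 1 ?a x, unfolded Suc_1]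
      by (simp only:)
    then show ?thesis
      using partial_bilinear[OF bounded_bilinear_scaleR d, of "\<lambda>x. x" i]
        partial_eq[OF has_derivative_ident, of i x]
      by (simp add: disk_eigenfield_def[abs_def])
  qed
  have "divergence (disk_eigenfield R) x
      = 2 * (bessel 1 ?s * (2 * ?a)) + bessel 2 ?s * (4 * ?a * ?a) * (\<Sum>i\<in>UNIV. x $ i * x $ i)"
    by (simp add: divergence_def p sum_2 axis_def algebra_simps)
  also have "(\<Sum>i\<in>UNIV. x $ i * x $ i) = (norm x)\<^sup>2"
    by (simp add: power2_norm_eq_inner inner_vec_def)
  also have "2 * (bessel 1 ?s * (2 * ?a)) + bessel 2 ?s * (4 * ?a * ?a) * (norm x)\<^sup>2
      = 4 * ?a * (?s * bessel 2 ?s + bessel 1 ?s)"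
    by (simp add: algebra_simps)
  also have "?s * bessel 2 ?s + bessel 1 ?s = - bessel 0 ?s"
    using bessel_ode[of ?s] by linarith
  finally show ?thesis by (simp add: disk_eigenvalue_def disk_eigenfunction_def)
qed

lemma disk_eigenfunction_pos:
  assumes "x \<in> ball 0 R" shows "disk_eigenfunction R x > 0"
proof -
  have R: "R > 0" using assms by (smt (verit) mem_ball dist_0_norm norm_ge_zero)
  have "(norm x)\<^sup>2 < R\<^sup>2" using assms by (simp add: power_strict_mono)
  then have "disk_scale R * (norm x)\<^sup>2 < bessel_zero"
    using R bessel_zero(1) by (simp add: disk_scale_def field_simps)
  then show ?thesis
    unfolding disk_eigenfunction_def using R disk_scale_pos[of R] by (intro bessel_zero(3)) auto
qed

text \<open>\<open>bessel 0\<close> vanishes at \<open>bessel_zero\<close>, so the mean value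
  theorem gives linear vanishing at the circle. This compensates the gradient of the cutoff, which
  grows like \<open>n\<close> in a boundary layer of width about \<open>1 / n\<close>.\<close>

lemma disk_eigenfunction_le:
  assumes "R > 0"
  obtains C where "C \<ge> 0" "\<And>x. x \<in> ball 0 R \<Longrightarrow> disk_eigenfunction R x \<le> C * (R\<^sup>2 - (norm x)\<^sup>2)"
proof -
  have "bounded (bessel 1 ` {0..bessel_zero})"
    by (intro compact_imp_bounded compact_continuous_image continuous_at_imp_continuous_on ballI isCont_bessel) auto
  then obtain B where B: "B > 0" "\<And>s. s \<in> {0..bessel_zero} \<Longrightarrow> \<bar>bessel 1 s\<bar> \<le> B"
    unfolding bounded_pos by auto
  show thesis
  proof (rule that[of "B * disk_scale R"])
    show "B * disk_scale R \<ge> 0" using B disk_scale_pos[OF assms] by simp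
    fix x :: "real^2" assume x: "x \<in> ball 0 R"
    let ?s = "disk_scale R * (norm x)\<^sup>2"
    have "(norm x)\<^sup>2 < R\<^sup>2" using x by (simp add: power_strict_mono)
    then have s: "0 \<le> ?s" "?s < bessel_zero"
      using assms bessel_zero(1) by (simp_all add: disk_scale_def field_simps)
    obtain \<xi> where xi: "?s < \<xi>" "\<xi> < bessel_zero" "bessel 0 bessel_zero - bessel 0 ?s = (bessel_zero - ?s) * bessel 1 \<xi>"
      using MVT2[OF s(2), of "bessel 0" "bessel 1"] bessel_has_derivative[of 0] by auto
    have "bessel 0 ?s = (bessel_zero - ?s) * (- bessel 1 \<xi>)" using xi(3) bessel_zero(2) by simp
    also have "\<dots> \<le> (bessel_zero - ?s) * B"
      using B(2)[of \<xi>] xi s by (intro mult_left_mono) auto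
    also have "bessel_zero - ?s = disk_scale R * (R\<^sup>2 - (norm x)\<^sup>2)"
      using assms by (simp add: disk_scale_def field_simps)
    finally show "disk_eigenfunction R x \<le> B * disk_scale R * (R\<^sup>2 - (norm x)\<^sup>2)"
      by (simp add: disk_eigenfunction_def mult_ac)
  qed
qed

section \<open>The sharp Poincare inequality\<close>

lemma norm_grad_square:
  "(norm (grad \<phi> x))\<^sup>2 = (\<Sum>i\<in>UNIV. (norm (partial i \<phi> x :: 'b::real_inner))\<^sup>2)"
  by (simp add: grad_def power2_norm_eq_inner inner_vec_def)

text \<open>Picone's argument: with \<open>w\<close> the positive eigenfunction, the vector field
  \<open>(\<bar>\<phi>\<bar>\<^sup>2 / w) \<nabla>w\<close> has divergence at most \<open>\<bar>\<nabla>\<phi>\<bar>\<^sup>2 - \<mu> \<bar>\<phi>\<bar>\<^sup>2\<close>.\<close>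

lemma Poincare_test_function:
  fixes \<phi> :: "real^2 \<Rightarrow> 'b::euclidean_space"
  assumes t: "test_function (ball 0 R) \<phi>"
  shows "disk_eigenvalue R * (L2_norm_on (ball 0 R) \<phi>)\<^sup>2 \<le> (L2_norm_on (ball 0 R) (grad \<phi>))\<^sup>2"
proof -
  let ?w = "disk_eigenfunction R" and ?W = "disk_eigenfield R" and ?B = "ball (0::real^2) R"
  have sp: "smooth \<phi>" using t by (rule test_function_smooth)
  obtain K where K: "compact K" "K \<subseteq> ?B" "\<And>x. x \<notin> K \<Longrightarrow> \<phi> x = 0"
    using test_functionE[OF t] by metis
  have wp: "?w x > 0" if "x \<in> ?B" for x using disk_eigenfunction_pos that by auto
  have pw: "partial i ?w x = ?W x $ i" for i x
    using grad_disk_eigenfunction[of R x] by (simp add: grad_def vec_eq_iff)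
  define h where "h x = (norm (\<phi> x))\<^sup>2 / ?w x" for x
  define h' where "h' i x = 2 * (\<phi> x \<bullet> partial i \<phi> x) / ?w x - (norm (\<phi> x))\<^sup>2 * ?W x $ i / (?w x)\<^sup>2" for i x
  have hz: "h x = 0" if "x \<notin> K" for x using K(3)[OF that] by (simp add: h_def)
  have hzB: "h x = 0" if "x \<notin> ?B" for x using hz K(2) that by blast
  \<comment> \<open>The quotient is harmless in the disk, where \<open>?w\<close> is positive.
    Elsewhere, in particular where \<open>?w\<close> vanishes, \<open>h\<close> is zero on the open
    complement of \<open>K\<close>, and the expressions \<open>h' i\<close> are zero as
    well.\<close>
  have hd: "(h has_derivative (\<lambda>v. \<Sum>i\<in>UNIV. v $ i * h' i x)) (at x)" for x
  proof (cases "x \<in> ?B")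
    case True
    have d1: "((\<lambda>x. \<phi> x \<bullet> \<phi> x) has_derivative (\<lambda>v. \<phi> x \<bullet> (\<Sum>i\<in>UNIV. v $ i *\<^sub>R partial i \<phi> x)
        + (\<Sum>i\<in>UNIV. v $ i *\<^sub>R partial i \<phi> x) \<bullet> \<phi> x)) (at x)"
      by (intro has_derivative_inner has_derivative_partials smooth_differentiable sp)
    have d2: "(?w has_derivative (\<lambda>v. \<Sum>i\<in>UNIV. v $ i *\<^sub>R partial i ?w x)) (at x)"
      by (intro has_derivative_partials smooth_differentiable smooth_disk_eigenfunction)
    from has_derivative_divide'[OF d1 d2] wp[OF True]
    have "((\<lambda>x. \<phi> x \<bullet> \<phi> x / ?w x) has_derivative (\<lambda>v. ((\<phi> x \<bullet> (\<Sum>i\<in>UNIV. v $ i *\<^sub>R partial i \<phi> x)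
        + (\<Sum>i\<in>UNIV. v $ i *\<^sub>R partial i \<phi> x) \<bullet> \<phi> x) * ?w x - (\<phi> x \<bullet> \<phi> x) * (\<Sum>i\<in>UNIV. v $ i *\<^sub>R partial i ?w x)) / (?w x * ?w x))) (at x)"
      by simp
    also have "(\<lambda>x. \<phi> x \<bullet> \<phi> x / ?w x) = h" by (simp add: h_def[abs_def] power2_norm_eq_inner)
    also have "(\<lambda>v. ((\<phi> x \<bullet> (\<Sum>i\<in>UNIV. v $ i *\<^sub>R partial i \<phi> x)
        + (\<Sum>i\<in>UNIV. v $ i *\<^sub>R partial i \<phi> x) \<bullet> \<phi> x) * ?w x - (\<phi> x \<bullet> \<phi> x) * (\<Sum>i\<in>UNIV. v $ i *\<^sub>R partial i ?w x)) / (?w x * ?w x))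
       = (\<lambda>v. \<Sum>i\<in>UNIV. v $ i * h' i x)"
      using wp[OF True] by (simp add: fun_eq_iff h'_def pw sum_2 inner_add_left inner_add_right inner_commute
          power2_norm_eq_inner power2_eq_square[of "?w x"] field_simps)
    finally show ?thesis .
  next
    case False
    then have xK: "x \<notin> K" using K(2) by auto
    have "h' i x = 0" for i using K(3)[OF xK] by (simp add: h'_def)
    moreover have "(h has_derivative (\<lambda>v. 0)) (at x)"
      by (rule has_derivative_transform_within_open[of "\<lambda>x. 0" _ _ _ "- K"])
         (use xK hz K(1) in \<open>auto intro: compact_imp_closed open_Compl\<close>)
    ultimately show ?thesis by simp
  qed
  have hdiff: "h differentiable (at x)" for x using hd differentiableI by blast
  have ph: "partial i h = h' i" for i
  proof
    fix x
    have "partial i h x = (\<Sum>j\<in>UNIV. axis i 1 $ j * h' j x)" by (rule partial_eq[OF hd])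
    also have "\<dots> = h' i x" by (simp add: axis_def if_distrib[of "\<lambda>z. z * _"] cong: if_cong)
    finally show "partial i h x = h' i x" .
  qed
  have ch': "continuous_on UNIV (h' i)" for i
  proof -
    have "continuous_on ?B (h' i)"
      unfolding h'_def
      by (intro continuous_intros smooth_continuous sp smooth_partial smooth_disk_eigenfunction smooth_disk_eigenfield)
         (use wp in force)+
    moreover have "continuous_on (- K) (h' i)"
      by (rule continuous_on_eq[of _ "\<lambda>x. 0"]) (use K(3) in \<open>auto simp: h'_def\<close>)
    ultimately have "continuous_on (?B \<union> - K) (h' i)"
      using K(1) by (intro continuous_on_open_Un) (auto intro: compact_imp_closed open_Compl)
    moreover have "?B \<union> - K = UNIV" using K(2) by auto
    ultimately show ?thesis by simp
  qed
  define X where "X x = h x *\<^sub>R ?W x" for x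
  have Xd: "X differentiable (at x)" for x
    unfolding X_def[abs_def]
    by (intro differentiable_bilinear[OF bounded_bilinear_scaleR] hdiff smooth_differentiable smooth_disk_eigenfield)
  have pX: "partial i X x = h x *\<^sub>R partial i ?W x + h' i x *\<^sub>R ?W x" for i x
    unfolding X_def[abs_def]
    using partial_bilinear[OF bounded_bilinear_scaleR hdiff[of x] smooth_differentiable[OF smooth_disk_eigenfield[of R], of x], where i=i]
    by (simp add: ph)
  have ch: "continuous_on UNIV h"
    using hdiff by (simp add: continuous_on_eq_continuous_at differentiable_imp_continuous_within)
  have cX: "continuous_on UNIV (partial i X)" for i
    unfolding pX[abs_def]
    by (intro continuous_intros ch ch' smooth_continuous smooth_partial smooth_disk_eigenfield)
  have X0: "(\<integral>x. divergence X x \<partial>lebesgue_on ?B) = 0"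
    by (rule integral_divergence_zero[OF Xd cX]) (use hzB in \<open>auto simp: X_def\<close>)
  have divX: "divergence X x = h x * divergence ?W x + (\<Sum>i\<in>UNIV. h' i x * ?W x $ i)" for x
    by (simp add: divergence_def pX sum.distrib sum_distrib_left)
  have cdiv: "continuous_on UNIV (divergence X)"
    unfolding divergence_def[abs_def] by (intro continuous_intros cX)
  have key: "divergence X x + disk_eigenvalue R * (norm (\<phi> x))\<^sup>2 \<le> (norm (grad \<phi> x))\<^sup>2" if x: "x \<in> ?B" for x
  proof -
    have w: "?w x > 0" using wp x by auto
    have "divergence X x + disk_eigenvalue R * (norm (\<phi> x))\<^sup>2 = (\<Sum>i\<in>UNIV. h' i x * ?W x $ i)"
      using w by (simp add: divX divergence_disk_eigenfield h_def)
    also have "\<dots> \<le> (\<Sum>i\<in>UNIV. (norm (partial i \<phi> x))\<^sup>2)"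
    proof (rule sum_mono)
      fix i :: 2
      \<comment> \<open>The difference of both sides is the square of
        \<open>\<partial>\<^sub>i \<phi> - c \<phi>\<close>, where \<open>c\<close> is the
        logarithmic derivative of \<open>w\<close>; it would vanish for multiples of
        \<open>w\<close>, which is why the constant is sharp.\<close>
      define c where "c = ?W x $ i / ?w x"
      have "0 \<le> (norm (partial i \<phi> x - c *\<^sub>R \<phi> x))\<^sup>2" by simp
      also have "\<dots> = (norm (partial i \<phi> x))\<^sup>2 - (2 * c * (\<phi> x \<bullet> partial i \<phi> x) - c\<^sup>2 * (norm (\<phi> x))\<^sup>2)"
        by (simp add: power2_norm_eq_inner inner_diff_left inner_diff_right inner_commute power2_eq_square[of c] algebra_simps)
      also have "2 * c * (\<phi> x \<bullet> partial i \<phi> x) - c\<^sup>2 * (norm (\<phi> x))\<^sup>2 = h' i x * ?W x $ i"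
        using w by (simp add: c_def h'_def field_simps power2_eq_square)
      finally show "h' i x * ?W x $ i \<le> (norm (partial i \<phi> x))\<^sup>2" by simp
    qed
    finally show ?thesis by (simp add: norm_grad_square)
  qed
  interpret finite_measure "lebesgue_on ?B" by (rule finite_measure_ball)
  have i1: "integrable (lebesgue_on ?B) (divergence X)"
  proof -
    have "bounded (divergence X ` cball 0 R)"
      by (intro compact_imp_bounded compact_continuous_image continuous_on_subset[OF cdiv]) auto
    then obtain B where "\<And>x. x \<in> cball 0 R \<Longrightarrow> norm (divergence X x) \<le> B" unfolding bounded_iff by blast
    then show ?thesis
      by (intro integrable_const_bound[of _ B] AE_I2 borel_measurable_lebesgue_on_continuous[OF cdiv]) auto
  qed
  have i2: "in_L2 ?B \<phi>" "in_L2 ?B (grad \<phi>)" by (auto intro: in_L2_smooth in_L2_grad sp)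
  have "(\<integral>x. divergence X x + disk_eigenvalue R * (norm (\<phi> x))\<^sup>2 \<partial>lebesgue_on ?B) \<le> (L2_norm_on ?B (grad \<phi>))\<^sup>2"
    unfolding L2_norm_on_power2 using i1 i2 key by (intro integral_mono) (auto simp: in_L2_def)
  then show ?thesis
    using i1 i2 X0 by (simp add: in_L2_def L2_norm_on_power2)
qed

lemma Poincare_H10:
  fixes f :: "real^2 \<Rightarrow> 'b::euclidean_space"
  assumes "H10_with_grad (ball 0 R) f g"
  shows "disk_eigenvalue R * (L2_norm_on (ball 0 R) f)\<^sup>2 \<le> (L2_norm_on (ball 0 R) g)\<^sup>2"
proof -
  let ?N = "L2_norm_on (ball 0 R)"
  obtain \<phi> :: "nat \<Rightarrow> real^2 \<Rightarrow> 'b" where p: "\<And>n. test_function (ball 0 R) (\<phi> n)"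
    "(\<lambda>n. L2_norm_on (ball 0 R) (\<lambda>x. \<phi> n x - f x)) \<longlonglongrightarrow> 0"
    "(\<lambda>n. L2_norm_on (ball 0 R) (\<lambda>x. grad (\<phi> n) x - g x)) \<longlonglongrightarrow> 0"
    "\<And>n. in_L2 (ball 0 R) (\<phi> n)" "\<And>n. in_L2 (ball 0 R) (grad (\<phi> n))"
    "in_L2 (ball 0 R) f" "in_L2 (ball 0 R) g"
    by (rule H10_with_gradE[OF assms]) blast
  have "(\<lambda>n. disk_eigenvalue R * (L2_norm_on (ball 0 R) (\<phi> n))\<^sup>2) \<longlonglongrightarrow> disk_eigenvalue R * (L2_norm_on (ball 0 R) f)\<^sup>2"
    by (intro tendsto_intros L2_tendsto_norm p)
  moreover have "(\<lambda>n. (L2_norm_on (ball 0 R) (grad (\<phi> n)))\<^sup>2) \<longlonglongrightarrow> (L2_norm_on (ball 0 R) g)\<^sup>2"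
    by (intro tendsto_intros L2_tendsto_norm p)
  ultimately show ?thesis
    by (rule LIMSEQ_le) (use Poincare_test_function[OF p(1)] in blast)
qed

section \<open>The eigenfunction lies in \<open>H10\<close>, and its eigenvalue is the least
  one\<close>

lemma L2_dominated_convergence:
  fixes f :: "nat \<Rightarrow> real^2 \<Rightarrow> 'b::euclidean_space"
  assumes "\<And>n. f n \<in> borel_measurable (lebesgue_on (ball 0 R))" "g \<in> borel_measurable (lebesgue_on (ball 0 R))"
    and "\<And>n x. x \<in> ball 0 R \<Longrightarrow> norm (f n x) \<le> B"
    and "\<And>x. x \<in> ball 0 R \<Longrightarrow> (\<lambda>n. f n x) \<longlonglongrightarrow> g x"
  shows "(\<lambda>n. L2_norm_on (ball 0 R) (\<lambda>x. f n x - g x)) \<longlonglongrightarrow> 0"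
proof -
  interpret finite_measure "lebesgue_on (ball (0::real^2) R)" by (rule finite_measure_ball)
  have gB: "norm (g x) \<le> B" if "x \<in> ball 0 R" for x
    using assms(3,4)[OF that] by (intro tendsto_upperbound[OF tendsto_norm]) auto
  have "(\<lambda>n. \<integral>x. (norm (f n x - g x))\<^sup>2 \<partial>lebesgue_on (ball 0 R)) \<longlonglongrightarrow> (\<integral>x. 0 \<partial>lebesgue_on (ball (0::real^2) R))"
  proof (rule integral_dominated_convergence)
    show "integrable (lebesgue_on (ball (0::real^2) R)) (\<lambda>x. (2 * B)\<^sup>2)" by simp
    show "(\<lambda>x. (norm (f n x - g x))\<^sup>2) \<in> borel_measurable (lebesgue_on (ball 0 R))" for n
      using borel_measurable_diff[OF assms(1)[of n] assms(2)] by measurable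
    show "AE x in lebesgue_on (ball 0 R). (\<lambda>n. (norm (f n x - g x))\<^sup>2) \<longlonglongrightarrow> 0"
      using assms(4) by (intro AE_I2) (auto intro!: tendsto_eq_intros LIM_zero)
    show "AE x in lebesgue_on (ball 0 R). norm ((norm (f n x - g x))\<^sup>2) \<le> (2 * B)\<^sup>2" for n
    proof (rule AE_I2)
      fix x assume "x \<in> space (lebesgue_on (ball (0::real^2) R))"
      then have x: "x \<in> ball 0 R" by simp
      have "norm (f n x - g x) \<le> 2 * B"
        using norm_triangle_ineq4[of "f n x" "g x"] assms(3)[OF x, of n] gB[OF x] by linarith
      then have "(norm (f n x - g x))\<^sup>2 \<le> (2 * B)\<^sup>2" by (intro power_mono) auto
      then show "norm ((norm (f n x - g x))\<^sup>2) \<le> (2 * B)\<^sup>2" by simp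
    qed
  qed simp
  then have "(\<lambda>n. sqrt (\<integral>x. (norm (f n x - g x))\<^sup>2 \<partial>lebesgue_on (ball 0 R))) \<longlonglongrightarrow> sqrt 0"
    by (intro tendsto_intros) simp
  then show ?thesis by (simp add: L2_norm_on_def)
qed

text \<open>For \<open>s\<close> the argument of \<open>disk_cutoff\<close>,
  \<open>s + 1 = n (R\<^sup>2 - (norm x)\<^sup>2)\<close>, which is the factor that arises when the
  \<open>n\<close> from the chain rule meets the linear bound on the eigenfunction. In terms of
  \<open>y = 1 / s\<close> the product is \<open>(y + y^2) exp (- y)\<close>.\<close>

lemma cutoff'_bound: "0 \<le> cutoff' s" "(s + 1) * cutoff' s \<le> 3"
proof -
  show "0 \<le> cutoff' s" by (simp add: cutoff'_def)
  show "(s + 1) * cutoff' s \<le> 3"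
  proof (cases "s > 0")
    case True
    define y where "y = 1 / s"
    have y: "y > 0" using True by (simp add: y_def)
    have "1 + y + y\<^sup>2 / 2 \<le> exp y" using exp_lower_Taylor_quadratic[of y] y by simp
    then have "y + y\<^sup>2 \<le> 3 * exp y" using y zero_le_power2[of y] by linarith
    then have "(y + y\<^sup>2) * exp (- y) \<le> 3" by (simp add: exp_minus field_simps)
    moreover have "(s + 1) * cutoff' s = (y + y\<^sup>2) * exp (- y)"
      using True by (simp add: cutoff'_def y_def field_simps power2_eq_square)
    ultimately show ?thesis by simp
  qed (simp add: cutoff'_def)
qed

lemma cutoff'_tendsto_0: "((\<lambda>s. (s + 1) * cutoff' s) \<longlongrightarrow> 0) at_top"
proof (rule Lim_transform_eventually)
  show "((\<lambda>s::real. (s + 1) * (exp (- (1 / s)) / s\<^sup>2)) \<longlongrightarrow> 0) at_top" by real_asymp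
  show "\<forall>\<^sub>F s in at_top. (s + 1) * (exp (- (1 / s)) / s\<^sup>2) = (s + 1) * cutoff' s"
    using eventually_gt_at_top[of 0] by eventually_elim (simp add: cutoff'_def)
qed

lemma partial_disk_cutoff:
  "partial i (disk_cutoff R n) x = cutoff' (real n * (R\<^sup>2 - (norm x)\<^sup>2) - 1) * (real n * (- 2 * x $ i))"
proof -
  let ?f = "\<lambda>x::real^2. real n * (R\<^sup>2 - (norm x)\<^sup>2) - 1"
  have d: "?f differentiable (at x)"
    by (intro smooth_differentiable smooth_diff smooth_mult smooth_const smooth_norm_square)
  have "((\<lambda>x::real^2. real n * (R\<^sup>2 - x \<bullet> x) - 1) has_derivative (\<lambda>h. real n * (0 - (x \<bullet> h + h \<bullet> x)) - 0)) (at x)"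
    by (intro derivative_intros)
  from partial_eq[OF this, of i] have "partial i ?f x = real n * (- 2 * x $ i)"
    by (simp add: power2_norm_eq_inner inner_axis inner_axis')
  then show ?thesis
    using partial_real_compose[OF cutoff_has_derivative d, of i] by (simp add: disk_cutoff_def[abs_def])
qed

text \<open>The truncations \<open>\<chi> w\<close>, with \<open>\<chi>\<close> the disk cutoff,
  have gradient \<open>\<chi> \<nabla>w + w \<nabla>\<chi>\<close>, and the second term is
  \<open>- 2 e x\<close>. Linear vanishing of \<open>w\<close> together with
  \<open>cutoff'_bound\<close> keeps \<open>e\<close> bounded in the boundary layer, and at each
  fixed point it tends to 0; dominated convergence leaves \<open>\<nabla>w\<close>.\<close>

lemma H10_disk_eigenfunction:
  assumes R: "R > 0"
  shows "H10_with_grad (ball 0 R) (disk_eigenfunction R) (disk_eigenfield R)"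
proof -
  let ?w = "disk_eigenfunction R" and ?W = "disk_eigenfield R" and ?B = "ball (0::real^2) R"
  define \<phi> where "\<phi> n x = disk_cutoff R n x *\<^sub>R ?w x" for n x
  have t: "test_function ?B (\<phi> n)" for n
    unfolding \<phi>_def[abs_def] by (rule test_function_disk_cutoff[OF smooth_disk_eigenfunction R])
  obtain C where C: "C \<ge> 0" "\<And>x. x \<in> ?B \<Longrightarrow> ?w x \<le> C * (R\<^sup>2 - (norm x)\<^sup>2)"
    using disk_eigenfunction_le[OF R] by metis
  have "bounded (?W ` cball 0 R)"
    by (intro compact_imp_bounded compact_continuous_image smooth_continuous smooth_disk_eigenfield) auto
  then obtain M where M: "\<And>x. x \<in> cball 0 R \<Longrightarrow> norm (?W x) \<le> M" unfolding bounded_iff by blast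
  define e where "e n x = cutoff' (real n * (R\<^sup>2 - (norm x)\<^sup>2) - 1) * real n * ?w x" for n and x :: "real^2"
  have g: "grad (\<phi> n) x = disk_cutoff R n x *\<^sub>R ?W x + (- 2 * e n x) *\<^sub>R x" for n x
  proof -
    have "partial i (\<phi> n) x = disk_cutoff R n x *\<^sub>R ?W x $ i + (- 2 * e n x) * x $ i" for i
      unfolding \<phi>_def[abs_def]
      using partial_bilinear[OF bounded_bilinear_scaleR smooth_differentiable[OF smooth_disk_cutoff[of R n], of x]
           smooth_differentiable[OF smooth_disk_eigenfunction[of R], of x], where i=i]
        grad_disk_eigenfunction[of R x]
      by (simp add: partial_disk_cutoff e_def grad_def vec_eq_iff)
    then show ?thesis by (simp add: grad_def vec_eq_iff)
  qed
  have eb: "0 \<le> e n x \<and> e n x \<le> C * ((real n * (R\<^sup>2 - (norm x)\<^sup>2) - 1 + 1) * cutoff' (real n * (R\<^sup>2 - (norm x)\<^sup>2) - 1))" if x: "x \<in> ?B" for n x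
  proof -
    let ?s = "real n * (R\<^sup>2 - (norm x)\<^sup>2) - 1"
    have "0 \<le> e n x" using disk_eigenfunction_pos[OF x] cutoff'_bound by (simp add: e_def)
    moreover have "e n x \<le> cutoff' ?s * real n * (C * (R\<^sup>2 - (norm x)\<^sup>2))"
      unfolding e_def by (intro mult_left_mono C x) (simp add: cutoff'_bound)
    ultimately show ?thesis by (simp add: mult_ac)
  qed
  have l1: "(\<lambda>n. L2_norm_on ?B (\<lambda>x. \<phi> n x - ?w x)) \<longlonglongrightarrow> 0"
  proof (rule L2_dominated_convergence[where B="C * R\<^sup>2"])
    show "\<phi> n \<in> borel_measurable (lebesgue_on ?B)" for n
      by (intro borel_measurable_lebesgue_on_continuous smooth_continuous test_function_smooth[OF t])
    show "?w \<in> borel_measurable (lebesgue_on ?B)"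
      by (intro borel_measurable_lebesgue_on_continuous smooth_continuous smooth_disk_eigenfunction)
    show "norm (\<phi> n x) \<le> C * R\<^sup>2" if x: "x \<in> ?B" for n x
    proof -
      have "norm (\<phi> n x) = disk_cutoff R n x * ?w x"
        using disk_eigenfunction_pos[OF x] by (simp add: \<phi>_def disk_cutoff_def abs_mult cutoff_bounds)
      also have "\<dots> \<le> 1 * (C * (R\<^sup>2 - (norm x)\<^sup>2))"
        using disk_eigenfunction_pos[OF x] C(2)[OF x]
        by (intro mult_mono) (auto simp: disk_cutoff_def cutoff_bounds)
      also have "\<dots> \<le> C * R\<^sup>2" using C(1) by (simp add: mult_left_mono)
      finally show ?thesis .
    qed
    show "(\<lambda>n. \<phi> n x) \<longlonglongrightarrow> ?w x" if "x \<in> ?B" for x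
      unfolding \<phi>_def using tendsto_scaleR[OF disk_cutoff_tendsto[OF that] tendsto_const[of "?w x"]] by simp
  qed
  have l2: "(\<lambda>n. L2_norm_on ?B (\<lambda>x. grad (\<phi> n) x - ?W x)) \<longlonglongrightarrow> 0"
  \<comment> \<open>\<open>M\<close> bounds the eigenfield, and \<open>2 * (3 C) * R\<close> bounds
    the term \<open>- 2 e x\<close>.\<close>
  proof (rule L2_dominated_convergence[where B="M + 6 * C * R"])
    show "grad (\<phi> n) \<in> borel_measurable (lebesgue_on ?B)" for n
      by (intro borel_measurable_lebesgue_on_continuous smooth_grad test_function_smooth[OF t])
    show "?W \<in> borel_measurable (lebesgue_on ?B)"
      by (intro borel_measurable_lebesgue_on_continuous smooth_continuous smooth_disk_eigenfield)
    show "norm (grad (\<phi> n) x) \<le> M + 6 * C * R" if x: "x \<in> ?B" for n x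
    proof -
      have "norm (disk_cutoff R n x *\<^sub>R ?W x) \<le> 1 * M"
        unfolding norm_scaleR using M[of x] x by (intro mult_mono) (auto simp: disk_cutoff_def cutoff_bounds)
      moreover have "norm ((- 2 * e n x) *\<^sub>R x) \<le> (2 * (C * 3)) * R"
      proof -
        have "e n x \<le> C * 3"
          using eb[OF x, of n] mult_left_mono[OF cutoff'_bound(2) C(1)] by (meson order_trans)
        then show ?thesis
          unfolding norm_scaleR using eb[OF x, of n] x C(1) R by (intro mult_mono) auto
      qed
      ultimately show ?thesis
        unfolding g using norm_triangle_ineq[of "disk_cutoff R n x *\<^sub>R ?W x" "(- 2 * e n x) *\<^sub>R x"] by linarith
    qed
    show "(\<lambda>n. grad (\<phi> n) x) \<longlonglongrightarrow> ?W x" if x: "x \<in> ?B" for x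
    proof -
      have "(\<lambda>n. e n x) \<longlonglongrightarrow> 0"
      proof (rule tendsto_sandwich[OF always_eventually always_eventually tendsto_const])
        show "\<forall>n. 0 \<le> e n x" using eb[OF x] by blast
        show "\<forall>n. e n x \<le> C * ((real n * (R\<^sup>2 - (norm x)\<^sup>2) - 1 + 1) * cutoff' (real n * (R\<^sup>2 - (norm x)\<^sup>2) - 1))"
          using eb[OF x] by blast
        show "(\<lambda>n. C * ((real n * (R\<^sup>2 - (norm x)\<^sup>2) - 1 + 1) * cutoff' (real n * (R\<^sup>2 - (norm x)\<^sup>2) - 1))) \<longlonglongrightarrow> 0"
          using tendsto_mult_left[OF filterlim_compose[OF cutoff'_tendsto_0 disk_cutoff_arg_at_top[OF x]], of C] by simp
      qed
      then have "(\<lambda>n. disk_cutoff R n x *\<^sub>R ?W x + (- 2 * e n x) *\<^sub>R x) \<longlonglongrightarrow> 1 *\<^sub>R ?W x + (- 2 * 0) *\<^sub>R x"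
        by (intro tendsto_intros disk_cutoff_tendsto x)
      then show ?thesis unfolding g by simp
    qed
  qed
  show ?thesis
    unfolding H10_with_grad_def
    using t l1 l2 by (intro conjI in_L2_smooth smooth_disk_eigenfunction smooth_disk_eigenfield exI[of _ \<phi>]) auto
qed

lemma dirichlet_eigenvalue_disk:
  assumes R: "R > 0"
  shows "dirichlet_eigenvalue (ball 0 R) (disk_eigenvalue R)"
proof -
  let ?w = "disk_eigenfunction R" and ?W = "disk_eigenfield R" and ?B = "ball (0::real^2) R"
  have "\<not> (AE x in lebesgue_on ?B. ?w x = 0)"
  proof
    assume "AE x in lebesgue_on ?B. ?w x = 0"
    moreover have "AE x in lebesgue_on ?B. ?w x \<noteq> 0"
      using disk_eigenfunction_pos by (intro AE_I2) force
    ultimately have "AE x in lebesgue_on ?B. False" by eventually_elim simp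
    then have "emeasure (lebesgue_on ?B) (space (lebesgue_on ?B)) = 0"
      by (metis eventually_False ae_filter_eq_bot_iff)
    then have "emeasure lebesgue ?B = 0" by (simp add: emeasure_restrict_space)
    then have "negligible ?B" by (simp add: negligible_iff_null_sets null_setsI)
    then show False using R by (simp add: open_not_negligible)
  qed
  moreover have "(\<integral>x. ?W x \<bullet> grad \<phi> x \<partial>lebesgue_on ?B) = disk_eigenvalue R * (\<integral>x. ?w x * \<phi> x \<partial>lebesgue_on ?B)"
    if t: "test_function ?B \<phi>" for \<phi>
  proof -
    have s: "smooth \<phi>" using t by (rule test_function_smooth)
    \<comment> \<open>Integrating the divergence of \<open>\<phi> \<nabla>w\<close> produces the
      weak equation, because the divergence of \<open>\<nabla>w\<close> is
      \<open>- \<mu> w\<close>.\<close>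
    define X where "X x = \<phi> x *\<^sub>R ?W x" for x
    have sX: "smooth X" unfolding X_def[abs_def] by (intro smooth_scaleR s smooth_disk_eigenfield)
    have "(\<integral>x. divergence X x \<partial>lebesgue_on ?B) = 0"
      by (intro integral_divergence_zero smooth_differentiable smooth_continuous smooth_partial sX)
         (use test_function_zero[OF t] in \<open>simp add: X_def\<close>)
    moreover have "divergence X x = ?W x \<bullet> grad \<phi> x - disk_eigenvalue R * (?w x * \<phi> x)" for x
    proof -
      have "partial i X x = \<phi> x *\<^sub>R partial i ?W x + partial i \<phi> x *\<^sub>R ?W x" for i
        unfolding X_def[abs_def]
        by (rule partial_bilinear[OF bounded_bilinear_scaleR smooth_differentiable[OF s] smooth_differentiable[OF smooth_disk_eigenfield]])
      then have "divergence X x = \<phi> x * divergence ?W x + ?W x \<bullet> grad \<phi> x"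
        by (simp add: divergence_def sum.distrib sum_distrib_left inner_vec_def grad_def mult.commute)
      then show ?thesis by (simp add: divergence_disk_eigenfield)
    qed
    moreover have "integrable (lebesgue_on ?B) (\<lambda>x. ?W x \<bullet> grad \<phi> x)"
      by (intro in_L2_inner_integrable in_L2_smooth in_L2_grad s smooth_disk_eigenfield)
    moreover have "integrable (lebesgue_on ?B) (\<lambda>x. ?w x * \<phi> x)"
      using in_L2_inner_integrable[OF in_L2_smooth[OF smooth_disk_eigenfunction] in_L2_smooth[OF s]] by simp
    ultimately show ?thesis by simp
  qed
  ultimately show ?thesis
    unfolding dirichlet_eigenvalue_def using H10_disk_eigenfunction[OF R] by blast
qed

text \<open>Test functions approximating \<open>w\<close> turn the weak equation into equality of
  the squared L2 norm of \<open>g\<close> with \<open>\<mu>\<close> times that of \<open>w\<close>;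
  the Poincare inequality bounds the former from below.\<close>

lemma dirichlet_eigenvalue_ge:
  assumes "dirichlet_eigenvalue (ball 0 R) \<mu>"
  shows "disk_eigenvalue R \<le> \<mu>"
proof -
  let ?B = "ball (0::real^2) R"
  obtain w :: "real^2 \<Rightarrow> real" and g where w: "H10_with_grad ?B w g" "\<not> (AE x in lebesgue_on ?B. w x = 0)"
    "\<And>\<phi>. test_function ?B \<phi> \<Longrightarrow>
       (\<integral>x. g x \<bullet> grad \<phi> x \<partial>lebesgue_on ?B) = \<mu> * (\<integral>x. w x * \<phi> x \<partial>lebesgue_on ?B)"
    using assms unfolding dirichlet_eigenvalue_def by blast
  obtain \<phi> :: "nat \<Rightarrow> real^2 \<Rightarrow> real" where p: "\<And>n. test_function (ball 0 R) (\<phi> n)"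
    "(\<lambda>n. L2_norm_on (ball 0 R) (\<lambda>x. \<phi> n x - w x)) \<longlonglongrightarrow> 0"
    "(\<lambda>n. L2_norm_on (ball 0 R) (\<lambda>x. grad (\<phi> n) x - g x)) \<longlonglongrightarrow> 0"
    "\<And>n. in_L2 (ball 0 R) (\<phi> n)" "\<And>n. in_L2 (ball 0 R) (grad (\<phi> n))"
    "in_L2 (ball 0 R) w" "in_L2 (ball 0 R) g"
    by (rule H10_with_gradE[OF w(1)]) blast
  have "(\<lambda>n. \<integral>x. g x \<bullet> grad (\<phi> n) x \<partial>lebesgue_on ?B) \<longlonglongrightarrow> (\<integral>x. g x \<bullet> g x \<partial>lebesgue_on ?B)"
    by (intro L2_tendsto_inner p)
  moreover have "(\<lambda>n. \<mu> * (\<integral>x. w x \<bullet> \<phi> n x \<partial>lebesgue_on ?B)) \<longlonglongrightarrow> \<mu> * (\<integral>x. w x \<bullet> w x \<partial>lebesgue_on ?B)"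
    by (intro tendsto_intros L2_tendsto_inner p)
  ultimately have "(\<integral>x. g x \<bullet> g x \<partial>lebesgue_on ?B) = \<mu> * (\<integral>x. w x \<bullet> w x \<partial>lebesgue_on ?B)"
    using w(3)[OF p(1)] LIMSEQ_unique by simp
  then have "disk_eigenvalue R * (L2_norm_on ?B w)\<^sup>2 \<le> \<mu> * (L2_norm_on ?B w)\<^sup>2"
    using Poincare_H10[OF w(1)] unfolding L2_norm_on_power2 power2_norm_eq_inner by simp
  moreover have "(L2_norm_on ?B w)\<^sup>2 \<noteq> 0"
  proof
    assume "(L2_norm_on ?B w)\<^sup>2 = 0"
    then have "AE x in lebesgue_on ?B. (norm (w x))\<^sup>2 = 0"
      using p(6) unfolding L2_norm_on_power2 by (subst (asm) integral_nonneg_eq_0_iff_AE) (auto simp: in_L2_def)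
    then show False using w(2) by simp
  qed
  ultimately show ?thesis
    using mult_right_le_imp_le[of "disk_eigenvalue R" "(L2_norm_on ?B w)\<^sup>2" \<mu>] zero_le_power2[of "L2_norm_on ?B w"]
    by linarith
qed

lemma first_dirichlet_eigenvalue_disk:
  assumes "R > 0"
  shows "first_dirichlet_eigenvalue (ball 0 R) = disk_eigenvalue R"
  unfolding first_dirichlet_eigenvalue_def
  by (rule Least_equality) (use assms disk_eigenvalue_pos dirichlet_eigenvalue_disk dirichlet_eigenvalue_ge in blast)+

section \<open>Density of solenoidal test functions\<close>

lemma in_L2_integrable:
  assumes "in_L2 (ball 0 R) f" shows "integrable (lebesgue_on (ball 0 R)) f"
proof -
  interpret finite_measure "lebesgue_on (ball (0::real^2) R)" by (rule finite_measure_ball)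
  show ?thesis
  proof (rule Bochner_Integration.integrable_bound[where f="\<lambda>x. 1 + (norm (f x))\<^sup>2"])
    show "AE x in lebesgue_on (ball 0 R). norm (f x) \<le> norm (1 + (norm (f x))\<^sup>2)"
    proof (rule AE_I2)
      fix x
      have "2 * norm (f x) \<le> 1 + (norm (f x))\<^sup>2" using sum_squares_bound[of 1 "norm (f x)"] by simp
      then have "norm (f x) \<le> 1 + (norm (f x))\<^sup>2" using norm_ge_zero[of "f x"] by linarith
      then show "norm (f x) \<le> norm (1 + (norm (f x))\<^sup>2)" by simp
    qed
  qed (use assms in \<open>auto simp: in_L2_def\<close>)
qed

lemma integrable_bounded_scaleR:
  fixes f :: "'a \<Rightarrow> 'b::euclidean_space"
  assumes "a \<in> borel_measurable M" "\<And>x. x \<in> space M \<Longrightarrow> \<bar>a x\<bar> \<le> B" "integrable M f"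
  shows "integrable M (\<lambda>x. a x *\<^sub>R f x)"
proof (rule Bochner_Integration.integrable_bound[where f="\<lambda>x. B *\<^sub>R f x"])
  show "AE x in M. norm (a x *\<^sub>R f x) \<le> norm (B *\<^sub>R f x)"
  proof (rule AE_I2)
    fix x assume "x \<in> space M"
    then have "\<bar>a x\<bar> \<le> \<bar>B\<bar>" using assms(2)[of x] by linarith
    then show "norm (a x *\<^sub>R f x) \<le> norm (B *\<^sub>R f x)" by (simp add: mult_right_mono)
  qed
qed (use assms in auto)

lemma in_L2_bounded_scaleR:
  fixes f :: "real^2 \<Rightarrow> 'b::euclidean_space"
  assumes "a \<in> borel_measurable (lebesgue_on S)" "\<And>x. x \<in> S \<Longrightarrow> \<bar>a x\<bar> \<le> B" "in_L2 S f"
  shows "in_L2 S (\<lambda>x. a x *\<^sub>R f x)"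
proof -
  have "integrable (lebesgue_on S) (\<lambda>x. (a x)\<^sup>2 *\<^sub>R (norm (f x))\<^sup>2)"
  proof (rule integrable_bounded_scaleR[where B="B\<^sup>2"])
    fix x assume "x \<in> space (lebesgue_on S)"
    then have "\<bar>a x\<bar> \<le> B" using assms(2) by simp
    then have "\<bar>a x\<bar>\<^sup>2 \<le> B\<^sup>2" by (intro power_mono) auto
    then show "\<bar>(a x)\<^sup>2\<bar> \<le> B\<^sup>2" by simp
  qed (use assms in \<open>auto simp: in_L2_def\<close>)
  then show ?thesis using assms by (auto simp: in_L2_def power_mult_distrib intro!: borel_measurable_scaleR)
qed

lemma partial_norm_sum_le:
  fixes c :: "2 \<Rightarrow> 'b::real_normed_vector"
  assumes "\<And>i. norm (c i) \<le> B"
  shows "norm (\<Sum>i\<in>UNIV. (v $ i) *\<^sub>R c i) \<le> 2 * B * norm (v::real^2)"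
proof -
  have "norm (\<Sum>i\<in>UNIV. (v $ i) *\<^sub>R c i) \<le> (\<Sum>i\<in>(UNIV::2 set). norm v * B)"
    by (rule sum_norm_le) (simp add: mult_mono component_le_norm_cart assms)
  then show ?thesis by (simp add: mult_ac)
qed

lemma test_function_lipschitz:
  fixes \<phi> :: "real^2 \<Rightarrow> 'b::real_normed_vector"
  assumes t: "test_function S \<phi>"
  obtains L where "L \<ge> 0" "\<And>x y. norm (\<phi> x - \<phi> y) \<le> L * norm (x - y)"
proof -
  obtain B1 where B1: "B1 > 0" "\<And>x. norm (partial 1 \<phi> x) \<le> B1"
    using test_function_bounded[OF test_function_partial[OF t, of 1]] by metis
  obtain B2 where B2: "B2 > 0" "\<And>x. norm (partial 2 \<phi> x) \<le> B2"
    using test_function_bounded[OF test_function_partial[OF t, of 2]] by metis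
  have B: "norm (partial i \<phi> x) \<le> B1 + B2" for i x
    using B1(1) B2(1) B1(2)[of x] B2(2)[of x] exhaust_2[of i] by (smt (verit))
  have "norm (\<phi> x - \<phi> y) \<le> 2 * (B1 + B2) * norm (x - y)" for x y
  proof (rule differentiable_bound[of UNIV])
    show "(\<phi> has_derivative (\<lambda>h. \<Sum>i\<in>UNIV. (h $ i) *\<^sub>R partial i \<phi> x)) (at x within UNIV)" for x
      by (intro has_derivative_partials smooth_differentiable test_function_smooth[OF t])
    show "onorm (\<lambda>h. \<Sum>i\<in>UNIV. (h $ i) *\<^sub>R partial i \<phi> x) \<le> 2 * (B1 + B2)" for x
      by (rule onorm_le) (rule partial_norm_sum_le[OF B])
  qed auto
  then show ?thesis using that[of "2 * (B1 + B2)"] B1(1) B2(1) by simp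
qed

text \<open>Subtracting the linear part at \<open>y\<close> leaves a function whose derivative, on
  the ball of radius \<open>norm h\<close>, is at most a Lipschitz constant of the partial
  derivatives times \<open>norm h\<close>. The uniform constant permits differentiation under the
  integral in \<open>mollify_has_derivative\<close>, for \<open>f\<close> merely integrable.\<close>

lemma test_function_quadratic_remainder:
  fixes \<phi> :: "real^2 \<Rightarrow> 'b::real_normed_vector"
  assumes t: "test_function S \<phi>"
  obtains C where "C \<ge> 0"
    "\<And>y h. norm (\<phi> (y + h) - \<phi> y - (\<Sum>i\<in>UNIV. (h $ i) *\<^sub>R partial i \<phi> y)) \<le> C * (norm h)\<^sup>2"
proof -
  obtain L1 where L1: "L1 \<ge> 0" "\<And>x y. norm (partial 1 \<phi> x - partial 1 \<phi> y) \<le> L1 * norm (x - y)"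
    using test_function_lipschitz[OF test_function_partial[OF t, of 1]] by metis
  obtain L2 where L2: "L2 \<ge> 0" "\<And>x y. norm (partial 2 \<phi> x - partial 2 \<phi> y) \<le> L2 * norm (x - y)"
    using test_function_lipschitz[OF test_function_partial[OF t, of 2]] by metis
  have L: "norm (partial i \<phi> x - partial i \<phi> y) \<le> (L1 + L2) * norm (x - y)" for i x y
  proof -
    have "L1 * norm (x - y) \<le> (L1 + L2) * norm (x - y)" "L2 * norm (x - y) \<le> (L1 + L2) * norm (x - y)"
      using L1(1) L2(1) by (auto intro!: mult_right_mono)
    then show ?thesis using L1(2)[of x y] L2(2)[of x y] exhaust_2[of i] by (smt (verit))
  qed
  have "norm (\<phi> (y + h) - \<phi> y - (\<Sum>i\<in>UNIV. (h $ i) *\<^sub>R partial i \<phi> y)) \<le> 2 * (L1 + L2) * (norm h)\<^sup>2" for y h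
  proof -
    define g where "g t = \<phi> t - (\<Sum>i\<in>UNIV. (t $ i) *\<^sub>R partial i \<phi> y)" for t
    let ?g' = "\<lambda>t v. \<Sum>i\<in>UNIV. (v $ i) *\<^sub>R (partial i \<phi> t - partial i \<phi> y)"
    have "norm (g (y + h) - g y) \<le> (2 * ((L1 + L2) * norm h)) * norm (y + h - y)"
    proof (rule differentiable_bound[of "cball y (norm h)" g ?g'])
      fix t assume t1: "t \<in> cball y (norm h)"
      have "(g has_derivative (\<lambda>v. (\<Sum>i\<in>UNIV. (v $ i) *\<^sub>R partial i \<phi> t) - (\<Sum>i\<in>UNIV. (v $ i) *\<^sub>R partial i \<phi> y))) (at t)"
        unfolding g_def[abs_def]
        by (intro has_derivative_diff has_derivative_partials smooth_differentiable test_function_smooth[OF t]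
            has_derivative_sum has_derivative_scaleR_left bounded_linear_imp_has_derivative bounded_linear_vec_nth)
      moreover have "(\<lambda>v::real^2. (\<Sum>i\<in>UNIV. (v $ i) *\<^sub>R partial i \<phi> t) - (\<Sum>i\<in>UNIV. (v $ i) *\<^sub>R partial i \<phi> y)) = ?g' t"
        by (simp add: scaleR_diff_right sum_subtractf)
      ultimately have "(g has_derivative ?g' t) (at t)" by (simp only:)
      then show "(g has_derivative ?g' t) (at t within cball y (norm h))"
        by (rule has_derivative_at_withinI)
      have "norm (partial i \<phi> t - partial i \<phi> y) \<le> (L1 + L2) * norm h" for i
      proof -
        have "norm (t - y) \<le> norm h" using t1 by (simp add: dist_norm norm_minus_commute)
        then have "(L1 + L2) * norm (t - y) \<le> (L1 + L2) * norm h" using L1 L2 by (intro mult_left_mono) auto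
        then show ?thesis using L[of i t y] by linarith
      qed
      then show "onorm (?g' t) \<le> 2 * ((L1 + L2) * norm h)"
        by (intro onorm_le partial_norm_sum_le)
    qed (auto simp: dist_norm)
    moreover have "g (y + h) - g y = \<phi> (y + h) - \<phi> y - (\<Sum>i\<in>UNIV. (h $ i) *\<^sub>R partial i \<phi> y)"
      by (simp add: g_def scaleR_add_left sum.distrib)
    ultimately show ?thesis by (simp add: power2_eq_square mult_ac)
  qed
  then show ?thesis using that[of "2 * (L1 + L2)"] L1(1) L2(1) by simp
qed

text \<open>A convolution evaluated at \<open>\<theta> x\<close>, with \<open>f\<close> extended by
  zero. A plain convolution would leak out of the disk; with \<open>\<theta> > 1\<close> and a
  kernel of small enough radius the result is compactly supported inside, because the disk is
  star-shaped about its centre.\<close>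

definition mollify :: "real \<Rightarrow> real \<Rightarrow> (real^2 \<Rightarrow> real) \<Rightarrow> (real^2 \<Rightarrow> 'b::euclidean_space) \<Rightarrow> real^2 \<Rightarrow> 'b" where
  "mollify R \<theta> \<kappa> f x = (\<integral>z. \<kappa> (\<theta> *\<^sub>R x - z) *\<^sub>R f z \<partial>lebesgue_on (ball 0 R))"

lemma mollify_kernel_continuous: "test_function S \<kappa> \<Longrightarrow> continuous_on UNIV (\<lambda>z. \<kappa> (a - z))"
  by (rule continuous_on_compose2[of UNIV \<kappa>])
     (auto intro!: continuous_intros intro: smooth_continuous test_function_smooth)

lemma mollify_integrable:
  fixes f :: "real^2 \<Rightarrow> 'b::euclidean_space"
  assumes "test_function S \<kappa>" "integrable (lebesgue_on (ball 0 R)) f"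
  shows "integrable (lebesgue_on (ball 0 R)) (\<lambda>z. \<kappa> (a - z) *\<^sub>R f z)"
proof -
  obtain B where B: "\<And>x. norm (\<kappa> x) \<le> B" using test_function_bounded[OF assms(1)] by metis
  show ?thesis
    by (rule integrable_bounded_scaleR[where B=B])
       (use B assms in \<open>auto intro: borel_measurable_lebesgue_on_continuous mollify_kernel_continuous\<close>)
qed

lemma mollify_has_derivative:
  assumes t: "test_function S \<kappa>" and f: "integrable (lebesgue_on (ball 0 R)) f"
  shows "(mollify R \<theta> \<kappa> f has_derivative (\<lambda>h. \<Sum>i\<in>UNIV. (h $ i) *\<^sub>R (\<theta> *\<^sub>R mollify R \<theta> (partial i \<kappa>) f x))) (at x)"
proof -
  let ?M = "lebesgue_on (ball (0::real^2) R)"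
  let ?D = "\<lambda>h. \<Sum>i\<in>UNIV. (h $ i) *\<^sub>R (\<theta> *\<^sub>R mollify R \<theta> (partial i \<kappa>) f x)"
  obtain C where C: "C \<ge> 0"
    "\<And>y h. norm (\<kappa> (y + h) - \<kappa> y - (\<Sum>i\<in>UNIV. (h $ i) *\<^sub>R partial i \<kappa> y)) \<le> C * (norm h)\<^sup>2"
    using test_function_quadratic_remainder[OF t] by metis
  note int = mollify_integrable[OF t f] mollify_integrable[OF test_function_partial[OF t] f]
  define K where "K = C * \<theta>\<^sup>2 * (\<integral>z. norm (f z) \<partial>?M)"
  have b: "norm (mollify R \<theta> \<kappa> f y - mollify R \<theta> \<kappa> f x - ?D (y - x)) \<le> K * (norm (y - x))\<^sup>2" for y
  proof -
    let ?h = "y - x"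
    define r where "r z = \<kappa> (\<theta> *\<^sub>R y - z) - \<kappa> (\<theta> *\<^sub>R x - z) - (\<Sum>i\<in>UNIV. (\<theta> * (?h $ i)) *\<^sub>R partial i \<kappa> (\<theta> *\<^sub>R x - z))" for z
    have rb: "\<bar>r z\<bar> \<le> C * \<theta>\<^sup>2 * (norm ?h)\<^sup>2" for z
    proof -
      have "\<theta> *\<^sub>R y - z = (\<theta> *\<^sub>R x - z) + \<theta> *\<^sub>R ?h" by (simp add: algebra_simps)
      then show ?thesis
        using C(2)[of "\<theta> *\<^sub>R x - z" "\<theta> *\<^sub>R ?h"]
        by (simp only: r_def vector_scaleR_component real_scaleR_def real_norm_def norm_scaleR power_mult_distrib power2_abs mult.assoc)
    qed
    have rf: "(\<lambda>z. r z *\<^sub>R f z) = (\<lambda>z. \<kappa> (\<theta> *\<^sub>R y - z) *\<^sub>R f z - \<kappa> (\<theta> *\<^sub>R x - z) *\<^sub>R f z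
        - (\<Sum>i\<in>UNIV. (\<theta> * (?h $ i)) *\<^sub>R (partial i \<kappa> (\<theta> *\<^sub>R x - z) *\<^sub>R f z)))"
      by (simp add: r_def scaleR_diff_left scaleR_sum_left)
    have irf: "integrable ?M (\<lambda>z. r z *\<^sub>R f z)"
      unfolding rf by (intro Bochner_Integration.integrable_diff Bochner_Integration.integrable_sum integrable_scaleR_right int)
    have "mollify R \<theta> \<kappa> f y - mollify R \<theta> \<kappa> f x - ?D ?h = (\<integral>z. r z *\<^sub>R f z \<partial>?M)"
    proof -
      have "?D ?h = (\<Sum>i\<in>UNIV. (\<theta> * (?h $ i)) *\<^sub>R mollify R \<theta> (partial i \<kappa>) f x)"
        by (simp add: mult.commute)
      then show ?thesis unfolding rf mollify_def using int by (simp del: scaleR_scaleR)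
    qed
    also have "norm \<dots> \<le> (\<integral>z. norm (r z *\<^sub>R f z) \<partial>?M)" by (rule integral_norm_bound)
    also have "\<dots> \<le> (\<integral>z. C * \<theta>\<^sup>2 * (norm ?h)\<^sup>2 * norm (f z) \<partial>?M)"
      by (intro integral_mono integrable_norm irf integrable_mult_right f) (simp add: mult_right_mono rb)
    also have "\<dots> = K * (norm ?h)\<^sup>2" by (simp add: K_def)
    finally show ?thesis .
  qed
  have bl: "bounded_linear ?D"
    by (intro bounded_linear_sum bounded_linear_compose[OF bounded_linear_scaleR_left bounded_linear_vec_nth])
  have "((\<lambda>y. norm (mollify R \<theta> \<kappa> f y - mollify R \<theta> \<kappa> f x - ?D (y - x)) / norm (y - x)) \<longlongrightarrow> 0) (at x)"
  proof (rule Lim_null_comparison)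
    show "\<forall>\<^sub>F y in at x. norm (norm (mollify R \<theta> \<kappa> f y - mollify R \<theta> \<kappa> f x - ?D (y - x)) / norm (y - x)) \<le> K * norm (y - x)"
      using b by (intro always_eventually allI) (auto simp: divide_le_eq power2_eq_square mult.assoc zero_less_mult_iff)
    show "((\<lambda>y. K * norm (y - x)) \<longlongrightarrow> 0) (at x)"
      by (auto intro!: tendsto_eq_intros)
  qed
  then show ?thesis using bl by (simp add: has_derivative_iff_norm)
qed

lemma partial_mollify:
  assumes "test_function S \<kappa>" "integrable (lebesgue_on (ball 0 R)) f"
  shows "partial i (mollify R \<theta> \<kappa> f) x = \<theta> *\<^sub>R mollify R \<theta> (partial i \<kappa>) f x"
  using partial_eq[OF mollify_has_derivative[OF assms], of i]
  using exhaust_2[of i] by (auto simp: axis_def sum_2)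

lemma smooth_mollify:
  assumes "test_function S \<kappa>" "integrable (lebesgue_on (ball 0 R)) f"
  shows "smooth (mollify R \<theta> \<kappa> f)"
proof -
  have "Ck k (mollify R \<theta> \<kappa> f)" for k
    using assms(1)
  proof (induction k arbitrary: \<kappa>)
    case 0
    then show ?case
      using has_derivative_continuous[OF mollify_has_derivative[OF 0 assms(2)]]
      unfolding Ck.simps by (intro continuous_at_imp_continuous_on ballI)
  next
    case (Suc k)
    have "partial i (mollify R \<theta> \<kappa> f) = (\<lambda>x. \<theta> *\<^sub>R mollify R \<theta> (partial i \<kappa>) f x)" for i
      by (intro ext partial_mollify[OF Suc.prems assms(2)])
    moreover have "Ck k (\<lambda>x. \<theta> *\<^sub>R mollify R \<theta> (partial i \<kappa>) f x)" for i
      by (intro Ck_linear[OF bounded_linear_scaleR_right] Suc.IH test_function_partial Suc.prems)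
    ultimately show ?case
      using differentiableI[OF mollify_has_derivative[OF Suc.prems assms(2)]] unfolding Ck.simps by simp
  qed
  then show ?thesis by (simp add: smooth_def)
qed

definition mollifier_mass :: "real \<Rightarrow> real" where
  "mollifier_mass \<delta> = (\<integral>x. cutoff (1 - (norm (x::real^2))\<^sup>2 / \<delta>\<^sup>2) \<partial>lborel)"

definition mollifier :: "real \<Rightarrow> real^2 \<Rightarrow> real" where
  "mollifier \<delta> x = cutoff (1 - (norm x)\<^sup>2 / \<delta>\<^sup>2) / mollifier_mass \<delta>"

lemma cutoff_mono: "s \<le> t \<Longrightarrow> cutoff s \<le> cutoff t"
  by (auto simp: cutoff_eq divide_left_mono)

lemma test_function_cutoff_ball:
  assumes "\<delta> > 0" shows "test_function UNIV (\<lambda>x::real^2. cutoff (1 - (norm x)\<^sup>2 / \<delta>\<^sup>2))"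
proof (rule test_functionI[of _ "cball 0 \<delta>"])
  have "smooth (\<lambda>x::real^2. cutoff (1 - (norm x)\<^sup>2 * (1 / \<delta>\<^sup>2)))"
    by (intro smooth_cutoff smooth_diff smooth_mult smooth_const smooth_norm_square)
  then show "smooth (\<lambda>x::real^2. cutoff (1 - (norm x)\<^sup>2 / \<delta>\<^sup>2))" by simp
  show "cutoff (1 - (norm x)\<^sup>2 / \<delta>\<^sup>2) = 0" if "x \<notin> cball 0 \<delta>" for x :: "real^2"
  proof -
    have "\<delta>\<^sup>2 \<le> (norm x)\<^sup>2" using that assms by (intro power_mono) auto
    then have "1 - (norm x)\<^sup>2 / \<delta>\<^sup>2 \<le> 0" using assms by simp
    then show ?thesis unfolding cutoff_eq by simp
  qed
qed auto

lemma integrable_cutoff_ball: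
  assumes "\<delta> > 0" shows "integrable lborel (\<lambda>x::real^2. cutoff (1 - (norm x)\<^sup>2 / \<delta>\<^sup>2))"
proof (rule continuous_compact_support_integrable[of _ \<delta>])
  show "continuous_on UNIV (\<lambda>x::real^2. cutoff (1 - (norm x)\<^sup>2 / \<delta>\<^sup>2))"
    by (intro smooth_continuous test_function_smooth[OF test_function_cutoff_ball[OF assms]])
  show "cutoff (1 - (norm x)\<^sup>2 / \<delta>\<^sup>2) = 0" if "norm x > \<delta>" for x :: "real^2"
  proof -
    have "\<delta>\<^sup>2 \<le> (norm x)\<^sup>2" using that assms by (intro power_mono) auto
    then have "1 - (norm x)\<^sup>2 / \<delta>\<^sup>2 \<le> 0" using assms by simp
    then show ?thesis unfolding cutoff_eq by simp
  qed
qed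

lemma mollifier_mass_pos:
  assumes "\<delta> > 0" shows "mollifier_mass \<delta> > 0"
proof -
  let ?A = "ball (0::real^2) (\<delta> / 2)"
  have "0 < cutoff (3/4) * measure lborel ?A"
    using content_ball_pos[of "\<delta> / 2" "0::real^2"] assms by (simp add: cutoff_eq)
  also have "\<dots> = (\<integral>x. cutoff (3/4) * indicator ?A x \<partial>lborel)" by simp
  also have "\<dots> \<le> mollifier_mass \<delta>"
    unfolding mollifier_mass_def
  proof (rule integral_mono[OF _ integrable_cutoff_ball[OF assms]])
    show "integrable lborel (\<lambda>x. cutoff (3/4) * indicator ?A x :: real)"
      by (intro integrable_mult_right integrable_real_indicator) (auto simp: emeasure_bounded_finite[simplified])
    show "cutoff (3/4) * indicator ?A x \<le> cutoff (1 - (norm x)\<^sup>2 / \<delta>\<^sup>2)" for x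
    proof (cases "x \<in> ?A")
      case True
      then have "(norm x)\<^sup>2 \<le> (\<delta> / 2)\<^sup>2" by (intro power_mono) auto
      then have "3/4 \<le> 1 - (norm x)\<^sup>2 / \<delta>\<^sup>2" using assms by (simp add: field_simps power2_eq_square)
      then show ?thesis using True cutoff_mono by simp
    qed (simp add: cutoff_bounds)
  qed
  finally show ?thesis .
qed

lemma test_function_mollifier:
  assumes "\<delta> > 0" shows "test_function UNIV (mollifier \<delta>)"
proof -
  obtain K where "compact K" "\<And>x. x \<notin> K \<Longrightarrow> cutoff (1 - (norm (x::real^2))\<^sup>2 / \<delta>\<^sup>2) = 0"
    using test_functionE[OF test_function_cutoff_ball[OF assms]] by metis
  moreover have "smooth (\<lambda>x::real^2. cutoff (1 - (norm x)\<^sup>2 / \<delta>\<^sup>2) * (1 / mollifier_mass \<delta>))"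
    by (intro smooth_mult smooth_const test_function_smooth[OF test_function_cutoff_ball[OF assms]])
  ultimately show ?thesis
    by (intro test_functionI[of _ K]) (auto simp: mollifier_def[abs_def])
qed

lemma mollifier_nonneg: "\<delta> > 0 \<Longrightarrow> 0 \<le> mollifier \<delta> x"
  by (simp add: mollifier_def cutoff_bounds mollifier_mass_pos less_imp_le)

lemma mollifier_zero:
  assumes "\<delta> > 0" "norm x \<ge> \<delta>" shows "mollifier \<delta> x = 0"
proof -
  have "\<delta>\<^sup>2 \<le> (norm x)\<^sup>2" using assms by (intro power_mono) auto
  then have "1 - (norm x)\<^sup>2 / \<delta>\<^sup>2 \<le> 0" using assms by simp
  then have "cutoff (1 - (norm x)\<^sup>2 / \<delta>\<^sup>2) = 0" unfolding cutoff_eq by simp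
  then show ?thesis by (simp add: mollifier_def)
qed

lemma has_bochner_integral_translate:
  fixes f :: "real^2 \<Rightarrow> 'b::euclidean_space"
  assumes "integrable lborel f"
  shows "has_bochner_integral lborel (\<lambda>x. f (x - c)) (\<integral>x. f x \<partial>lborel)"
proof -
  have "has_bochner_integral (distr lborel borel ((+) (- c))) f (\<integral>x. f x \<partial>lborel)"
    by (metis assms lborel_distr_plus has_bochner_integral_integrable)
  then show ?thesis
    using borel_measurable_integrable[OF assms]
    by (simp add: has_bochner_integral_iff integrable_distr_eq integral_distr)
qed

lemma mollifier_integral:
  assumes "\<delta> > 0"
  shows "has_bochner_integral lborel (\<lambda>z. mollifier \<delta> (z - a)) 1"
proof -
  have "has_bochner_integral lborel (mollifier \<delta>) 1"
    using integrable_cutoff_ball[OF assms] mollifier_mass_pos[OF assms]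
    by (simp add: has_bochner_integral_iff mollifier_def[abs_def] mollifier_mass_def[symmetric])
  then show ?thesis using has_bochner_integral_translate[of "mollifier \<delta>" a]
    by (simp add: has_bochner_integral_iff)
qed

lemma mollifier_minus: "mollifier \<delta> (a - z) = mollifier \<delta> (z - a)"
  by (simp add: mollifier_def norm_minus_commute)

lemma integral_ball_le:
  fixes f :: "real^2 \<Rightarrow> real"
  assumes "integrable lborel f" "\<And>x. 0 \<le> f x"
  shows "(\<integral>x. f x \<partial>lebesgue_on (ball 0 R)) \<le> (\<integral>x. f x \<partial>lborel)"
proof -
  have i: "integrable lebesgue f" using assms(1) by (simp add: integrable_completion)
  have "(\<integral>x. f x \<partial>lebesgue_on (ball 0 R)) = (\<integral>x. indicator (ball 0 R) x *\<^sub>R f x \<partial>lebesgue)"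
    by (intro integral_restrict_space) auto
  also have "\<dots> \<le> (\<integral>x. f x \<partial>lebesgue)"
    by (intro integral_mono integrable_mult_indicator i) (auto simp: indicator_def assms(2))
  also have "\<dots> = (\<integral>x. f x \<partial>lborel)" using assms(1) by (simp add: integral_completion)
  finally show ?thesis .
qed

lemma mollifier_mass_fst:
  assumes "\<delta> > 0" shows "(\<integral>z. mollifier \<delta> (a - z) \<partial>lebesgue_on (ball 0 R)) \<le> 1"
  using integral_ball_le[of "\<lambda>z. mollifier \<delta> (z - a)"] mollifier_integral[OF assms, of a] mollifier_nonneg[OF assms]
  by (simp add: has_bochner_integral_iff mollifier_minus)

text \<open>Factoring out \<open>\<theta> \<ge> 1\<close> shows that \<open>\<theta> x - z\<close>
  is at least as long as \<open>x - z / \<theta>\<close>. The mollifier decreases with the distance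
  from 0, so its translate by \<open>z / \<theta>\<close>, of mass 1, dominates.\<close>

lemma mollifier_mass_snd:
  assumes "\<delta> > 0" "\<theta> \<ge> 1" shows "(\<integral>x. mollifier \<delta> (\<theta> *\<^sub>R x - z) \<partial>lebesgue_on (ball 0 R)) \<le> 1"
proof -
  have le: "mollifier \<delta> (\<theta> *\<^sub>R x - z) \<le> mollifier \<delta> (x - (1 / \<theta>) *\<^sub>R z)" for x
  proof -
    have "\<theta> *\<^sub>R x - z = \<theta> *\<^sub>R (x - (1 / \<theta>) *\<^sub>R z)" using assms by (simp add: scaleR_diff_right)
    then have "norm (\<theta> *\<^sub>R x - z) = \<theta> * norm (x - (1 / \<theta>) *\<^sub>R z)" using assms(2) by simp
    then have "norm (x - (1 / \<theta>) *\<^sub>R z) \<le> norm (\<theta> *\<^sub>R x - z)"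
      using mult_right_mono[OF assms(2) norm_ge_zero[of "x - (1 / \<theta>) *\<^sub>R z"]] by simp
    then have "(norm (x - (1 / \<theta>) *\<^sub>R z))\<^sup>2 \<le> (norm (\<theta> *\<^sub>R x - z))\<^sup>2" by (intro power_mono) auto
    then show ?thesis
      unfolding mollifier_def using assms mollifier_mass_pos[OF assms(1)]
      by (intro divide_right_mono cutoff_mono diff_left_mono) auto
  qed
  have m: "continuous_on UNIV (mollifier \<delta>)" using smooth_continuous[OF test_function_smooth[OF test_function_mollifier[OF assms(1)]]] .
  have c: "continuous_on UNIV (\<lambda>x. mollifier \<delta> (\<theta> *\<^sub>R x - z))"
    by (rule continuous_on_compose2[OF m]) (auto intro!: continuous_intros)
  have i: "integrable lborel (\<lambda>x. mollifier \<delta> (\<theta> *\<^sub>R x - z))"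
    by (rule Bochner_Integration.integrable_bound[where f="\<lambda>x. mollifier \<delta> (x - (1 / \<theta>) *\<^sub>R z)"])
      (use mollifier_integral[OF assms(1)] le mollifier_nonneg[OF assms(1)] borel_measurable_continuous_onI[OF c]
        in \<open>auto simp: has_bochner_integral_iff\<close>)
  have "(\<integral>x. mollifier \<delta> (\<theta> *\<^sub>R x - z) \<partial>lebesgue_on (ball 0 R)) \<le> (\<integral>x. mollifier \<delta> (\<theta> *\<^sub>R x - z) \<partial>lborel)"
    by (intro integral_ball_le i mollifier_nonneg assms)
  also have "\<dots> \<le> (\<integral>x. mollifier \<delta> (x - (1 / \<theta>) *\<^sub>R z) \<partial>lborel)"
    by (rule integral_mono) (use i le mollifier_integral[OF assms(1)] in \<open>auto simp: has_bochner_integral_iff\<close>)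
  also have "\<dots> = 1" using mollifier_integral[OF assms(1)] by (simp add: has_bochner_integral_iff)
  finally show ?thesis .
qed

lemma measurable_id_lebesgue_on: "(\<lambda>x. x) \<in> measurable (lebesgue_on (A :: 'a::euclidean_space set)) borel"
  by (intro measurable_restrict_space1 measurable_completion) simp

lemma borel_measurable_pair_lebesgue_on:
  fixes f :: "'a::euclidean_space \<times> 'c::euclidean_space \<Rightarrow> 'b::topological_space"
  assumes "f \<in> borel_measurable borel"
  shows "f \<in> borel_measurable (lebesgue_on A \<Otimes>\<^sub>M lebesgue_on B)"
proof -
  have "(\<lambda>z. (fst z, snd z)) \<in> measurable (lebesgue_on A \<Otimes>\<^sub>M lebesgue_on B) (borel \<Otimes>\<^sub>M borel)"
    by (intro measurable_Pair measurable_compose[OF measurable_fst measurable_id_lebesgue_on]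
        measurable_compose[OF measurable_snd measurable_id_lebesgue_on])
  then show ?thesis using assms measurable_compose by (fastforce simp: borel_prod)
qed

text \<open>Schur's test: the kernel is split into two square roots, Cauchy-Schwarz uses its mass in
  \<open>z\<close>, and after the exchange of the integrals its mass in \<open>x\<close> enters.
  Both masses are at most 1, uniformly in \<open>\<delta>\<close> and
  \<open>\<theta>\<close>.\<close>

lemma mollify_L2_le:
  fixes f :: "real^2 \<Rightarrow> 'b::euclidean_space"
  assumes d: "\<delta> > 0" and l: "\<theta> \<ge> 1" and f: "in_L2 (ball 0 R) f"
  shows "L2_norm_on (ball 0 R) (mollify R \<theta> (mollifier \<delta>) f) \<le> L2_norm_on (ball 0 R) f"
proof -
  let ?M = "lebesgue_on (ball (0::real^2) R)" and ?k = "mollifier \<delta>"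
  interpret M: finite_measure ?M by (rule finite_measure_ball)
  interpret P: pair_sigma_finite ?M ?M ..
  have t: "test_function UNIV ?k" by (rule test_function_mollifier[OF d])
  have kc: "continuous_on UNIV ?k" by (rule smooth_continuous[OF test_function_smooth[OF t]])
  obtain B where B: "\<And>x. norm (?k x) \<le> B" using test_function_bounded[OF t] by metis
  have fi: "integrable ?M f" by (rule in_L2_integrable[OF f])
  have f2: "integrable ?M (\<lambda>z. (norm (f z))\<^sup>2)" using f by (simp add: in_L2_def)
  have i1: "integrable ?M (\<lambda>z. ?k (a - z) * (norm (f z))\<^sup>2)" for a
    using mollify_integrable[OF t f2] by simp
  have pt: "(norm (mollify R \<theta> ?k f x))\<^sup>2 \<le> (\<integral>z. ?k (\<theta> *\<^sub>R x - z) * (norm (f z))\<^sup>2 \<partial>?M)" for x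
  proof -
    define a where "a z = sqrt (?k (\<theta> *\<^sub>R x - z))" for z
    have ka: "?k (\<theta> *\<^sub>R x - z) = a z * a z" for z using mollifier_nonneg[OF d] by (simp add: a_def)
    have ac: "continuous_on UNIV a" unfolding a_def[abs_def]
      by (intro continuous_intros mollify_kernel_continuous[OF t])
    have ab: "\<bar>a z\<bar> \<le> sqrt B" for z using B[of "\<theta> *\<^sub>R x - z"] mollifier_nonneg[OF d] by (simp add: a_def)
    have L: "in_L2 (ball 0 R) (\<lambda>z. norm (f z))" using f by (auto simp: in_L2_def)
    have La: "in_L2 (ball 0 R) a" by (rule in_L2_continuous[OF ac])
    have Laf: "in_L2 (ball 0 R) (\<lambda>z. a z *\<^sub>R norm (f z))"
      by (intro in_L2_bounded_scaleR[of _ _ "sqrt B"] borel_measurable_lebesgue_on_continuous ac ab L)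
    have "norm (mollify R \<theta> ?k f x) \<le> (\<integral>z. norm (?k (\<theta> *\<^sub>R x - z) *\<^sub>R f z) \<partial>?M)"
      unfolding mollify_def by (rule integral_norm_bound)
    also have "\<dots> = (\<integral>z. a z \<bullet> (a z *\<^sub>R norm (f z)) \<partial>?M)"
      by (simp add: ka abs_mult_self_eq mult.assoc)
    also have "\<dots> \<le> L2_norm_on (ball 0 R) a * L2_norm_on (ball 0 R) (\<lambda>z. a z *\<^sub>R norm (f z))"
      using L2_Cauchy_Schwarz[OF La Laf] by linarith
    finally have "(norm (mollify R \<theta> ?k f x))\<^sup>2 \<le> (L2_norm_on (ball 0 R) a * L2_norm_on (ball 0 R) (\<lambda>z. a z *\<^sub>R norm (f z)))\<^sup>2"
      by (intro power_mono) auto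
    also have "\<dots> = (\<integral>z. ?k (\<theta> *\<^sub>R x - z) \<partial>?M) * (\<integral>z. ?k (\<theta> *\<^sub>R x - z) * (norm (f z))\<^sup>2 \<partial>?M)"
      by (simp add: power_mult_distrib L2_norm_on_power2 ka flip: power2_eq_square)
    also have "\<dots> \<le> 1 * (\<integral>z. ?k (\<theta> *\<^sub>R x - z) * (norm (f z))\<^sup>2 \<partial>?M)"
      by (intro mult_right_mono mollifier_mass_fst d integral_nonneg_AE) (simp add: mollifier_nonneg[OF d])
    finally show ?thesis by simp
  qed
  define F where "F = (\<lambda>(x, z). ?k (\<theta> *\<^sub>R x - z) * (norm (f z))\<^sup>2)"
  have Fm: "F \<in> borel_measurable (?M \<Otimes>\<^sub>M ?M)"
  proof -
    have "continuous_on UNIV (\<lambda>p::(real^2)\<times>(real^2). ?k (\<theta> *\<^sub>R fst p - snd p))"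
      by (rule continuous_on_compose2[OF kc]) (auto intro!: continuous_intros)
    from borel_measurable_pair_lebesgue_on[OF borel_measurable_continuous_onI[OF this]]
    have "(\<lambda>p. ?k (\<theta> *\<^sub>R fst p - snd p)) \<in> borel_measurable (?M \<Otimes>\<^sub>M ?M)" .
    moreover have "(\<lambda>p. (norm (f (snd p)))\<^sup>2) \<in> borel_measurable (?M \<Otimes>\<^sub>M ?M)"
      by (rule measurable_compose[OF measurable_snd borel_measurable_integrable[OF f2]])
    ultimately show ?thesis unfolding F_def case_prod_beta by (rule borel_measurable_times)
  qed
  have Fn: "F p \<ge> 0" for p by (simp add: F_def case_prod_beta mollifier_nonneg[OF d])
  have Fi: "integrable (?M \<Otimes>\<^sub>M ?M) F"
  proof (rule P.Fubini_integrable[OF Fm])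
    show "integrable ?M (\<lambda>x. \<integral>y. norm (F (x, y)) \<partial>?M)"
    proof (rule M.integrable_const_bound[of _ "B * (\<integral>z. (norm (f z))\<^sup>2 \<partial>?M)"])
      show "(\<lambda>x. \<integral>y. norm (F (x, y)) \<partial>?M) \<in> borel_measurable ?M"
      proof -
        have "(\<lambda>(x, y). norm (F (x, y))) = (\<lambda>p. norm (F p))" by auto
        then have "(\<lambda>(x, y). norm (F (x, y))) \<in> borel_measurable (?M \<Otimes>\<^sub>M ?M)" using Fm by simp
        then show ?thesis by (rule M.borel_measurable_lebesgue_integral)
      qed
      show "AE x in ?M. norm (\<integral>y. norm (F (x, y)) \<partial>?M) \<le> B * (\<integral>z. (norm (f z))\<^sup>2 \<partial>?M)"
      proof (rule AE_I2)
        fix x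
        have "(\<integral>y. norm (F (x, y)) \<partial>?M) \<le> (\<integral>z. B * (norm (f z))\<^sup>2 \<partial>?M)"
          using i1 f2 B by (intro integral_mono) (auto simp: F_def abs_mult mollifier_nonneg[OF d] intro!: mult_right_mono)
        then show "norm (\<integral>y. norm (F (x, y)) \<partial>?M) \<le> B * (\<integral>z. (norm (f z))\<^sup>2 \<partial>?M)"
          by simp
      qed
    qed
    show "AE x in ?M. integrable ?M (\<lambda>y. F (x, y))" using i1 by (simp add: F_def)
  qed
  have "(L2_norm_on (ball 0 R) (mollify R \<theta> ?k f))\<^sup>2 = (\<integral>x. (norm (mollify R \<theta> ?k f x))\<^sup>2 \<partial>?M)"
    by (rule L2_norm_on_power2)
  also have "\<dots> \<le> (\<integral>x. (\<integral>z. F (x, z) \<partial>?M) \<partial>?M)"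
  proof (rule integral_mono)
    show "integrable ?M (\<lambda>x. (norm (mollify R \<theta> ?k f x))\<^sup>2)"
      using in_L2_smooth[OF smooth_mollify[OF t fi]] by (simp add: in_L2_def)
    show "integrable ?M (\<lambda>x. \<integral>z. F (x, z) \<partial>?M)" by (rule P.integrable_fst'[OF Fi])
  qed (use pt in \<open>simp add: F_def\<close>)
  also have "\<dots> = (\<integral>z. (\<integral>x. F (x, z) \<partial>?M) \<partial>?M)"
    using P.Fubini_integral[of "\<lambda>x z. F (x, z)"] Fi by simp
  also have "\<dots> \<le> (\<integral>z. (norm (f z))\<^sup>2 \<partial>?M)"
  proof (rule integral_mono[OF _ f2])
    show "integrable ?M (\<lambda>z. \<integral>x. F (x, z) \<partial>?M)"
      using P.integrable_snd[of "\<lambda>x z. F (x, z)"] Fi by simp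
    show "(\<integral>x. F (x, z) \<partial>?M) \<le> (norm (f z))\<^sup>2" for z
      using mult_right_mono[OF mollifier_mass_snd[OF d l, where z=z and R=R], of "(norm (f z))\<^sup>2"] by (simp add: F_def)
  qed
  also have "\<dots> = (L2_norm_on (ball 0 R) f)\<^sup>2" by (rule L2_norm_on_power2[symmetric])
  finally show ?thesis by (rule power2_le_imp_le) simp
qed

section \<open>Integration by parts against kernels, with zero boundary values\<close>

lemma partial_reflect:
  assumes "f differentiable (at (a - z))"
  shows "partial i (\<lambda>z. f (a - z)) z = - partial i f (a - z)"
proof -
  let ?f' = "frechet_derivative f (at (a - z))"
  have "((\<lambda>z. a - z) has_derivative (\<lambda>h. 0 - h)) (at z)" by (intro derivative_intros)
  from has_derivative_compose[OF this assms[THEN frechet_derivative_works[THEN iffD1]]]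
  have "partial i (\<lambda>z. f (a - z)) z = ?f' (0 - axis i 1)" by (rule partial_eq)
  also have "\<dots> = - ?f' (axis i 1)"
    using linear_neg[OF linear_frechet_derivative[OF assms]] by simp
  finally show ?thesis by (simp add: partial_def)
qed

lemma Ck_reflect: "Ck k f \<Longrightarrow> Ck k (\<lambda>z. f (a - z))"
proof (induction k arbitrary: f)
  case 0
  then have "continuous_on UNIV f" by simp
  then show ?case unfolding Ck.simps by (rule continuous_on_compose2) (auto intro!: continuous_intros)
next
  case (Suc k)
  then have d: "f differentiable (at x)" for x by simp
  have "(\<lambda>z. f (a - z)) differentiable (at z)" for z
  proof -
    have "((\<lambda>z. a - z) has_derivative (\<lambda>h. 0 - h)) (at z)" by (intro derivative_intros)
    from has_derivative_compose[OF this d[THEN frechet_derivative_works[THEN iffD1]]]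
    show ?thesis by (rule differentiableI)
  qed
  moreover have "partial i (\<lambda>z. f (a - z)) = (\<lambda>z. - partial i f (a - z))" for i
    by (intro ext partial_reflect d)
  moreover have "Ck k (\<lambda>z. - partial i f (a - z))" for i
    using Suc by (intro Ck_linear[OF bounded_linear_minus[OF bounded_linear_ident]]) auto
  ultimately show ?case by simp
qed

lemma smooth_reflect: "smooth f \<Longrightarrow> smooth (\<lambda>z. f (a - z))"
  by (simp add: smooth_def Ck_reflect)

lemma test_function_smooth_scaleR:
  assumes "smooth q" "test_function S \<phi>"
  shows "test_function S (\<lambda>x. q x *\<^sub>R \<phi> x)"
proof -
  obtain K where "compact K" "K \<subseteq> S" "\<And>x. x \<notin> K \<Longrightarrow> \<phi> x = 0" using test_functionE[OF assms(2)] by metis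
  then show ?thesis
    by (intro test_functionI[of _ K] smooth_scaleR assms test_function_smooth[OF assms(2)]) auto
qed

lemma integral_partial_test_function:
  fixes \<phi> :: "real^2 \<Rightarrow> 'b::euclidean_space"
  assumes t: "test_function (ball 0 R) \<phi>"
  shows "(\<integral>x. partial i \<phi> x \<partial>lebesgue_on (ball 0 R)) = 0"
proof (rule euclidean_eqI)
  fix b :: 'b assume "b \<in> Basis"
  have s: "smooth \<phi>" by (rule test_function_smooth[OF t])
  have z: "partial i \<phi> x = 0" if "x \<notin> ball 0 R" for x
    by (rule test_function_zero[OF test_function_partial[OF t] that])
  have c: "continuous_on UNIV (partial i \<phi>)" by (intro smooth_continuous smooth_partial s)
  have p: "partial i (\<lambda>x. \<phi> x \<bullet> b) = (\<lambda>x. partial i \<phi> x \<bullet> b)"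
    by (intro ext partial_linear[OF bounded_linear_inner_left] smooth_differentiable s)
  have "(\<integral>x. partial i \<phi> x \<partial>lebesgue_on (ball 0 R)) = (\<integral>x. partial i \<phi> x \<partial>lborel)"
    by (intro integral_lebesgue_on_zero_outside borel_measurable_continuous_onI c z) auto
  moreover have "(\<integral>x. partial i \<phi> x \<partial>lborel) \<bullet> b = (\<integral>x. partial i \<phi> x \<bullet> b \<partial>lborel)"
  proof -
    have "integrable lborel (partial i \<phi>)"
      by (rule continuous_compact_support_integrable[OF c, of R]) (simp add: z)
    then show ?thesis by simp
  qed
  moreover have "(\<integral>x. partial i (\<lambda>x. \<phi> x \<bullet> b) x \<partial>lborel) = 0"
  proof (rule integral_partial_zero[where r=R])
    show "(\<lambda>x. \<phi> x \<bullet> b) differentiable (at x)" for x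
      by (intro differentiable_linear[OF bounded_linear_inner_left] smooth_differentiable s)
    show "continuous_on UNIV (partial i (\<lambda>x. \<phi> x \<bullet> b))" unfolding p by (intro continuous_intros c)
    show "\<phi> x \<bullet> b = 0" if "norm x > R" for x using test_function_zero[OF t, of x] that by simp
  qed
  ultimately show "(\<integral>x. partial i \<phi> x \<partial>lebesgue_on (ball 0 R)) \<bullet> b = 0 \<bullet> b" by (simp add: p)
qed

lemma divergence_scaleR:
  assumes "q differentiable (at x)" "\<phi> differentiable (at x)"
  shows "divergence (\<lambda>x. q x *\<^sub>R \<phi> x) x = q x * divergence \<phi> x + \<phi> x \<bullet> grad q x"
  using partial_bilinear[OF bounded_bilinear_scaleR assms]
  by (simp add: divergence_def sum.distrib sum_distrib_left inner_vec_def grad_def mult.commute)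

text \<open>The inner product with the identity matrix is the trace. In this form a multiple of the
  divergence becomes an L2 pairing with the gradient, to which convergence of gradients applies and
  which makes sense for the weak gradient of a limit.\<close>

lemma divergence_eq_grad_inner: "grad \<phi> x \<bullet> (c *\<^sub>R mat 1) = c * divergence \<phi> x"
  by (simp add: grad_def divergence_def inner_vec_def mat_def sum_2 algebra_simps)

lemma test_function_integral_by_parts:
  assumes t: "test_function (ball 0 R) \<phi>" and q: "smooth q"
  shows "(\<integral>x. \<phi> x \<bullet> grad q x \<partial>lebesgue_on (ball 0 R)) = - (\<integral>x. grad \<phi> x \<bullet> (q x *\<^sub>R mat 1) \<partial>lebesgue_on (ball 0 R))"
proof -
  let ?M = "lebesgue_on (ball (0::real^2) R)"
  have s: "smooth \<phi>" by (rule test_function_smooth[OF t])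
  have T: "test_function (ball 0 R) (\<lambda>x. q x *\<^sub>R \<phi> x)" by (rule test_function_smooth_scaleR[OF q t])
  have "(\<integral>x. divergence (\<lambda>x. q x *\<^sub>R \<phi> x) x \<partial>?M) = 0"
    by (intro integral_divergence_zero smooth_differentiable smooth_continuous smooth_partial test_function_smooth[OF T])
       (rule test_function_zero[OF T])
  moreover have "divergence (\<lambda>x. q x *\<^sub>R \<phi> x) x = grad \<phi> x \<bullet> (q x *\<^sub>R mat 1) + \<phi> x \<bullet> grad q x" for x
    unfolding divergence_eq_grad_inner by (intro divergence_scaleR smooth_differentiable q s)
  moreover have "integrable ?M (\<lambda>x. grad \<phi> x \<bullet> (q x *\<^sub>R mat 1))" "integrable ?M (\<lambda>x. \<phi> x \<bullet> grad q x)"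
    by (intro in_L2_inner_integrable in_L2_grad in_L2_smooth smooth_scaleR q s smooth_const)+
  ultimately show ?thesis by simp
qed

text \<open>\<open>div_free_distr\<close> tests with compactly supported \<open>q\<close> only, and
  for a general L2 field a nonzero normal component at the circle obstructs the extension. In
  \<open>H10\<close> no boundary term arises: the integral is minus that of \<open>q\<close> times
  the trace of \<open>g\<close>, which vanishes for \<open>q\<close> times a cutoff, and the cutoffs
  tend to 1 in L2.\<close>

lemma solenoidal_H10_orthogonal_gradient:
  assumes R: "R > 0" and H: "H10_with_grad (ball 0 R) f g" and d: "div_free_distr (ball 0 R) f" and q: "smooth q"
  shows "(\<integral>x. f x \<bullet> grad q x \<partial>lebesgue_on (ball 0 R)) = 0"
proof -
  let ?M = "lebesgue_on (ball (0::real^2) R)"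
  obtain \<phi> :: "nat \<Rightarrow> real^2 \<Rightarrow> real^2" where p: "\<And>n. test_function (ball 0 R) (\<phi> n)"
    "(\<lambda>n. L2_norm_on (ball 0 R) (\<lambda>x. \<phi> n x - f x)) \<longlonglongrightarrow> 0"
    "(\<lambda>n. L2_norm_on (ball 0 R) (\<lambda>x. grad (\<phi> n) x - g x)) \<longlonglongrightarrow> 0"
    "\<And>n. in_L2 (ball 0 R) (\<phi> n)" "\<And>n. in_L2 (ball 0 R) (grad (\<phi> n))"
    "in_L2 (ball 0 R) f" "in_L2 (ball 0 R) g"
    by (rule H10_with_gradE[OF H]) blast
  have parts: "(\<integral>x. f x \<bullet> grad q x \<partial>?M) = - (\<integral>x. g x \<bullet> (q x *\<^sub>R mat 1) \<partial>?M)" if q: "smooth q" for q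
  proof (rule LIMSEQ_unique)
    show "(\<lambda>n. \<integral>x. \<phi> n x \<bullet> grad q x \<partial>?M) \<longlonglongrightarrow> (\<integral>x. f x \<bullet> grad q x \<partial>?M)"
      using L2_tendsto_inner[OF p(4,6) in_L2_grad[OF q] p(2)] by (simp add: inner_commute)
    have m: "in_L2 (ball 0 R) (\<lambda>x. q x *\<^sub>R (mat 1 :: real^2^2))"
      by (intro in_L2_smooth smooth_scaleR q smooth_const)
    have "(\<lambda>n. - (\<integral>x. grad (\<phi> n) x \<bullet> (q x *\<^sub>R mat 1) \<partial>?M)) \<longlonglongrightarrow> - (\<integral>x. g x \<bullet> (q x *\<^sub>R mat 1) \<partial>?M)"
      using tendsto_minus[OF L2_tendsto_inner[OF p(5,7) m p(3)]] by (simp only: inner_commute[of "_ *\<^sub>R mat 1"])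
    then show "(\<lambda>n. \<integral>x. \<phi> n x \<bullet> grad q x \<partial>?M) \<longlonglongrightarrow> - (\<integral>x. g x \<bullet> (q x *\<^sub>R mat 1) \<partial>?M)"
      by (simp only: test_function_integral_by_parts[OF p(1) q])
  qed
  have z: "(\<integral>x. g x \<bullet> ((disk_cutoff R n x *\<^sub>R q x) *\<^sub>R mat 1) \<partial>?M) = 0" for n
  proof -
    have T: "test_function (ball 0 R) (\<lambda>x. disk_cutoff R n x *\<^sub>R q x)" by (rule test_function_disk_cutoff[OF q R])
    then have "(\<integral>x. f x \<bullet> grad (\<lambda>x. disk_cutoff R n x *\<^sub>R q x) x \<partial>?M) = 0"
      using d unfolding div_free_distr_def by blast
    then show ?thesis using parts[OF test_function_smooth[OF T]] by linarith
  qed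
  have qm: "in_L2 (ball 0 R) (\<lambda>x. (disk_cutoff R n x *\<^sub>R q x) *\<^sub>R (mat 1 :: real^2^2))" for n
    by (intro in_L2_smooth smooth_scaleR q smooth_const smooth_disk_cutoff)
  have qm': "in_L2 (ball 0 R) (\<lambda>x. q x *\<^sub>R (mat 1 :: real^2^2))"
    by (intro in_L2_smooth smooth_scaleR q smooth_const)
  have "bounded (q ` cball 0 R)"
    by (intro compact_imp_bounded compact_continuous_image smooth_continuous q) auto
  then obtain B where B: "\<And>x. x \<in> cball 0 R \<Longrightarrow> norm (q x) \<le> B" unfolding bounded_iff by blast
  have "(\<lambda>n. L2_norm_on (ball 0 R) (\<lambda>x. (disk_cutoff R n x *\<^sub>R q x) *\<^sub>R (mat 1 :: real^2^2) - q x *\<^sub>R mat 1)) \<longlonglongrightarrow> 0"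
  proof (rule L2_dominated_convergence[where B="B * norm (mat 1 :: real^2^2)"])
    show "(\<lambda>x. (disk_cutoff R n x *\<^sub>R q x) *\<^sub>R (mat 1 :: real^2^2)) \<in> borel_measurable ?M" for n
      using qm by (simp add: in_L2_def)
    show "(\<lambda>x. q x *\<^sub>R (mat 1 :: real^2^2)) \<in> borel_measurable ?M"
      using qm' by (simp add: in_L2_def)
    fix x assume x: "x \<in> ball (0::real^2) R"
    show "norm ((disk_cutoff R n x *\<^sub>R q x) *\<^sub>R (mat 1 :: real^2^2)) \<le> B * norm (mat 1 :: real^2^2)" for n
    proof -
      have "\<bar>disk_cutoff R n x\<bar> * \<bar>q x\<bar> \<le> 1 * B"
        using B[of x] x by (intro mult_mono) (auto simp: disk_cutoff_def cutoff_bounds)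
      then show ?thesis by (simp add: abs_mult mult_right_mono)
    qed
    have "(\<lambda>n. (disk_cutoff R n x *\<^sub>R q x) *\<^sub>R (mat 1 :: real^2^2)) \<longlonglongrightarrow> (1 *\<^sub>R q x) *\<^sub>R mat 1"
      by (intro tendsto_intros disk_cutoff_tendsto x)
    then show "(\<lambda>n. (disk_cutoff R n x *\<^sub>R q x) *\<^sub>R (mat 1 :: real^2^2)) \<longlonglongrightarrow> q x *\<^sub>R mat 1" by simp
  qed
  from L2_tendsto_inner[OF qm qm' p(7) this]
  have "(\<integral>x. g x \<bullet> (q x *\<^sub>R mat 1) \<partial>?M) = 0" unfolding z by (simp add: LIMSEQ_const_iff)
  then show ?thesis using parts[OF q] by simp
qed

lemma test_function_mollify_partial:
  fixes \<phi> :: "real^2 \<Rightarrow> 'b::euclidean_space"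
  assumes k: "test_function UNIV \<kappa>" and t: "test_function (ball 0 R) \<phi>"
  shows "mollify R \<theta> (partial i \<kappa>) \<phi> x = mollify R \<theta> \<kappa> (partial i \<phi>) x"
proof -
  let ?M = "lebesgue_on (ball (0::real^2) R)"
  have sk: "smooth \<kappa>" "smooth \<phi>" by (auto intro: test_function_smooth k t)
  let ?P = "\<lambda>z. \<kappa> (\<theta> *\<^sub>R x - z) *\<^sub>R \<phi> z"
  have "(\<integral>z. partial i ?P z \<partial>?M) = 0"
    by (intro integral_partial_test_function test_function_smooth_scaleR smooth_reflect sk t)
  moreover have "partial i ?P z = \<kappa> (\<theta> *\<^sub>R x - z) *\<^sub>R partial i \<phi> z - partial i \<kappa> (\<theta> *\<^sub>R x - z) *\<^sub>R \<phi> z" for z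
    using partial_bilinear[OF bounded_bilinear_scaleR smooth_differentiable[OF smooth_reflect[OF sk(1), of "\<theta> *\<^sub>R x"], of z]
        smooth_differentiable[OF sk(2), of z], where i=i]
      partial_reflect[OF smooth_differentiable[OF sk(1), of "\<theta> *\<^sub>R x - z"], where i=i] by simp
  moreover have "integrable ?M (\<lambda>z. \<kappa> (\<theta> *\<^sub>R x - z) *\<^sub>R partial i \<phi> z)"
    by (intro mollify_integrable[OF k] in_L2_integrable in_L2_smooth smooth_partial sk)
  moreover have "integrable ?M (\<lambda>z. partial i \<kappa> (\<theta> *\<^sub>R x - z) *\<^sub>R \<phi> z)"
    by (intro mollify_integrable[OF test_function_partial[OF k]] in_L2_integrable in_L2_smooth sk)
  ultimately show ?thesis by (simp add: mollify_def)
qed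

lemma mollify_inner:
  assumes "test_function S \<kappa>" "in_L2 (ball 0 R) f"
  shows "mollify R \<theta> \<kappa> f x \<bullet> b = (\<integral>z. (\<kappa> (\<theta> *\<^sub>R x - z) *\<^sub>R b) \<bullet> f z \<partial>lebesgue_on (ball 0 R))"
proof -
  have "mollify R \<theta> \<kappa> f x \<bullet> b = (\<integral>z. (\<kappa> (\<theta> *\<^sub>R x - z) *\<^sub>R f z) \<bullet> b \<partial>lebesgue_on (ball 0 R))"
    unfolding mollify_def
    by (rule integral_inner_left[symmetric]) (rule mollify_integrable[OF assms(1) in_L2_integrable[OF assms(2)]])
  then show ?thesis by (simp add: inner_commute)
qed

lemma in_L2_nth:
  fixes g :: "real^2 \<Rightarrow> 'b::euclidean_space^2"
  assumes "in_L2 S g" shows "in_L2 S (\<lambda>x. g x $ i)"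
proof -
  have m: "(\<lambda>x. g x $ i) \<in> borel_measurable (lebesgue_on S)"
    using assms borel_measurable_continuous_onI[OF continuous_on_component[OF continuous_on_id, of UNIV i]]
    by (auto simp: in_L2_def intro: measurable_compose)
  have "integrable (lebesgue_on S) (\<lambda>x. (norm (g x $ i))\<^sup>2)"
    by (rule Bochner_Integration.integrable_bound[where f="\<lambda>x. (norm (g x))\<^sup>2"])
       (use assms m Finite_Cartesian_Product.norm_nth_le in \<open>auto simp: in_L2_def intro!: AE_I2 power_mono\<close>)
  then show ?thesis using m by (simp add: in_L2_def)
qed

lemma L2_norm_nth_le:
  fixes g :: "real^2 \<Rightarrow> 'b::euclidean_space^2"
  assumes "in_L2 S g" shows "L2_norm_on S (\<lambda>x. g x $ i) \<le> L2_norm_on S g"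
  unfolding L2_norm_on_def
  using assms in_L2_nth[OF assms] Finite_Cartesian_Product.norm_nth_le
  by (intro real_sqrt_le_mono integral_mono) (auto simp: in_L2_def intro!: power_mono)

text \<open>For test functions the derivative moves from the kernel to the function by parts;
  componentwise both sides are L2 pairings with a fixed kernel, so the identity survives the limit.
  Zero boundary values of \<open>f\<close> are essential, as the kernel may be nonzero at the
  circle.\<close>

lemma mollify_partial_H10:
  fixes f :: "real^2 \<Rightarrow> 'b::euclidean_space"
  assumes k: "test_function UNIV \<kappa>" and H: "H10_with_grad (ball 0 R) f g"
  shows "mollify R \<theta> (partial i \<kappa>) f x = mollify R \<theta> \<kappa> (\<lambda>z. g z $ i) x"
proof (rule euclidean_eqI)
  fix b :: 'b
  let ?M = "lebesgue_on (ball (0::real^2) R)"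
  obtain \<phi> :: "nat \<Rightarrow> real^2 \<Rightarrow> 'b" where p: "\<And>n. test_function (ball 0 R) (\<phi> n)"
    "(\<lambda>n. L2_norm_on (ball 0 R) (\<lambda>x. \<phi> n x - f x)) \<longlonglongrightarrow> 0"
    "(\<lambda>n. L2_norm_on (ball 0 R) (\<lambda>x. grad (\<phi> n) x - g x)) \<longlonglongrightarrow> 0"
    "\<And>n. in_L2 (ball 0 R) (\<phi> n)" "\<And>n. in_L2 (ball 0 R) (grad (\<phi> n))"
    "in_L2 (ball 0 R) f" "in_L2 (ball 0 R) g"
    by (rule H10_with_gradE[OF H]) blast
  have pk: "test_function UNIV (partial i \<kappa>)" by (rule test_function_partial[OF k])
  have g: "partial i (\<phi> n) = (\<lambda>z. grad (\<phi> n) z $ i)" for n by (simp add: grad_def)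
  have L: "in_L2 (ball 0 R) (\<lambda>z. \<kappa>' (\<theta> *\<^sub>R x - z) *\<^sub>R b)" if "test_function UNIV \<kappa>'" for \<kappa>'
    by (intro in_L2_smooth smooth_scaleR smooth_const smooth_reflect test_function_smooth[OF that])
  have ni: "in_L2 (ball 0 R) (\<lambda>x. g x $ i)" "in_L2 (ball 0 R) (\<lambda>x. grad (\<phi> n) x $ i)" for n
    using in_L2_nth p by blast+
  have gi: "(\<lambda>n. L2_norm_on (ball 0 R) (\<lambda>x. grad (\<phi> n) x $ i - g x $ i)) \<longlonglongrightarrow> 0"
  proof (rule Lim_null_comparison[OF always_eventually p(3)], rule allI)
    fix n
    show "norm (L2_norm_on (ball 0 R) (\<lambda>x. grad (\<phi> n) x $ i - g x $ i))
        \<le> L2_norm_on (ball 0 R) (\<lambda>x. grad (\<phi> n) x - g x)"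
      using L2_norm_nth_le[OF in_L2_diff[OF p(5)[of n] p(7)], of i] by simp
  qed
  have "(\<lambda>n. mollify R \<theta> (partial i \<kappa>) (\<phi> n) x \<bullet> b) \<longlonglongrightarrow> mollify R \<theta> (partial i \<kappa>) f x \<bullet> b"
    unfolding mollify_inner[OF pk p(6)] mollify_inner[OF pk p(4)]
    by (rule L2_tendsto_inner[OF p(4,6) L[OF pk] p(2)])
  moreover have "(\<lambda>n. mollify R \<theta> \<kappa> (\<lambda>z. grad (\<phi> n) z $ i) x \<bullet> b) \<longlonglongrightarrow> mollify R \<theta> \<kappa> (\<lambda>z. g z $ i) x \<bullet> b"
    unfolding mollify_inner[OF k ni(1)] mollify_inner[OF k ni(2)]
    by (rule L2_tendsto_inner[OF ni(2,1) L[OF k] gi])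
  ultimately show "mollify R \<theta> (partial i \<kappa>) f x \<bullet> b = mollify R \<theta> \<kappa> (\<lambda>z. g z $ i) x \<bullet> b"
    unfolding test_function_mollify_partial[OF k p(1)] g by (rule LIMSEQ_unique)
qed

lemma mollify_test_function_close:
  fixes \<phi> :: "real^2 \<Rightarrow> 'b::euclidean_space"
  assumes t: "test_function (ball 0 R) \<phi>" and d: "\<delta> > 0" and th: "\<theta> \<ge> 1"
    and L: "L \<ge> 0" "\<And>x y. norm (\<phi> x - \<phi> y) \<le> L * norm (x - y)" and x: "x \<in> ball 0 R"
  shows "norm (mollify R \<theta> (mollifier \<delta>) \<phi> x - \<phi> x) \<le> L * (\<delta> + (\<theta> - 1) * R)"
proof -
  let ?k = "\<lambda>z. mollifier \<delta> (\<theta> *\<^sub>R x - z)" and ?C = "L * (\<delta> + (\<theta> - 1) * R)"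
  have k1: "has_bochner_integral lborel ?k 1"
    using mollifier_integral[OF d, of "\<theta> *\<^sub>R x"] by (simp add: mollifier_minus)
  have tk: "test_function UNIV (mollifier \<delta>)" by (rule test_function_mollifier[OF d])
  have c: "continuous_on UNIV (\<lambda>z. ?k z *\<^sub>R \<phi> z)"
    by (intro continuous_intros mollify_kernel_continuous[OF tk] smooth_continuous test_function_smooth[OF t])
  have i1: "integrable lborel (\<lambda>z. ?k z *\<^sub>R \<phi> z)"
    by (rule continuous_compact_support_integrable[OF c, of R]) (simp add: test_function_zero[OF t])
  \<comment> \<open>Since \<open>\<phi>\<close> vanishes outside the disk, the integral extends to
    the plane. There the kernel has mass exactly 1, so \<open>\<phi> x\<close> is an average with
    the same kernel.\<close>
  have "mollify R \<theta> (mollifier \<delta>) \<phi> x = (\<integral>z. ?k z *\<^sub>R \<phi> z \<partial>lborel)"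
    unfolding mollify_def
    by (intro integral_lebesgue_on_zero_outside borel_measurable_continuous_onI c) (auto simp: test_function_zero[OF t])
  moreover have "\<phi> x = (\<integral>z. ?k z *\<^sub>R \<phi> x \<partial>lborel)"
    using k1 by (simp add: has_bochner_integral_iff)
  ultimately have "norm (mollify R \<theta> (mollifier \<delta>) \<phi> x - \<phi> x) = norm (\<integral>z. ?k z *\<^sub>R (\<phi> z - \<phi> x) \<partial>lborel)"
    using i1 k1 by (simp add: scaleR_diff_right has_bochner_integral_iff)
  also have "\<dots> \<le> (\<integral>z. ?k z * ?C \<partial>lborel)"
  proof (rule Bochner_Integration.integral_norm_bound_integral)
    show "integrable lborel (\<lambda>z. ?k z *\<^sub>R (\<phi> z - \<phi> x))"
      using i1 k1 by (simp add: scaleR_diff_right has_bochner_integral_iff)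
    show "integrable lborel (\<lambda>z. ?k z * ?C)" using k1 by (simp add: has_bochner_integral_iff)
    show "norm (?k z *\<^sub>R (\<phi> z - \<phi> x)) \<le> ?k z * ?C" for z
    proof (cases "norm (\<theta> *\<^sub>R x - z) < \<delta>")
      case True
      have "norm (z - x) \<le> norm (z - \<theta> *\<^sub>R x) + norm (\<theta> *\<^sub>R x - x)"
        using norm_triangle_ineq[of "z - \<theta> *\<^sub>R x" "\<theta> *\<^sub>R x - x"] by simp
      also have "norm (\<theta> *\<^sub>R x - x) = (\<theta> - 1) * norm x"
        using th norm_scaleR[of "\<theta> - 1" x] by (simp add: scaleR_diff_left)
      also have "\<dots> \<le> (\<theta> - 1) * R" using th x by (intro mult_left_mono) auto
      finally have "norm (z - x) \<le> \<delta> + (\<theta> - 1) * R" using True by (simp add: norm_minus_commute)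
      then have "norm (\<phi> z - \<phi> x) \<le> ?C" using L by (meson mult_left_mono order_trans)
      then show ?thesis using mollifier_nonneg[OF d] by (simp add: mult_left_mono)
    qed (use mollifier_zero[OF d] in simp)
  qed
  also have "\<dots> = ?C" using k1 by (simp add: has_bochner_integral_iff)
  finally show ?thesis .
qed

lemma mollify_diff:
  assumes "test_function S \<kappa>" "in_L2 (ball 0 R) f" "in_L2 (ball 0 R) g"
  shows "mollify R \<theta> \<kappa> (\<lambda>z. f z - g z) x = mollify R \<theta> \<kappa> f x - mollify R \<theta> \<kappa> g x"
  using mollify_integrable[OF assms(1) in_L2_integrable[OF assms(2)]] mollify_integrable[OF assms(1) in_L2_integrable[OF assms(3)]]
  by (simp add: mollify_def scaleR_diff_right)

lemma L2_norm_on_bounded: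
  fixes f :: "real^2 \<Rightarrow> 'b::euclidean_space"
  assumes "f \<in> borel_measurable (lebesgue_on (ball 0 R))" "\<And>x. x \<in> ball 0 R \<Longrightarrow> norm (f x) \<le> B" "B \<ge> 0"
  shows "L2_norm_on (ball 0 R) f \<le> B * sqrt (measure lebesgue (ball (0::real^2) R))"
proof -
  let ?M = "lebesgue_on (ball (0::real^2) R)"
  interpret finite_measure ?M by (rule finite_measure_ball)
  have "(\<integral>x. (norm (f x))\<^sup>2 \<partial>?M) \<le> (\<integral>x. B\<^sup>2 \<partial>?M)"
    using in_L2_bounded[OF assms(1,2)] assms(2) by (intro integral_mono) (auto simp: in_L2_def intro!: power_mono)
  also have "\<dots> = B\<^sup>2 * measure lebesgue (ball (0::real^2) R)" by (simp add: measure_restrict_space mult.commute)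
  finally show ?thesis unfolding L2_norm_on_def
    using assms(3) real_sqrt_le_mono by (fastforce simp: real_sqrt_mult)
qed

text \<open>The operators are contractions of L2 for every \<open>n\<close>, so convergence on the
  approximating test functions, where the Lipschitz bound makes it uniform in space, carries over to
  \<open>h\<close>.\<close>

lemma mollify_tendsto:
  fixes h :: "real^2 \<Rightarrow> 'b::euclidean_space"
  assumes R: "R > 0" and psi: "\<And>m::nat. test_function (ball 0 R) (\<psi> m)" "(\<lambda>m. L2_norm_on (ball 0 R) (\<lambda>x. \<psi> m x - h x)) \<longlonglongrightarrow> 0"
    and h: "in_L2 (ball 0 R) h"
    and d: "\<And>n::nat. \<delta> n > 0" "\<delta> \<longlonglongrightarrow> 0" and th: "\<And>n. \<theta> n \<ge> 1" "\<theta> \<longlonglongrightarrow> 1"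
  shows "(\<lambda>n. L2_norm_on (ball 0 R) (\<lambda>x. mollify R (\<theta> n) (mollifier (\<delta> n)) h x - h x)) \<longlonglongrightarrow> 0"
proof (rule LIMSEQ_I)
  fix \<epsilon> :: real assume e: "\<epsilon> > 0"
  let ?N = "L2_norm_on (ball (0::real^2) R)" and ?S = "\<lambda>n. mollify R (\<theta> n) (mollifier (\<delta> n))"
  obtain m where "norm (?N (\<lambda>x. \<psi> m x - h x) - 0) < \<epsilon> / 3"
    using LIMSEQ_D[OF psi(2), of "\<epsilon> / 3"] e by auto
  then have m: "?N (\<lambda>x. \<psi> m x - h x) < \<epsilon> / 3" by simp
  obtain L where L: "L \<ge> 0" "\<And>x y. norm (\<psi> m x - \<psi> m y) \<le> L * norm (x - y)"
    using test_function_lipschitz[OF psi(1)[of m]] by metis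
  let ?c = "\<lambda>n. L * (\<delta> n + (\<theta> n - 1) * R) * sqrt (measure lebesgue (ball (0::real^2) R))"
  have "?c \<longlonglongrightarrow> L * (0 + (1 - 1) * R) * sqrt (measure lebesgue (ball (0::real^2) R))"
    by (intro tendsto_intros d th)
  then have "?c \<longlonglongrightarrow> 0" by simp
  then obtain n0 where n0: "\<And>n. n \<ge> n0 \<Longrightarrow> norm (?c n - 0) < \<epsilon> / 3"
    using LIMSEQ_D[of ?c 0 "\<epsilon> / 3"] e by auto
  have "norm (?N (\<lambda>x. ?S n h x - h x) - 0) < \<epsilon>" if n: "n \<ge> n0" for n
  proof -
    have t: "test_function UNIV (mollifier (\<delta> n))" by (rule test_function_mollifier[OF d(1)])
    have s: "in_L2 (ball 0 R) (\<psi> m)" by (intro in_L2_smooth test_function_smooth[OF psi(1)])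
    have Ss: "in_L2 (ball 0 R) (?S n f)" if "in_L2 (ball 0 R) f" for f :: "real^2 \<Rightarrow> 'b"
      by (intro in_L2_smooth smooth_mollify[OF t] in_L2_integrable that)
    have "?N (\<lambda>x. ?S n h x - h x) \<le> ?N (\<lambda>x. ?S n h x - ?S n (\<psi> m) x) + ?N (\<lambda>x. ?S n (\<psi> m) x - h x)"
      by (rule L2_triangle_diff[OF Ss[OF h] Ss[OF s] h])
    also have "?N (\<lambda>x. ?S n (\<psi> m) x - h x) \<le> ?N (\<lambda>x. ?S n (\<psi> m) x - \<psi> m x) + ?N (\<lambda>x. \<psi> m x - h x)"
      by (rule L2_triangle_diff[OF Ss[OF s] s h])
    also have "?N (\<lambda>x. ?S n h x - ?S n (\<psi> m) x) = ?N (?S n (\<lambda>z. h z - \<psi> m z))"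
      by (simp add: mollify_diff[OF t h s, symmetric])
    also have "\<dots> \<le> ?N (\<lambda>z. h z - \<psi> m z)"
      by (intro mollify_L2_le d th in_L2_diff h s)
    also have "?N (\<lambda>x. ?S n (\<psi> m) x - \<psi> m x) \<le> ?c n"
    proof (rule L2_norm_on_bounded)
        show "(\<lambda>x. ?S n (\<psi> m) x - \<psi> m x) \<in> borel_measurable (lebesgue_on (ball 0 R))"
          using in_L2_diff[OF Ss[OF s] s] unfolding in_L2_def by blast
        show "norm (?S n (\<psi> m) x - \<psi> m x) \<le> L * (\<delta> n + (\<theta> n - 1) * R)" if "x \<in> ball 0 R" for x
          by (rule mollify_test_function_close[OF psi(1) d(1) th(1) L that])
        show "0 \<le> L * (\<delta> n + (\<theta> n - 1) * R)" using R L d(1)[of n] th(1)[of n] by simp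
    qed
    finally have "?N (\<lambda>x. ?S n h x - h x) \<le> 2 * ?N (\<lambda>x. \<psi> m x - h x) + ?c n"
      using L2_norm_on_minus[of "ball 0 R" h "\<psi> m"] by simp
    then show ?thesis using m n0[OF n] by simp
  qed
  then show "\<exists>n0. \<forall>n\<ge>n0. norm (?N (\<lambda>x. ?S n h x - h x) - 0) < \<epsilon>" by blast
qed

lemma L2_norm_vec_square:
  fixes g :: "real^2 \<Rightarrow> 'b::euclidean_space^2"
  assumes "in_L2 S g"
  shows "(L2_norm_on S g)\<^sup>2 = (\<Sum>i\<in>UNIV. (L2_norm_on S (\<lambda>x. g x $ i))\<^sup>2)"
proof -
  have "(norm (g x))\<^sup>2 = (\<Sum>i\<in>UNIV. (norm (g x $ i))\<^sup>2)" for x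
    by (simp add: power2_norm_eq_inner inner_vec_def)
  then show ?thesis unfolding L2_norm_on_power2
    using in_L2_nth[OF assms] by (simp add: in_L2_def)
qed

lemma mollify_zero_outside:
  fixes f :: "real^2 \<Rightarrow> 'b::euclidean_space"
  assumes d: "\<delta> > 0" and th: "\<theta> > 0" and x: "norm x \<ge> (R + \<delta>) / \<theta>"
  shows "mollify R \<theta> (mollifier \<delta>) f x = 0"
proof -
  have k0: "mollifier \<delta> (\<theta> *\<^sub>R x - z) = 0" if z: "z \<in> ball 0 R" for z
  proof (rule mollifier_zero[OF d])
    have "R + \<delta> \<le> \<theta> * norm x" using x th by (simp add: divide_le_eq mult.commute)
    moreover have "\<theta> * norm x \<le> norm (\<theta> *\<^sub>R x - z) + norm z"
      using norm_triangle_sub[of "\<theta> *\<^sub>R x" z] th by simp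
    ultimately show "\<delta> \<le> norm (\<theta> *\<^sub>R x - z)" using z by simp
  qed
  have "mollify R \<theta> (mollifier \<delta>) f x = (\<integral>z. 0 \<partial>lebesgue_on (ball (0::real^2) R))"
    unfolding mollify_def by (rule Bochner_Integration.integral_cong[OF refl]) (simp add: k0)
  then show ?thesis by simp
qed

text \<open>Mollified dilations of \<open>f\<close> are smooth and compactly supported, and their
  derivatives are mollifications of \<open>g\<close>, which gives the convergence. Their divergence
  is a pairing of \<open>f\<close> with the gradient of a translated kernel; as this kernel may
  reach beyond the disk, the orthogonality to all smooth gradients is used, not only the
  distributional condition.\<close>

theorem solenoidal_test_functions_dense:
  assumes R: "R > 0" and H: "H10_with_grad (ball 0 R) f g" and df: "div_free_distr (ball 0 R) f"
  obtains \<psi> :: "nat \<Rightarrow> real^2 \<Rightarrow> real^2" where "\<And>n. test_function (ball 0 R) (\<psi> n)" "\<And>n x. divergence (\<psi> n) x = 0"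
    "(\<lambda>n. L2_norm_on (ball 0 R) (\<lambda>x. \<psi> n x - f x)) \<longlonglongrightarrow> 0"
    "(\<lambda>n. L2_norm_on (ball 0 R) (\<lambda>x. grad (\<psi> n) x - g x)) \<longlonglongrightarrow> 0"
proof -
  let ?N = "L2_norm_on (ball (0::real^2) R)"
  obtain \<phi> :: "nat \<Rightarrow> real^2 \<Rightarrow> real^2" where p: "\<And>n. test_function (ball 0 R) (\<phi> n)"
    "(\<lambda>n. L2_norm_on (ball 0 R) (\<lambda>x. \<phi> n x - f x)) \<longlonglongrightarrow> 0"
    "(\<lambda>n. L2_norm_on (ball 0 R) (\<lambda>x. grad (\<phi> n) x - g x)) \<longlonglongrightarrow> 0"
    "\<And>n. in_L2 (ball 0 R) (\<phi> n)" "\<And>n. in_L2 (ball 0 R) (grad (\<phi> n))"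
    "in_L2 (ball 0 R) f" "in_L2 (ball 0 R) g"
    by (rule H10_with_gradE[OF H]) blast
  define \<delta> where "\<delta> n = 1 / real (Suc n)" for n
  \<comment> \<open>Then \<open>R \<theta> = R + 2 \<delta>\<close> exceeds
    \<open>R + \<delta>\<close>, so the support, of radius at most
    \<open>(R + \<delta>) / \<theta>\<close>, stays inside the disk.\<close>
  define \<theta> where "\<theta> n = 1 + 2 * \<delta> n / R" for n
  have d: "\<delta> n > 0" for n by (simp add: \<delta>_def)
  have dl: "\<delta> \<longlonglongrightarrow> 0" unfolding \<delta>_def[abs_def] using LIMSEQ_inverse_real_of_nat by (simp add: inverse_eq_divide)
  have th: "\<theta> n \<ge> 1" for n using d[of n] R by (simp add: \<theta>_def)
  have "(\<lambda>n. 1 + 2 * \<delta> n / R) \<longlonglongrightarrow> 1 + 2 * 0 / R" by (intro tendsto_intros dl) (use R in simp)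
  then have thl: "\<theta> \<longlonglongrightarrow> 1" by (simp add: \<theta>_def[abs_def])
  have fi: "integrable (lebesgue_on (ball 0 R)) f" by (rule in_L2_integrable[OF p(6)])
  define \<psi> where "\<psi> n = mollify R (\<theta> n) (mollifier (\<delta> n)) f" for n
  have k: "test_function UNIV (mollifier (\<delta> n))" for n by (rule test_function_mollifier[OF d])
  have t: "test_function (ball 0 R) (\<psi> n)" for n
  proof (rule test_functionI[of _ "cball 0 ((R + \<delta> n) / \<theta> n)"])
    show "smooth (\<psi> n)" unfolding \<psi>_def by (rule smooth_mollify[OF k fi])
    have "R + \<delta> n < R * \<theta> n" using d[of n] R by (simp add: \<theta>_def distrib_left)
    then have "(R + \<delta> n) / \<theta> n < R" using th[of n] by (simp add: pos_divide_less_eq)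
    then show "cball 0 ((R + \<delta> n) / \<theta> n) \<subseteq> ball 0 R" by auto
    show "\<psi> n x = 0" if "x \<notin> cball 0 ((R + \<delta> n) / \<theta> n)" for x
      unfolding \<psi>_def using that th[of n] by (intro mollify_zero_outside d) auto
  qed simp
  have pp: "partial i (\<psi> n) x = \<theta> n *\<^sub>R mollify R (\<theta> n) (mollifier (\<delta> n)) (\<lambda>z. g z $ i) x" for i n x
    unfolding \<psi>_def partial_mollify[OF k fi] mollify_partial_H10[OF k H] ..
  have div: "divergence (\<psi> n) x = 0" for n x
  proof -
    let ?a = "\<theta> n *\<^sub>R x" and ?k = "mollifier (\<delta> n)"
    have sk: "smooth ?k" by (rule test_function_smooth[OF k])
    have "divergence (\<psi> n) x = \<theta> n * (\<Sum>i\<in>UNIV. mollify R (\<theta> n) (partial i ?k) f x \<bullet> axis i 1)"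
      unfolding divergence_def \<psi>_def partial_mollify[OF k fi] by (simp add: sum_distrib_left inner_axis)
    also have "(\<Sum>i\<in>UNIV. mollify R (\<theta> n) (partial i ?k) f x \<bullet> axis i 1)
        = (\<Sum>i\<in>UNIV. \<integral>z. (partial i ?k (?a - z) *\<^sub>R axis i 1) \<bullet> f z \<partial>lebesgue_on (ball 0 R))"
      by (simp only: mollify_inner[OF test_function_partial[OF k] p(6)])
    also have "\<dots> = (\<integral>z. (\<Sum>i\<in>UNIV. (partial i ?k (?a - z) *\<^sub>R axis i 1) \<bullet> f z) \<partial>lebesgue_on (ball 0 R))"
    proof (rule Bochner_Integration.integral_sum[symmetric])
      fix i
      have "smooth (\<lambda>z. partial i ?k (?a - z))" by (rule smooth_reflect[OF smooth_partial[OF sk]])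
      then have "in_L2 (ball 0 R) (\<lambda>z. partial i ?k (?a - z) *\<^sub>R (axis i 1 :: real^2))"
        by (rule in_L2_smooth[OF smooth_scaleR[OF _ smooth_const]])
      then show "integrable (lebesgue_on (ball 0 R)) (\<lambda>z. (partial i ?k (?a - z) *\<^sub>R axis i 1) \<bullet> f z)"
        by (rule in_L2_inner_integrable[OF _ p(6)])
    qed
    also have "\<dots> = (\<integral>z. - (f z \<bullet> grad (\<lambda>z. ?k (?a - z)) z) \<partial>lebesgue_on (ball 0 R))"
      by (intro Bochner_Integration.integral_cong refl)
        (simp add: grad_def inner_vec_def[of "f _"] partial_reflect[OF smooth_differentiable[OF sk]] inner_axis' sum_negf mult.commute)
    also have "\<dots> = 0"
      using solenoidal_H10_orthogonal_gradient[OF R H df smooth_reflect[OF sk, of ?a]] by simp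
    finally show ?thesis by simp
  qed
  have l1: "(\<lambda>n. ?N (\<lambda>x. \<psi> n x - f x)) \<longlonglongrightarrow> 0"
    unfolding \<psi>_def by (rule mollify_tendsto[OF R p(1,2,6) d dl th thl])
  have gi: "in_L2 (ball 0 R) (\<lambda>x. g x $ i)" for i by (rule in_L2_nth[OF p(7)])
  have l2: "(\<lambda>n. ?N (\<lambda>x. partial i (\<psi> n) x - g x $ i)) \<longlonglongrightarrow> 0" for i
  proof -
    let ?S = "\<lambda>n. mollify R (\<theta> n) (mollifier (\<delta> n)) (\<lambda>z. g z $ i)"
    have Si: "in_L2 (ball 0 R) (?S n)" for n by (intro in_L2_smooth smooth_mollify[OF k] in_L2_integrable gi)
    have pc: "(\<lambda>n. ?N (\<lambda>x. partial i (\<phi> n) x - g x $ i)) \<longlonglongrightarrow> 0"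
    proof (rule Lim_null_comparison[OF always_eventually p(3)], rule allI)
      fix n show "norm (?N (\<lambda>x. partial i (\<phi> n) x - g x $ i)) \<le> ?N (\<lambda>x. grad (\<phi> n) x - g x)"
        using L2_norm_nth_le[OF in_L2_diff[OF p(5)[of n] p(7)], of i] by (simp add: grad_def)
    qed
    have S: "(\<lambda>n. ?N (\<lambda>x. ?S n x - g x $ i)) \<longlonglongrightarrow> 0"
      by (rule mollify_tendsto[OF R test_function_partial[OF p(1)] pc gi d dl th thl])
    show ?thesis
    proof (rule Lim_null_comparison[OF always_eventually], rule allI)
      fix n
      \<comment> \<open>The chain rule contributes the factor \<open>\<theta> n\<close>, so
        \<open>(\<theta> n - 1) g\<close> is added to the error of the mollification.\<close>
      have "?N (\<lambda>x. partial i (\<psi> n) x - g x $ i) = ?N (\<lambda>x. \<theta> n *\<^sub>R (?S n x - g x $ i) + (\<theta> n - 1) *\<^sub>R g x $ i)"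
        by (simp add: pp algebra_simps)
      also have "\<dots> \<le> ?N (\<lambda>x. \<theta> n *\<^sub>R (?S n x - g x $ i)) + ?N (\<lambda>x. (\<theta> n - 1) *\<^sub>R g x $ i)"
        by (intro L2_triangle in_L2_scaleR in_L2_diff Si gi)
      also have "\<dots> = \<bar>\<theta> n\<bar> * ?N (\<lambda>x. ?S n x - g x $ i) + \<bar>\<theta> n - 1\<bar> * ?N (\<lambda>x. g x $ i)"
        by (simp only: L2_norm_on_scaleR)
      finally show "norm (?N (\<lambda>x. partial i (\<psi> n) x - g x $ i)) \<le> \<bar>\<theta> n\<bar> * ?N (\<lambda>x. ?S n x - g x $ i) + \<bar>\<theta> n - 1\<bar> * ?N (\<lambda>x. g x $ i)"
        by simp
      have "(\<lambda>n. \<bar>\<theta> n\<bar> * ?N (\<lambda>x. ?S n x - g x $ i) + \<bar>\<theta> n - 1\<bar> * ?N (\<lambda>x. g x $ i)) \<longlonglongrightarrow> \<bar>1\<bar> * 0 + \<bar>1 - 1\<bar> * ?N (\<lambda>x. g x $ i)"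
        by (intro tendsto_intros S thl)
      then show "(\<lambda>n. \<bar>\<theta> n\<bar> * ?N (\<lambda>x. ?S n x - g x $ i) + \<bar>\<theta> n - 1\<bar> * ?N (\<lambda>x. g x $ i)) \<longlonglongrightarrow> 0" by simp
    qed
  qed
  have "(\<lambda>n. (?N (\<lambda>x. grad (\<psi> n) x - g x))\<^sup>2) \<longlonglongrightarrow> 0"
  proof -
    have "(?N (\<lambda>x. grad (\<psi> n) x - g x))\<^sup>2 = (\<Sum>i\<in>UNIV. (?N (\<lambda>x. partial i (\<psi> n) x - g x $ i))\<^sup>2)" for n
      using L2_norm_vec_square[OF in_L2_diff[OF in_L2_grad[OF test_function_smooth[OF t[of n]]] p(7)]]
      by (simp add: grad_def)
    moreover have "(\<lambda>n. \<Sum>i\<in>(UNIV::2 set). (?N (\<lambda>x. partial i (\<psi> n) x - g x $ i))\<^sup>2) \<longlonglongrightarrow> (\<Sum>i\<in>(UNIV::2 set). 0\<^sup>2)"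
      by (intro tendsto_intros l2)
    ultimately show ?thesis by simp
  qed
  then have "(\<lambda>n. sqrt ((?N (\<lambda>x. grad (\<psi> n) x - g x))\<^sup>2)) \<longlonglongrightarrow> sqrt 0" by (intro tendsto_intros)
  then have "(\<lambda>n. ?N (\<lambda>x. grad (\<psi> n) x - g x)) \<longlonglongrightarrow> 0" by simp
  then show thesis using that[OF t div l1] by blast
qed

section \<open>Ladyzhenskaya's inequality\<close>

definition plane_point :: "real \<times> real \<Rightarrow> real^2" where
  "plane_point p = fst p *\<^sub>R axis 1 1 + snd p *\<^sub>R axis 2 1"

lemma plane_point_nth [simp]: "plane_point p $ 1 = fst p" "plane_point p $ 2 = snd p"
  by (simp_all add: plane_point_def axis_def)

lemma plane_point_measurable: "plane_point \<in> measurable (lborel \<Otimes>\<^sub>M lborel) borel"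
proof -
  have "continuous_on UNIV plane_point"
    unfolding plane_point_def[abs_def] by (intro continuous_intros)
  then show ?thesis by (simp add: borel_measurable_continuous_onI lborel_prod)
qed

lemma Basis_real_2: "(Basis :: (real^2) set) = {axis 1 1, axis 2 1}"
  by (auto simp: Basis_vec_def UNIV_2)

text \<open>Boxes determine Lebesgue measure, and their preimages under \<open>plane_point\<close>
  are products of intervals. The identification makes Tonelli's theorem available in both orders on
  \<open>real^2\<close>.\<close>

lemma lborel_eq_distr_plane_point: "lborel = distr (lborel \<Otimes>\<^sub>M lborel) borel plane_point"
proof (rule lborel_eqI)
  fix l u :: "real^2" assume lu: "\<And>b. b \<in> Basis \<Longrightarrow> l \<bullet> b \<le> u \<bullet> b"
  have ax: "axis 1 1 \<noteq> (axis 2 1 :: real^2)" by (simp add: axis_eq_axis)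
  have lu': "l $ 1 \<le> u $ 1" "l $ 2 \<le> u $ 2"
    using lu[of "axis 1 1"] lu[of "axis 2 1"] by (simp_all add: Basis_real_2 inner_axis)
  have "plane_point -` box l u \<inter> space (lborel \<Otimes>\<^sub>M lborel) = {l $ 1<..<u $ 1} \<times> {l $ 2<..<u $ 2}"
    by (auto simp: mem_box_cart space_pair_measure forall_2)
  then have "emeasure (distr (lborel \<Otimes>\<^sub>M lborel) borel plane_point) (box l u)
      = emeasure (lborel \<Otimes>\<^sub>M lborel) ({l $ 1<..<u $ 1} \<times> {l $ 2<..<u $ 2})"
    by (subst emeasure_distr[OF plane_point_measurable]) auto
  also have "\<dots> = emeasure lborel {l $ 1<..<u $ 1} * emeasure lborel {l $ 2<..<u $ 2}"
    by (rule lborel.emeasure_pair_measure_Times) auto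
  also have "\<dots> = ennreal ((u $ 1 - l $ 1) * (u $ 2 - l $ 2))"
    using lu' by (simp add: ennreal_mult)
  also have "(u $ 1 - l $ 1) * (u $ 2 - l $ 2) = (\<Prod>b\<in>Basis. (u - l) \<bullet> b)"
    unfolding Basis_real_2 using ax by (simp add: inner_axis)
  finally show "emeasure (distr (lborel \<Otimes>\<^sub>M lborel) borel plane_point) (box l u) = ennreal (\<Prod>b\<in>Basis. (u - l) \<bullet> b)" .
qed simp

lemma nn_integral_plane:
  fixes f :: "real^2 \<Rightarrow> ennreal"
  assumes "f \<in> borel_measurable borel"
  shows "(\<integral>\<^sup>+x. f x \<partial>lborel) = (\<integral>\<^sup>+a. \<integral>\<^sup>+b. f (plane_point (a, b)) \<partial>lborel \<partial>lborel)"
    and "(\<integral>\<^sup>+x. f x \<partial>lborel) = (\<integral>\<^sup>+b. \<integral>\<^sup>+a. f (plane_point (a, b)) \<partial>lborel \<partial>lborel)"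
proof -
  have m: "(\<lambda>p. f (plane_point p)) \<in> borel_measurable (lborel \<Otimes>\<^sub>M lborel)"
    by (rule measurable_compose[OF plane_point_measurable assms])
  have "(\<integral>\<^sup>+x. f x \<partial>lborel) = (\<integral>\<^sup>+p. f (plane_point p) \<partial>(lborel \<Otimes>\<^sub>M lborel))"
    using nn_integral_distr[OF plane_point_measurable, of f] assms by (simp add: lborel_eq_distr_plane_point[symmetric])
  then show "(\<integral>\<^sup>+x. f x \<partial>lborel) = (\<integral>\<^sup>+a. \<integral>\<^sup>+b. f (plane_point (a, b)) \<partial>lborel \<partial>lborel)"
    "(\<integral>\<^sup>+x. f x \<partial>lborel) = (\<integral>\<^sup>+b. \<integral>\<^sup>+a. f (plane_point (a, b)) \<partial>lborel \<partial>lborel)"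
    using lborel.nn_integral_fst[OF m] lborel_pair.nn_integral_snd[OF m] by simp_all
qed

text \<open>The fundamental theorem of calculus for the squared norm of \<open>\<phi>\<close> along
  the line, started outside the disk. The right side does not depend on \<open>a\<close>, and this
  is what separates the variables in Ladyzhenskaya's inequality.\<close>

lemma norm_square_le_line_integral:
  fixes \<phi> :: "real^2 \<Rightarrow> 'b::euclidean_space"
  assumes t: "test_function (ball 0 R) \<phi>"
  shows "ennreal ((norm (\<phi> (x + a *\<^sub>R axis i 1)))\<^sup>2)
    \<le> (\<integral>\<^sup>+s. ennreal (2 * (norm (\<phi> (x + s *\<^sub>R axis i 1)) * norm (partial i \<phi> (x + s *\<^sub>R axis i 1)))) \<partial>lborel)"
proof -
  let ?l = "\<lambda>s. x + s *\<^sub>R (axis i 1 :: real^2)"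
  have sm: "smooth \<phi>" by (rule test_function_smooth[OF t])
  define f where "f x = \<phi> x \<bullet> \<phi> x" for x
  have sf: "smooth f" unfolding f_def[abs_def] by (intro smooth_inner sm)
  have pf: "partial i f y = 2 * (\<phi> y \<bullet> partial i \<phi> y)" for y
    unfolding f_def[abs_def]
    using partial_bilinear[OF bounded_bilinear_inner smooth_differentiable[OF sm, of y] smooth_differentiable[OF sm, of y], where i=i]
    by (simp add: inner_commute)
  define g where "g s = partial i f (?l s)" for s
  have gc: "continuous_on UNIV g"
    unfolding g_def[abs_def]
    by (rule continuous_on_compose2[OF smooth_continuous[OF smooth_partial[OF sf], of UNIV]]) (auto intro!: continuous_intros)
  have gd: "((\<lambda>s. f (?l s)) has_real_derivative g s) (at s)" for s
    unfolding g_def by (rule partial_line_derivative[OF smooth_differentiable[OF sf]])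
  \<comment> \<open>Large enough for \<open>- L \<le> a\<close> and for the starting point
    \<open>x - L e\<^sub>i\<close> to lie outside the disk.\<close>
  define L where "L = \<bar>a\<bar> + norm x + \<bar>R\<bar>"
  have La: "- L \<le> a" using norm_ge_zero[of x] unfolding L_def by linarith
  have z: "f (?l (- L)) = 0"
  proof -
    have "norm (?l (- L)) \<ge> norm ((- L) *\<^sub>R (axis i 1 :: real^2)) - norm x"
      using norm_triangle_ineq2[of "(- L) *\<^sub>R (axis i 1 :: real^2)" "- x"] by (simp add: add.commute)
    then have "norm (?l (- L)) \<ge> R" by (simp add: L_def norm_axis_1)
    then show ?thesis using test_function_zero[OF t, of "?l (- L)"] by (simp add: f_def)
  qed
  have gab: "\<bar>g s\<bar> \<le> 2 * (norm (\<phi> (?l s)) * norm (partial i \<phi> (?l s)))" for s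
    using Cauchy_Schwarz_ineq2[of "\<phi> (?l s)" "partial i \<phi> (?l s)"] by (simp add: g_def pf abs_mult)
  have int: "integrable lborel (\<lambda>s. indicator {- L..a} s *\<^sub>R \<bar>g s\<bar>)"
    by (rule borel_integrable_compact) (auto intro!: continuous_intros continuous_on_subset[OF gc])
  have int': "integrable lborel (\<lambda>s. g s * indicator {- L..a} s)"
    using borel_integrable_compact[of "{- L..a}" g] continuous_on_subset[OF gc] by (simp add: mult.commute)
  have "f (?l a) - f (?l (- L)) = (\<integral>s. g s * indicator {- L..a} s \<partial>lborel)"
    by (rule integral_FTC_Icc_real[OF La, symmetric]) (use gd gc in \<open>auto simp: continuous_on_eq_continuous_at\<close>)
  also have "\<dots> \<le> (\<integral>s. indicator {- L..a} s *\<^sub>R \<bar>g s\<bar> \<partial>lborel)"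
    by (rule integral_mono[OF int' int]) (auto simp: indicator_def)
  finally have "ennreal (f (?l a)) \<le> ennreal (\<integral>s. indicator {- L..a} s *\<^sub>R \<bar>g s\<bar> \<partial>lborel)"
    using z by (intro ennreal_leI) simp
  also have "\<dots> = (\<integral>\<^sup>+s. ennreal (indicator {- L..a} s *\<^sub>R \<bar>g s\<bar>) \<partial>lborel)"
    by (rule nn_integral_eq_integral[symmetric, OF int]) (simp add: indicator_def)
  also have "\<dots> \<le> (\<integral>\<^sup>+s. ennreal (2 * (norm (\<phi> (?l s)) * norm (partial i \<phi> (?l s)))) \<partial>lborel)"
    using gab by (intro nn_integral_mono ennreal_leI) (auto simp: indicator_def)
  finally show ?thesis by (simp add: f_def power2_norm_eq_inner)
qed

text \<open>The line bounds in the two coordinate directions give \<open>P b * Q a\<close> as a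
  bound of the fourth power at \<open>(a, b)\<close>. A product of functions of separate variables
  integrates to the product of the integrals, and Cauchy-Schwarz bounds each of these by twice the
  product of the norms of \<open>\<phi>\<close> and \<open>grad \<phi>\<close>.\<close>

lemma Ladyzhenskaya_test_function:
  fixes \<phi> :: "real^2 \<Rightarrow> 'b::euclidean_space"
  assumes t: "test_function (ball 0 R) \<phi>"
  shows "L2_norm_on (ball 0 R) (\<lambda>x. (norm (\<phi> x))\<^sup>2) \<le> 2 * (L2_norm_on (ball 0 R) \<phi> * L2_norm_on (ball 0 R) (grad \<phi>))"
proof -
  let ?N = "L2_norm_on (ball (0::real^2) R)" and ?M = "lebesgue_on (ball (0::real^2) R)"
  have sm: "smooth \<phi>" by (rule test_function_smooth[OF t])
  define k where "k i x = 2 * (norm (\<phi> x) * norm (partial i \<phi> x))" for i x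
  have kc: "continuous_on UNIV (k i)" for i
    unfolding k_def[abs_def] by (intro continuous_intros smooth_continuous smooth_partial sm)
  have km: "(\<lambda>x. ennreal (k i x)) \<in> borel_measurable borel" for i
    using borel_measurable_continuous_onI[OF kc] by simp
  have fm: "(\<lambda>x. ennreal ((norm (\<phi> x))^4)) \<in> borel_measurable borel"
    using borel_measurable_continuous_onI[OF smooth_continuous[OF sm]] by simp
  define P where "P b = (\<integral>\<^sup>+a. ennreal (k 1 (plane_point (a, b))) \<partial>lborel)" for b
  define Q where "Q a = (\<integral>\<^sup>+b. ennreal (k 2 (plane_point (a, b))) \<partial>lborel)" for a
  have mk: "(\<lambda>(a, b). ennreal (k i (plane_point (a, b)))) \<in> borel_measurable (lborel \<Otimes>\<^sub>M lborel)" for i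
    using measurable_compose[OF plane_point_measurable km[of i]] by (simp add: case_prod_beta')
  have mk': "(\<lambda>(b, a). ennreal (k i (plane_point (a, b)))) \<in> borel_measurable (lborel \<Otimes>\<^sub>M lborel)" for i
    using measurable_compose[OF measurable_pair_swap'[of "lborel::real measure" "lborel::real measure"] mk[of i]] by (simp add: case_prod_beta')
  have Qm: "Q \<in> borel_measurable lborel" unfolding Q_def[abs_def]
    using lborel.borel_measurable_nn_integral[OF mk[of 2]] by simp
  have Pm: "P \<in> borel_measurable lborel" unfolding P_def[abs_def]
    using lborel.borel_measurable_nn_integral[OF mk'[of 1]] by simp
  have le: "ennreal ((norm (\<phi> (plane_point (a, b))))^4) \<le> P b * Q a" for a b
  proof -
    have "ennreal ((norm (\<phi> (plane_point (a, b))))\<^sup>2) \<le> P b"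
      using norm_square_le_line_integral[OF t, of "b *\<^sub>R axis 2 1" a 1]
      by (simp add: P_def k_def plane_point_def add.commute)
    moreover have "ennreal ((norm (\<phi> (plane_point (a, b))))\<^sup>2) \<le> Q a"
      using norm_square_le_line_integral[OF t, of "a *\<^sub>R axis 1 1" b 2]
      by (simp add: Q_def k_def plane_point_def)
    ultimately have "ennreal ((norm (\<phi> (plane_point (a, b))))\<^sup>2) * ennreal ((norm (\<phi> (plane_point (a, b))))\<^sup>2) \<le> P b * Q a"
      by (rule mult_mono) auto
    then show ?thesis by (simp add: ennreal_mult[symmetric] flip: power_add)
  qed
  have "(\<integral>\<^sup>+x. ennreal ((norm (\<phi> x))^4) \<partial>lborel) \<le> (\<integral>\<^sup>+a. \<integral>\<^sup>+b. P b * Q a \<partial>lborel \<partial>lborel)"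
    unfolding nn_integral_plane(1)[OF fm] by (intro nn_integral_mono le)
  also have "\<dots> = (\<integral>\<^sup>+b. P b \<partial>lborel) * (\<integral>\<^sup>+a. Q a \<partial>lborel)"
    using Pm Qm by (simp add: nn_integral_multc nn_integral_cmult)
  also have "(\<integral>\<^sup>+b. P b \<partial>lborel) = (\<integral>\<^sup>+x. ennreal (k 1 x) \<partial>lborel)"
    unfolding P_def nn_integral_plane(2)[OF km] ..
  also have "(\<integral>\<^sup>+a. Q a \<partial>lborel) = (\<integral>\<^sup>+x. ennreal (k 2 x) \<partial>lborel)"
    unfolding Q_def nn_integral_plane(1)[OF km] ..
  finally have main: "(\<integral>\<^sup>+x. ennreal ((norm (\<phi> x))^4) \<partial>lborel)
      \<le> (\<integral>\<^sup>+x. ennreal (k 1 x) \<partial>lborel) * (\<integral>\<^sup>+x. ennreal (k 2 x) \<partial>lborel)" .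
  have kb: "(\<integral>\<^sup>+x. ennreal (k i x) \<partial>lborel) \<le> ennreal (2 * (?N \<phi> * ?N (grad \<phi>)))" for i
  proof -
    have z: "k i x = 0" if "x \<notin> ball 0 R" for x using test_function_zero[OF t that] by (simp add: k_def)
    have "integrable lborel (k i)"
      by (rule continuous_compact_support_integrable[OF kc, of R]) (simp add: z)
    then have "(\<integral>\<^sup>+x. ennreal (k i x) \<partial>lborel) = ennreal (\<integral>x. k i x \<partial>lborel)"
      by (rule nn_integral_eq_integral) (simp add: k_def)
    also have "(\<integral>x. k i x \<partial>lborel) = (\<integral>x. k i x \<partial>?M)"
      by (rule integral_lebesgue_on_zero_outside[symmetric]) (use z borel_measurable_continuous_onI[OF kc] in auto)
    also have "\<dots> = 2 * (\<integral>x. norm (\<phi> x) \<bullet> norm (partial i \<phi> x) \<partial>?M)" by (simp add: k_def)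
    also have "\<dots> \<le> 2 * (?N (\<lambda>x. norm (\<phi> x)) * ?N (\<lambda>x. norm (partial i \<phi> x)))"
    proof -
      have "in_L2 (ball 0 R) (\<lambda>x. norm (\<phi> x))" "in_L2 (ball 0 R) (\<lambda>x. norm (partial i \<phi> x))"
        by (intro in_L2_continuous continuous_intros smooth_continuous smooth_partial sm)+
      from L2_Cauchy_Schwarz[OF this] show ?thesis by simp
    qed
    also have "\<dots> \<le> 2 * (?N \<phi> * ?N (grad \<phi>))"
      using L2_norm_nth_le[OF in_L2_grad[OF sm], of R i]
      by (intro mult_left_mono mult_mono) (auto simp: L2_norm_on_def grad_def)
    finally show ?thesis by (simp add: ennreal_leI)
  qed
  have i4: "integrable lborel (\<lambda>x. (norm (\<phi> x))^4)"
    by (rule continuous_compact_support_integrable[of _ R])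
       (use test_function_zero[OF t] in \<open>auto intro!: continuous_on_power continuous_on_norm smooth_continuous[OF sm]\<close>)
  have "ennreal (\<integral>x. (norm (\<phi> x))^4 \<partial>lborel) = (\<integral>\<^sup>+x. ennreal ((norm (\<phi> x))^4) \<partial>lborel)"
    by (rule nn_integral_eq_integral[OF i4, symmetric]) simp
  also have "\<dots> \<le> ennreal (2 * (?N \<phi> * ?N (grad \<phi>))) * ennreal (2 * (?N \<phi> * ?N (grad \<phi>)))"
    using main kb by (meson mult_mono order_trans zero_le)
  also have "\<dots> = ennreal ((2 * (?N \<phi> * ?N (grad \<phi>)))\<^sup>2)"
    by (simp add: ennreal_mult[symmetric] power2_eq_square)
  finally have "(\<integral>x. (norm (\<phi> x))^4 \<partial>lborel) \<le> (2 * (?N \<phi> * ?N (grad \<phi>)))\<^sup>2" by simp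
  moreover have "(\<integral>x. (norm (\<phi> x))^4 \<partial>lborel) = (?N (\<lambda>x. (norm (\<phi> x))\<^sup>2))\<^sup>2"
  proof -
    have "(\<integral>x. (norm (\<phi> x))^4 \<partial>lborel) = (\<integral>x. (norm (\<phi> x))^4 \<partial>?M)"
      by (rule integral_lebesgue_on_zero_outside[symmetric]) (use i4 test_function_zero[OF t] in auto)
    then show ?thesis by (simp add: L2_norm_on_power2 flip: power_mult)
  qed
  ultimately have "(?N (\<lambda>x. (norm (\<phi> x))\<^sup>2))\<^sup>2 \<le> (2 * (?N \<phi> * ?N (grad \<phi>)))\<^sup>2" by simp
  then show ?thesis by (rule power2_le_imp_le) simp
qed

text \<open>An almost everywhere convergent subsequence and Fatou's lemma carry the bound on fourth
  powers to the limit. Integrability of the fourth power is part of what is gained, so it cannot be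
  presupposed in the passage to the limit.\<close>

lemma Ladyzhenskaya_H10:
  fixes f :: "real^2 \<Rightarrow> 'b::euclidean_space"
  assumes H: "H10_with_grad (ball 0 R) f g"
  shows "in_L2 (ball 0 R) (\<lambda>x. (norm (f x))\<^sup>2)"
    and "L2_norm_on (ball 0 R) (\<lambda>x. (norm (f x))\<^sup>2) \<le> 2 * (L2_norm_on (ball 0 R) f * L2_norm_on (ball 0 R) g)"
proof -
  let ?N = "L2_norm_on (ball (0::real^2) R)" and ?M = "lebesgue_on (ball (0::real^2) R)"
  obtain \<phi> :: "nat \<Rightarrow> real^2 \<Rightarrow> 'b" where p: "\<And>n. test_function (ball 0 R) (\<phi> n)"
    "(\<lambda>n. L2_norm_on (ball 0 R) (\<lambda>x. \<phi> n x - f x)) \<longlonglongrightarrow> 0"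
    "(\<lambda>n. L2_norm_on (ball 0 R) (\<lambda>x. grad (\<phi> n) x - g x)) \<longlonglongrightarrow> 0"
    "\<And>n. in_L2 (ball 0 R) (\<phi> n)" "\<And>n. in_L2 (ball 0 R) (grad (\<phi> n))"
    "in_L2 (ball 0 R) f" "in_L2 (ball 0 R) g"
    by (rule H10_with_gradE[OF H]) blast
  have fm: "f \<in> borel_measurable ?M" using p(6) by (simp add: in_L2_def)
  have "\<exists>r. strict_mono r \<and> (AE x in ?M. (\<lambda>n. (norm (\<phi> (r n) x - f x))\<^sup>2) \<longlonglongrightarrow> 0)"
  proof (rule tendsto_L1_AE_subseq)
    show "integrable ?M (\<lambda>x. (norm (\<phi> n x - f x))\<^sup>2)" for n
      using in_L2_diff[OF p(4,6)] unfolding in_L2_def by blast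
    have "(\<lambda>n. (?N (\<lambda>x. \<phi> n x - f x))\<^sup>2) \<longlonglongrightarrow> 0\<^sup>2" by (intro tendsto_intros p)
    then show "(\<lambda>n. \<integral>x. norm ((norm (\<phi> n x - f x))\<^sup>2) \<partial>?M) \<longlonglongrightarrow> 0"
      by (simp add: L2_norm_on_power2)
  qed
  then obtain r :: "nat \<Rightarrow> nat" where r: "strict_mono r" "AE x in ?M. (\<lambda>n. (norm (\<phi> (r n) x - f x))\<^sup>2) \<longlonglongrightarrow> 0" by blast
  define c where "c n = 2 * (?N (\<phi> n) * ?N (grad (\<phi> n)))" for n
  have cl: "c \<longlonglongrightarrow> 2 * (?N f * ?N g)"
    unfolding c_def[abs_def] by (intro tendsto_intros L2_tendsto_norm p)
  have b: "(\<integral>\<^sup>+x. ennreal ((norm (\<phi> n x))^4) \<partial>?M) \<le> ennreal ((c n)\<^sup>2)" for n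
  proof -
    have "in_L2 (ball 0 R) (\<lambda>x. (norm (\<phi> n x))\<^sup>2)"
      by (intro in_L2_continuous continuous_intros smooth_continuous test_function_smooth[OF p(1)])
    then have i4: "integrable ?M (\<lambda>x. (norm (\<phi> n x))^4)" by (simp add: in_L2_def flip: power_mult)
    have "(\<integral>\<^sup>+x. ennreal ((norm (\<phi> n x))^4) \<partial>?M) = ennreal (\<integral>x. (norm (\<phi> n x))^4 \<partial>?M)"
      by (rule nn_integral_eq_integral[OF i4]) simp
    also have "(\<integral>x. (norm (\<phi> n x))^4 \<partial>?M) = (?N (\<lambda>x. (norm (\<phi> n x))\<^sup>2))\<^sup>2"
      by (simp add: L2_norm_on_power2 flip: power_mult)
    also have "\<dots> \<le> (c n)\<^sup>2"
      unfolding c_def by (intro power_mono Ladyzhenskaya_test_function p) simp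
    finally show ?thesis by (simp add: ennreal_leI)
  qed
  have "(\<integral>\<^sup>+x. ennreal ((norm (f x))^4) \<partial>?M) \<le> (\<integral>\<^sup>+x. liminf (\<lambda>n. ennreal ((norm (\<phi> (r n) x))^4)) \<partial>?M)"
  proof (rule nn_integral_mono_AE, rule eventually_mono[OF r(2)])
    fix x assume "(\<lambda>n. (norm (\<phi> (r n) x - f x))\<^sup>2) \<longlonglongrightarrow> 0"
    then have "(\<lambda>n. sqrt ((norm (\<phi> (r n) x - f x))\<^sup>2)) \<longlonglongrightarrow> sqrt 0" by (rule tendsto_real_sqrt)
    then have "(\<lambda>n. \<phi> (r n) x - f x) \<longlonglongrightarrow> 0" by (simp add: tendsto_norm_zero_iff)
    then have "(\<lambda>n. \<phi> (r n) x) \<longlonglongrightarrow> f x" by (rule LIM_zero_cancel)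
    then have "(\<lambda>n. ennreal ((norm (\<phi> (r n) x))^4)) \<longlonglongrightarrow> ennreal ((norm (f x))^4)"
      by (intro tendsto_intros)
    then show "ennreal ((norm (f x))^4) \<le> liminf (\<lambda>n. ennreal ((norm (\<phi> (r n) x))^4))"
      using lim_imp_Liminf[OF sequentially_bot] by fastforce
  qed
  also have "\<dots> \<le> liminf (\<lambda>n. \<integral>\<^sup>+x. ennreal ((norm (\<phi> (r n) x))^4) \<partial>?M)"
  proof (rule nn_integral_liminf)
    fix n have "\<phi> (r n) \<in> borel_measurable ?M" using p(4) by (simp add: in_L2_def)
    then show "(\<lambda>x. ennreal ((norm (\<phi> (r n) x))^4)) \<in> borel_measurable ?M" by measurable
  qed
  also have "\<dots> \<le> liminf (\<lambda>n. ennreal ((c (r n))\<^sup>2))"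
    by (rule Liminf_mono) (simp add: b)
  also have "\<dots> = ennreal ((2 * (?N f * ?N g))\<^sup>2)"
  proof (rule lim_imp_Liminf)
    have "(\<lambda>n. c (r n)) \<longlonglongrightarrow> 2 * (?N f * ?N g)"
      using LIMSEQ_subseq_LIMSEQ[OF cl r(1)] by (simp add: o_def)
    then show "(\<lambda>n. ennreal ((c (r n))\<^sup>2)) \<longlonglongrightarrow> ennreal ((2 * (?N f * ?N g))\<^sup>2)"
      by (intro tendsto_intros)
  qed simp
  finally have fin: "(\<integral>\<^sup>+x. ennreal ((norm (f x))^4) \<partial>?M) \<le> ennreal ((2 * (?N f * ?N g))\<^sup>2)" .
  have m4: "(\<lambda>x. (norm (f x))^4) \<in> borel_measurable ?M" using fm by measurable
  have i4: "integrable ?M (\<lambda>x. (norm (f x))^4)"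
    by (rule integrableI_nonneg[OF m4]) (use fin in \<open>auto simp: le_less_trans\<close>)
  show "in_L2 (ball 0 R) (\<lambda>x. (norm (f x))\<^sup>2)"
    using i4 fm by (auto simp: in_L2_def simp flip: power_mult)
  have "ennreal (\<integral>x. (norm (f x))^4 \<partial>?M) \<le> ennreal ((2 * (?N f * ?N g))\<^sup>2)"
    using fin nn_integral_eq_integral[OF i4] by simp
  then have "(?N (\<lambda>x. (norm (f x))\<^sup>2))\<^sup>2 \<le> (2 * (?N f * ?N g))\<^sup>2"
    by (simp add: L2_norm_on_power2 flip: power_mult)
  then show "?N (\<lambda>x. (norm (f x))\<^sup>2) \<le> 2 * (?N f * ?N g)" by (rule power2_le_imp_le) simp
qed

section \<open>The convection term\<close>

lemma norm_tensor: "norm (tensor a b) = norm a * norm b"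
proof -
  have "(norm (tensor a b))\<^sup>2 = (norm a * norm b)\<^sup>2"
    by (simp add: power_mult_distrib power2_norm_eq_inner tensor_def inner_vec_def sum_2 algebra_simps)
  then show ?thesis by (simp add: power2_eq_iff_nonneg)
qed

lemma tensor_inner: "tensor a b \<bullet> g = (\<Sum>i\<in>UNIV. a $ i * (b \<bullet> g $ i))"
  by (simp add: tensor_def inner_vec_def sum_2 algebra_simps)

lemma bounded_bilinear_tensor: "bounded_bilinear tensor"
proof (rule bounded_bilinear.intro)
  show "\<exists>K. \<forall>a b. norm (tensor a b) \<le> norm a * norm b * K" by (rule exI[of _ 1]) (simp add: norm_tensor)
qed (simp_all add: tensor_def vec_eq_iff algebra_simps)

text \<open>The norm of a tensor product is the product of the norms, so its square is a pairing of
  the two squared norms, to which Cauchy-Schwarz applies.\<close>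

lemma L2_tensor:
  assumes "in_L2 S f" "in_L2 S (\<lambda>x. (norm (f x))\<^sup>2)" "in_L2 S h" "in_L2 S (\<lambda>x. (norm (h x))\<^sup>2)"
  shows "in_L2 S (\<lambda>x. tensor (f x) (h x))"
    and "(L2_norm_on S (\<lambda>x. tensor (f x) (h x)))\<^sup>2 \<le> L2_norm_on S (\<lambda>x. (norm (f x))\<^sup>2) * L2_norm_on S (\<lambda>x. (norm (h x))\<^sup>2)"
proof -
  let ?M = "lebesgue_on S"
  have c: "continuous_on UNIV (\<lambda>p. tensor (fst p) (snd p))"
    by (intro bounded_bilinear.continuous_on[OF bounded_bilinear_tensor] continuous_intros)
  have "(\<lambda>x. (f x, h x)) \<in> borel_measurable ?M"
    using assms by (intro borel_measurable_Pair) (auto simp: in_L2_def)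
  from measurable_compose[OF this borel_measurable_continuous_onI[OF c]]
  have m: "(\<lambda>x. tensor (f x) (h x)) \<in> borel_measurable ?M" by simp
  have n: "(norm (tensor (f x) (h x)))\<^sup>2 = (norm (f x))\<^sup>2 \<bullet> (norm (h x))\<^sup>2" for x
    by (simp add: norm_tensor power_mult_distrib)
  have "integrable ?M (\<lambda>x. (norm (tensor (f x) (h x)))\<^sup>2)"
    unfolding n by (rule in_L2_inner_integrable[OF assms(2,4)])
  then show "in_L2 S (\<lambda>x. tensor (f x) (h x))" using m by (simp add: in_L2_def)
  show "(L2_norm_on S (\<lambda>x. tensor (f x) (h x)))\<^sup>2 \<le> L2_norm_on S (\<lambda>x. (norm (f x))\<^sup>2) * L2_norm_on S (\<lambda>x. (norm (h x))\<^sup>2)"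
    unfolding L2_norm_on_power2 n using L2_Cauchy_Schwarz[OF assms(2,4)] by simp
qed

lemma L2_tendsto_inner_both:
  assumes "\<And>n::nat. in_L2 S (f n)" "in_L2 S g" "(\<lambda>n. L2_norm_on S (\<lambda>x. f n x - g x)) \<longlonglongrightarrow> 0"
    and "\<And>n::nat. in_L2 S (f' n)" "in_L2 S g'" "(\<lambda>n. L2_norm_on S (\<lambda>x. f' n x - g' x)) \<longlonglongrightarrow> 0"
  shows "(\<lambda>n. \<integral>x. f n x \<bullet> f' n x \<partial>lebesgue_on S) \<longlonglongrightarrow> (\<integral>x. g x \<bullet> g' x \<partial>lebesgue_on S)"
proof -
  have "(\<lambda>n. \<integral>x. (f n x - g x) \<bullet> f' n x \<partial>lebesgue_on S) \<longlonglongrightarrow> 0"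
  proof (rule Lim_null_comparison[OF always_eventually], rule allI)
    fix n
    show "norm (\<integral>x. (f n x - g x) \<bullet> f' n x \<partial>lebesgue_on S) \<le> L2_norm_on S (\<lambda>x. f n x - g x) * L2_norm_on S (f' n)"
      using L2_Cauchy_Schwarz[OF in_L2_diff[OF assms(1,2)] assms(4)] by simp
    show "(\<lambda>n. L2_norm_on S (\<lambda>x. f n x - g x) * L2_norm_on S (f' n)) \<longlonglongrightarrow> 0"
      using tendsto_mult[OF assms(3) L2_tendsto_norm[OF assms(4,5,6)]] by simp
  qed
  moreover have "(\<integral>x. f n x \<bullet> f' n x \<partial>lebesgue_on S)
      = (\<integral>x. (f n x - g x) \<bullet> f' n x \<partial>lebesgue_on S) + (\<integral>x. g x \<bullet> f' n x \<partial>lebesgue_on S)" for n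
    using in_L2_inner_integrable[OF assms(1)[of n] assms(4)[of n]] in_L2_inner_integrable[OF assms(2) assms(4)[of n]]
    by (simp add: inner_diff_left)
  ultimately show ?thesis
    using tendsto_add[OF _ L2_tendsto_inner[OF assms(4,5,2,6)]] by fastforce
qed

lemma partial_solid_body: "partial i (solid_body \<omega>) x = (\<omega> / 2) *\<^sub>R perp (axis i 1)"
  and smooth_solid_body: "smooth (solid_body \<omega>)"
proof -
  have l: "linear (solid_body \<omega>)"
    by (rule linearI) (auto simp: solid_body_def perp_def vec_eq_iff forall_2 algebra_simps)
  then have bl: "bounded_linear (solid_body \<omega>)" by (simp add: linear_conv_bounded_linear)
  show "smooth (solid_body \<omega>)" by (rule smooth_bounded_linear[OF bl])
  show "partial i (solid_body \<omega>) x = (\<omega> / 2) *\<^sub>R perp (axis i 1)"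
    using partial_eq[OF bounded_linear_imp_has_derivative[OF bl], of i] by (simp add: solid_body_def)
qed

lemma divergence_add:
  assumes "smooth f" "smooth g"
  shows "divergence (\<lambda>x. f x + g x) x = divergence f x + divergence g x"
  using assms by (simp add: divergence_def partial_add smooth_differentiable sum.distrib)

lemma divergence_solid_body: "divergence (solid_body \<omega>) x = 0"
  by (simp add: divergence_def partial_solid_body sum_2 perp_def axis_def)

text \<open>For a solenoidal \<open>\<phi>\<close> and the solid body rotation \<open>b\<close>, the convection term is the
  divergence of \<open>(\<bar>\<phi>\<bar>\<^sup>2 / 2 + b \<bullet> \<phi>) (\<phi> + b) + (\<omega> \<bar>x\<bar>)\<^sup>2 \<phi> / 8\<close>; the last summand
  compensates for \<open>b \<bullet> \<nabla>b = - \<nabla> (\<omega> \<bar>x\<bar>)\<^sup>2 / 8\<close>.\<close>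

lemma convection_test_function:
  assumes t: "test_function (ball 0 R) \<phi>" and div: "\<And>x. divergence \<phi> x = 0"
  shows "(\<integral>x. tensor (\<phi> x + solid_body \<omega> x) (\<phi> x + solid_body \<omega> x) \<bullet> grad \<phi> x \<partial>lebesgue_on (ball 0 R)) = 0"
proof -
  let ?b = "solid_body \<omega>"
  have sm: "smooth \<phi>" by (rule test_function_smooth[OF t])
  define q where "q x = (1/2) * (\<phi> x \<bullet> \<phi> x) + ?b x \<bullet> \<phi> x" for x
  define w where "w x = \<phi> x + ?b x" for x
  define s where "s x = (\<omega>\<^sup>2 / 8) * (norm x)\<^sup>2" for x :: "real^2"
  have sq: "smooth q" unfolding q_def[abs_def] by (intro smooth_add smooth_mult smooth_inner smooth_const sm smooth_solid_body)
  have sw: "smooth w" unfolding w_def[abs_def] by (intro smooth_add sm smooth_solid_body)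
  have ss: "smooth s" unfolding s_def[abs_def] by (intro smooth_mult smooth_const smooth_norm_square)
  define X where "X x = q x *\<^sub>R w x + s x *\<^sub>R \<phi> x" for x
  have sX: "smooth X" unfolding X_def[abs_def] by (intro smooth_add smooth_scaleR sq sw ss sm)
  have dX: "divergence X x = w x \<bullet> grad q x + \<phi> x \<bullet> grad s x" for x
  proof -
    have "divergence w x = 0"
      unfolding w_def[abs_def] using divergence_add[OF sm smooth_solid_body] by (simp add: div divergence_solid_body)
    then show ?thesis
      unfolding X_def[abs_def]
      using divergence_add[OF smooth_scaleR[OF sq sw] smooth_scaleR[OF ss sm], of x]
      by (simp add: divergence_scaleR smooth_differentiable sq sw ss sm div)
  qed
  have gq: "grad q x $ i = \<phi> x \<bullet> partial i \<phi> x + ?b x \<bullet> partial i \<phi> x + ((\<omega> / 2) *\<^sub>R perp (axis i 1)) \<bullet> \<phi> x" for i x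
  proof -
    have dp: "\<phi> differentiable (at x)" and db: "?b differentiable (at x)"
      by (auto intro: smooth_differentiable sm smooth_solid_body)
    have 1: "partial i (\<lambda>x. \<phi> x \<bullet> \<phi> x) x = 2 * (\<phi> x \<bullet> partial i \<phi> x)"
      using partial_bilinear[OF bounded_bilinear_inner dp dp] by (simp add: inner_commute)
    have 2: "partial i (\<lambda>x. (1/2) * (\<phi> x \<bullet> \<phi> x)) x = \<phi> x \<bullet> partial i \<phi> x"
      using partial_linear[OF bounded_linear_mult_right[of "1/2"] differentiable_bilinear[OF bounded_bilinear_inner dp dp], where i=i]
      by (simp add: 1)
    have 3: "partial i (\<lambda>x. ?b x \<bullet> \<phi> x) x = ?b x \<bullet> partial i \<phi> x + ((\<omega> / 2) *\<^sub>R perp (axis i 1)) \<bullet> \<phi> x"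
      using partial_bilinear[OF bounded_bilinear_inner db dp] by (simp add: partial_solid_body)
    have "grad q x $ i = partial i (\<lambda>x. (1/2) * (\<phi> x \<bullet> \<phi> x)) x + partial i (\<lambda>x. ?b x \<bullet> \<phi> x) x"
      unfolding grad_def q_def[abs_def]
      by (simp only: vec_lambda_beta)
        (intro partial_add smooth_differentiable smooth_mult smooth_inner smooth_const sm smooth_solid_body)
    then show ?thesis by (simp only: 2 3 add.assoc)
  qed
  have gs: "grad s x $ i = (\<omega>\<^sup>2 / 4) * x $ i" for i x
    unfolding grad_def s_def[abs_def]
    using partial_linear[OF bounded_linear_mult_right smooth_differentiable[OF smooth_norm_square], of i "\<omega>\<^sup>2 / 8" x]
    by (simp add: partial_norm_square)
  have "divergence X x = tensor (w x) (w x) \<bullet> grad \<phi> x" for x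
    unfolding dX tensor_inner inner_vec_def[of _ "grad q x"] inner_vec_def[of _ "grad s x"] gq gs
    by (simp add: w_def grad_def inner_add_left sum_2 inner_vec_def perp_def axis_def solid_body_def
        field_simps power2_eq_square)
  then have "(\<integral>x. tensor (w x) (w x) \<bullet> grad \<phi> x \<partial>lebesgue_on (ball 0 R)) = (\<integral>x. divergence X x \<partial>lebesgue_on (ball 0 R))"
    by simp
  also have "\<dots> = 0"
    by (intro integral_divergence_zero smooth_differentiable smooth_continuous smooth_partial sX)
       (use test_function_zero[OF t] in \<open>simp add: X_def q_def\<close>)
  finally show ?thesis by (simp add: w_def)
qed

lemma in_L2_norm_square_add:
  assumes "in_L2 S f" "in_L2 S (\<lambda>x. (norm (f x))\<^sup>2)" "in_L2 S h" "in_L2 S (\<lambda>x. (norm (h x))\<^sup>2)"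
  shows "in_L2 S (\<lambda>x. (norm (f x + h x))\<^sup>2)"
proof -
  have m: "(\<lambda>x. f x + h x) \<in> borel_measurable (lebesgue_on S)"
    using in_L2_add[OF assms(1,3)] by (simp add: in_L2_def)
  have i: "in_L2 S (\<lambda>x. 2 *\<^sub>R (norm (f x))\<^sup>2 + 2 *\<^sub>R (norm (h x))\<^sup>2)"
    by (intro in_L2_add in_L2_scaleR assms)
  have "integrable (lebesgue_on S) (\<lambda>x. (norm ((norm (f x + h x))\<^sup>2))\<^sup>2)"
  proof (rule Bochner_Integration.integrable_bound[where f="\<lambda>x. (norm (2 *\<^sub>R (norm (f x))\<^sup>2 + 2 *\<^sub>R (norm (h x))\<^sup>2))\<^sup>2"])
    show "AE x in lebesgue_on S. norm ((norm ((norm (f x + h x))\<^sup>2))\<^sup>2) \<le> norm ((norm (2 *\<^sub>R (norm (f x))\<^sup>2 + 2 *\<^sub>R (norm (h x))\<^sup>2))\<^sup>2)"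
    proof (rule AE_I2)
      fix x
      have "((norm (f x + h x))\<^sup>2)\<^sup>2 \<le> (2 * (norm (f x))\<^sup>2 + 2 * (norm (h x))\<^sup>2)\<^sup>2"
        by (intro power_mono norm_add_square_le) simp
      then show "norm ((norm ((norm (f x + h x))\<^sup>2))\<^sup>2) \<le> norm ((norm (2 *\<^sub>R (norm (f x))\<^sup>2 + 2 *\<^sub>R (norm (h x))\<^sup>2))\<^sup>2)"
        by simp
    qed
  qed (use i m in \<open>auto simp: in_L2_def\<close>)
  then show ?thesis using m by (auto simp: in_L2_def)
qed

text \<open>Solenoidal test functions satisfy the identity by
  \<open>convection_test_function\<close>. The quadratic term is the obstacle in the limit: the
  tensors have to converge in L2, hence the errors in L4, and this is what Ladyzhenskaya's
  inequality provides.\<close>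

lemma convection_H10:
  assumes R: "R > 0" and H: "H10_with_grad (ball 0 R) v g" and d: "div_free_distr (ball 0 R) v"
  shows "in_L2 (ball 0 R) (\<lambda>x. tensor (v x + solid_body \<omega> x) (v x + solid_body \<omega> x))"
    and "(\<integral>x. tensor (v x + solid_body \<omega> x) (v x + solid_body \<omega> x) \<bullet> g x \<partial>lebesgue_on (ball 0 R)) = 0"
proof -
  let ?B = "ball (0::real^2) R" and ?b = "solid_body \<omega>"
  let ?N = "L2_norm_on ?B"
  obtain \<psi> where p: "\<And>n::nat. test_function ?B (\<psi> n)" "\<And>n x. divergence (\<psi> n) x = 0"
    "(\<lambda>n. ?N (\<lambda>x. \<psi> n x - v x)) \<longlonglongrightarrow> 0" "(\<lambda>n. ?N (\<lambda>x. grad (\<psi> n) x - g x)) \<longlonglongrightarrow> 0"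
    by (rule solenoidal_test_functions_dense[OF R H d]) blast
  have L: "in_L2 ?B v" "in_L2 ?B g" using H by (auto simp: H10_with_grad_def)
  have Lp: "in_L2 ?B (\<psi> n)" "in_L2 ?B (grad (\<psi> n))" for n
    by (intro in_L2_smooth in_L2_grad test_function_smooth[OF p(1)])+
  have b: "in_L2 ?B ?b" "in_L2 ?B (\<lambda>x. (norm (?b x))\<^sup>2)"
    by (intro in_L2_continuous continuous_intros smooth_continuous smooth_solid_body)+
  define w where "w x = v x + ?b x" for x
  have w: "in_L2 ?B w" "in_L2 ?B (\<lambda>x. (norm (w x))\<^sup>2)"
    unfolding w_def[abs_def]
    by (intro in_L2_add in_L2_norm_square_add L b Ladyzhenskaya_H10(1)[OF H])+
  show T: "in_L2 ?B (\<lambda>x. tensor (v x + ?b x) (v x + ?b x))"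
    using L2_tensor(1)[OF w w] by (simp add: w_def)
  define e where "e n x = \<psi> n x - v x" for n x
  have He: "H10_with_grad ?B (e n) (\<lambda>x. grad (\<psi> n) x - g x)" for n
    unfolding e_def[abs_def] by (rule H10_diff[OF H10_test_function[OF p(1)] H])
  have e: "in_L2 ?B (e n)" "in_L2 ?B (\<lambda>x. (norm (e n x))\<^sup>2)" for n
    using Ladyzhenskaya_H10(1)[OF He[of n]] He[of n] by (auto simp: H10_with_grad_def)
  \<comment> \<open>The squared L4 norm of the error, which is at most twice the product of the L2
    errors of \<open>\<psi> n\<close> and of its gradient.\<close>
  define a where "a n = ?N (\<lambda>x. (norm (e n x))\<^sup>2)" for n
  have al: "a \<longlonglongrightarrow> 0"
  proof (rule Lim_null_comparison[OF always_eventually], rule allI)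
    fix n
    show "norm (a n) \<le> 2 * (?N (\<lambda>x. \<psi> n x - v x) * ?N (\<lambda>x. grad (\<psi> n) x - g x))"
      using Ladyzhenskaya_H10(2)[OF He[of n]] unfolding a_def by (simp add: e_def[abs_def])
    have "(\<lambda>n. 2 * (?N (\<lambda>x. \<psi> n x - v x) * ?N (\<lambda>x. grad (\<psi> n) x - g x))) \<longlonglongrightarrow> 2 * (0 * 0)"
      by (intro tendsto_intros p)
    then show "(\<lambda>n. 2 * (?N (\<lambda>x. \<psi> n x - v x) * ?N (\<lambda>x. grad (\<psi> n) x - g x))) \<longlonglongrightarrow> 0" by simp
  qed
  let ?A = "?N (\<lambda>x. (norm (w x))\<^sup>2)"
  have Te: "in_L2 ?B (\<lambda>x. tensor (w x) (e n x))" "in_L2 ?B (\<lambda>x. tensor (e n x) (w x))" "in_L2 ?B (\<lambda>x. tensor (e n x) (e n x))" for n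
    by (intro L2_tensor(1) w e)+
  have Tn: "in_L2 ?B (\<lambda>x. tensor (w x + e n x) (w x + e n x))" for n
    by (intro L2_tensor(1) in_L2_add in_L2_norm_square_add w e)
  have lim: "(\<lambda>n. ?N (\<lambda>x. tensor (w x + e n x) (w x + e n x) - tensor (w x) (w x))) \<longlonglongrightarrow> 0"
  proof (rule Lim_null_comparison[OF always_eventually], rule allI)
    fix n
    have "(\<lambda>x. tensor (w x + e n x) (w x + e n x) - tensor (w x) (w x))
        = (\<lambda>x. tensor (w x) (e n x) + (tensor (e n x) (w x) + tensor (e n x) (e n x)))"
      by (simp add: bounded_bilinear.add_left[OF bounded_bilinear_tensor] bounded_bilinear.add_right[OF bounded_bilinear_tensor] add_ac)
    then have "?N (\<lambda>x. tensor (w x + e n x) (w x + e n x) - tensor (w x) (w x))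
        \<le> ?N (\<lambda>x. tensor (w x) (e n x)) + (?N (\<lambda>x. tensor (e n x) (w x)) + ?N (\<lambda>x. tensor (e n x) (e n x)))"
      using L2_triangle[OF Te(1) in_L2_add[OF Te(2,3)], of n n n] L2_triangle[OF Te(2,3), of n n] by simp
    also have "\<dots> \<le> sqrt (?A * a n) + (sqrt (a n * ?A) + sqrt (a n * a n))"
      unfolding a_def by (intro add_mono real_le_rsqrt L2_tensor(2) w e)
    finally show "norm (?N (\<lambda>x. tensor (w x + e n x) (w x + e n x) - tensor (w x) (w x)))
       \<le> sqrt (?A * a n) + (sqrt (a n * ?A) + sqrt (a n * a n))" by simp
    have "(\<lambda>n. sqrt (?A * a n) + (sqrt (a n * ?A) + sqrt (a n * a n))) \<longlonglongrightarrow> sqrt (?A * 0) + (sqrt (0 * ?A) + sqrt (0 * 0))"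
      by (intro tendsto_intros al)
    then show "(\<lambda>n. sqrt (?A * a n) + (sqrt (a n * ?A) + sqrt (a n * a n))) \<longlonglongrightarrow> 0" by simp
  qed
  have "(\<lambda>n. \<integral>x. tensor (w x + e n x) (w x + e n x) \<bullet> grad (\<psi> n) x \<partial>lebesgue_on ?B)
      \<longlonglongrightarrow> (\<integral>x. tensor (w x) (w x) \<bullet> g x \<partial>lebesgue_on ?B)"
    by (rule L2_tendsto_inner_both[OF Tn L2_tensor(1)[OF w w] lim Lp(2) L(2) p(4)])
  moreover have "(\<integral>x. tensor (w x + e n x) (w x + e n x) \<bullet> grad (\<psi> n) x \<partial>lebesgue_on ?B) = 0" for n
  proof -
    have "w x + e n x = \<psi> n x + ?b x" for x by (simp add: w_def e_def)
    then show ?thesis using convection_test_function[OF p(1,2)] by (simp only:)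
  qed
  ultimately show "(\<integral>x. tensor (v x + ?b x) (v x + ?b x) \<bullet> g x \<partial>lebesgue_on ?B) = 0"
    by (simp add: LIMSEQ_const_iff w_def)
qed

section \<open>Measurability in space-time\<close>

lemma AE_sections_not_in_negligible:
  fixes N :: "('a::euclidean_space \<times> 'b::euclidean_space) set"
  assumes "negligible N" "A \<in> sets lebesgue" "B \<in> sets lebesgue"
  shows "AE t in lebesgue_on A. AE x in lebesgue_on B. (t, x) \<notin> N"
proof -
  have "AE z in lebesgue. z \<notin> N"
    using assms(1) by (simp add: negligible_iff_null_sets AE_not_in)
  then have "AE z in (lborel \<Otimes>\<^sub>M lborel :: ('a \<times> 'b) measure). z \<notin> N"
    unfolding lborel_prod by (simp add: AE_completion_iff)
  then have "AE t in (lborel :: 'a measure). AE x in (lborel :: 'b measure). (t, x) \<notin> N"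
    by (rule lborel_pair.AE_pair)
  then have "AE t in (lborel :: 'a measure). AE x in lebesgue. (t, x) \<notin> N"
    by (simp add: AE_completion_iff)
  then have "AE t in lebesgue. AE x in lebesgue. (t, x) \<notin> N"
    by (simp add: AE_completion_iff)
  then show ?thesis
    using assms by (simp add: AE_restrict_space_iff) (auto elim!: eventually_mono)
qed

text \<open>Space-time measurability is given for the completed Lebesgue measure of the product,
  whose sigma-algebra is larger than the product of those of the factors, so Fubini does not apply
  directly. Outside a null set the function is a limit of continuous ones, and almost every time
  section of that null set is null.\<close>

lemma continuous_approximation:
  fixes F :: "real \<times> (real^2) \<Rightarrow> 'b::euclidean_space"
  assumes "F \<in> borel_measurable (lebesgue_on ({0..} \<times> ball 0 R))"
  obtains g where "\<And>n::nat. continuous_on UNIV (g n)"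
    "AE t in lebesgue_on {0..}. AE x in lebesgue_on (ball 0 R). (\<lambda>n. g n (t, x)) \<longlonglongrightarrow> F (t, x)"
proof -
  have S: "({0::real..} \<times> ball (0::real^2) R) \<in> sets lebesgue"
  proof -
    have "({0::real..} \<times> ball (0::real^2) R) \<in> sets borel" by (intro borel_Times) auto
    then show ?thesis by (intro sets_completionI_sets) simp
  qed
  have "F measurable_on ({0..} \<times> ball 0 R)" using assms by (simp add: measurable_on_iff_borel_measurable[OF S])
  then obtain N g where N: "negligible N" "\<And>n. continuous_on UNIV (g n)"
    "\<And>z. z \<notin> N \<Longrightarrow> (\<lambda>n. g n z) \<longlonglongrightarrow> (if z \<in> {0..} \<times> ball 0 R then F z else 0)"
    unfolding measurable_on_def by blast
  have "AE t in lebesgue_on {0..}. AE x in lebesgue_on (ball 0 R). (t, x) \<notin> N"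
    by (rule AE_sections_not_in_negligible[OF N(1)]) auto
  then have "AE t in lebesgue_on {0..}. AE x in lebesgue_on (ball 0 R). (\<lambda>n. g n (t, x)) \<longlonglongrightarrow> F (t, x)"
    using AE_space[of "lebesgue_on {0::real..}"]
  proof eventually_elim
    case (elim t)
    have t: "t \<ge> 0" using elim(2) by simp
    show ?case
      using elim(1) AE_space[of "lebesgue_on (ball (0::real^2) R)"]
    proof eventually_elim
      case (elim x)
      then show ?case using N(3)[of "(t, x)"] t by simp
    qed
  qed
  then show thesis using that N(2) by blast
qed

lemma borel_measurable_lebesgue_on_AE:
  fixes f :: "'a::euclidean_space \<Rightarrow> 'b::euclidean_space"
  assumes "f \<in> borel_measurable (lebesgue_on S)" "AE x in lebesgue_on S. f x = g x" "S \<in> sets lebesgue"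
  shows "g \<in> borel_measurable (lebesgue_on S)"
proof -
  have "(\<lambda>x. if x \<in> S then f x else 0) \<in> borel_measurable lebesgue"
    using assms by (simp add: borel_measurable_if)
  moreover have "AE x in lebesgue. (if x \<in> S then f x else 0) = (if x \<in> S then g x else 0)"
    using assms by (auto simp: AE_restrict_space_iff elim: eventually_mono)
  ultimately have "(\<lambda>x. if x \<in> S then g x else 0) \<in> borel_measurable lebesgue"
    by (rule borel_measurable_AE)
  then show ?thesis using assms(3) by (simp add: borel_measurable_if)
qed

text \<open>The limit of the continuous approximations is Borel, so its section integrals are
  measurable by Fubini; for almost every \<open>t\<close> its section agrees with \<open>F t\<close>
  almost everywhere.\<close>

lemma measurable_section_integral:
  fixes F :: "real \<Rightarrow> real^2 \<Rightarrow> real"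
  assumes "(\<lambda>(t, x). F t x) \<in> borel_measurable (lebesgue_on ({0..} \<times> ball 0 R))"
    and sec: "AE t in lebesgue_on {0..}. F t \<in> borel_measurable (lebesgue_on (ball 0 R))"
  shows "(\<lambda>t. \<integral>x. F t x \<partial>lebesgue_on (ball 0 R)) \<in> borel_measurable (lebesgue_on {0..})"
proof -
  let ?M = "lebesgue_on (ball (0::real^2) R)"
  interpret M: finite_measure ?M by (rule finite_measure_ball)
  obtain g where g: "\<And>n::nat. continuous_on UNIV (g n)"
    "AE t in lebesgue_on {0..}. AE x in ?M. (\<lambda>n. g n (t, x)) \<longlonglongrightarrow> (case (t, x) of (t, x) \<Rightarrow> F t x)"
    by (rule continuous_approximation[OF assms(1)]) blast
  define G where "G z = lim (\<lambda>n. g n z)" for z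
  have "G \<in> borel_measurable borel"
    unfolding G_def[abs_def] by (rule borel_measurable_lim_metric) (rule borel_measurable_continuous_onI[OF g(1)])
  then have Gm: "G \<in> borel_measurable (lebesgue_on {0..} \<Otimes>\<^sub>M ?M)" by (rule borel_measurable_pair_lebesgue_on)
  have Gs: "(\<lambda>x. G (t, x)) \<in> borel_measurable ?M" if "t \<ge> 0" for t
    using Gm that by (intro measurable_Pair2[of G "lebesgue_on {0..}" ?M borel t]) auto
  have "(\<lambda>t. \<integral>x. G (t, x) \<partial>?M) \<in> borel_measurable (lebesgue_on {0..})"
    using Gm by (intro M.borel_measurable_lebesgue_integral) simp
  moreover have "AE t in lebesgue_on {0..}. (\<integral>x. G (t, x) \<partial>?M) = (\<integral>x. F t x \<partial>?M)"
    using g(2) sec AE_space[of "lebesgue_on {0::real..}"]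
  proof eventually_elim
    case (elim t)
    show ?case
    proof (rule integral_cong_AE)
      show "(\<lambda>x. G (t, x)) \<in> borel_measurable ?M" using Gs elim by simp
      show "F t \<in> borel_measurable ?M" by fact
      show "AE x in ?M. G (t, x) = F t x"
        using elim(1) by eventually_elim (simp add: G_def limI)
    qed
  qed
  ultimately show ?thesis by (rule borel_measurable_lebesgue_on_AE) simp
qed

text \<open>For \<open>k > 0\<close> the radial retraction onto the closed ball of radius
  \<open>k\<close>; the maximum in the denominator makes continuity visible.\<close>

definition clamp_norm :: "real \<Rightarrow> 'b::real_normed_vector \<Rightarrow> 'b" where
  "clamp_norm k y = (k / max k (norm y)) *\<^sub>R y"

lemma clamp_norm_continuous: "k > 0 \<Longrightarrow> continuous_on UNIV (clamp_norm k)"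
  unfolding clamp_norm_def[abs_def] by (intro continuous_intros) auto

lemma clamp_norm_le: "k > 0 \<Longrightarrow> norm (clamp_norm k y) \<le> k"
  by (simp add: clamp_norm_def divide_le_eq max_def mult.commute)

lemma clamp_norm_id: "k > 0 \<Longrightarrow> norm y \<le> k \<Longrightarrow> clamp_norm k y = y"
  by (simp add: clamp_norm_def max_def)

lemma clamp_norm_diff_le: "k > 0 \<Longrightarrow> norm (clamp_norm k y - y) \<le> norm y"
proof -
  assume k: "k > 0"
  have "clamp_norm k y - y = (k / max k (norm y) - 1) *\<^sub>R y" by (simp add: clamp_norm_def scaleR_diff_left)
  moreover have "\<bar>k / max k (norm y) - 1\<bar> \<le> 1"
  proof -
    have "0 \<le> k / max k (norm y)" "k / max k (norm y) \<le> 1" using k by (auto simp: divide_le_eq_1)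
    then show ?thesis by linarith
  qed
  ultimately show ?thesis by (simp add: mult_left_le_one_le)
qed

lemma integrable_lebesgue_on_subset:
  fixes f :: "real \<Rightarrow> real"
  assumes "integrable (lebesgue_on {0..T}) f" "0 \<le> a" "b \<le> T"
  shows "integrable (lebesgue_on {a..b}) f"
  using assms integrable_subinterval[of 0 T f a b] by auto

lemma AE_lebesgue_on_mono:
  assumes "AE x in lebesgue_on A. P x" "B \<subseteq> A" "A \<in> sets lebesgue" "B \<in> sets lebesgue"
  shows "AE x in lebesgue_on B. P x"
  using assms by (auto simp: AE_restrict_space_iff elim!: eventually_mono)

lemma measurable_lebesgue_on_mono:
  assumes "f \<in> borel_measurable (lebesgue_on A)" "B \<subseteq> A" 
  shows "f \<in> borel_measurable (lebesgue_on B)"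
  using measurable_restrict_mono[OF assms] .

text \<open>Functions in \<open>L\<^sup>2((0,T) \<times> D)\<close> are approximated by clamping their values and then
  replacing the clamped function by one of the continuous functions converging to it.\<close>

lemma space_time_L2_approximation:
  fixes G :: "real \<Rightarrow> real^2 \<Rightarrow> 'b::euclidean_space"
  assumes meas: "(\<lambda>(t, x). G t x) \<in> borel_measurable (lebesgue_on ({0..} \<times> ball 0 R))"
    and L2: "AE t in lebesgue_on {0..}. in_L2 (ball 0 R) (G t)"
    and int: "integrable (lebesgue_on {0..T}) (\<lambda>t. (L2_norm_on (ball 0 R) (G t))\<^sup>2)"
    and eps: "\<epsilon> > 0"
  obtains \<Gamma> where "continuous_on UNIV \<Gamma>"
    "integrable (lebesgue_on {0..T}) (\<lambda>t. (L2_norm_on (ball 0 R) (\<lambda>x. G t x - \<Gamma> (t, x)))\<^sup>2)"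
    "(\<integral>t. (L2_norm_on (ball 0 R) (\<lambda>x. G t x - \<Gamma> (t, x)))\<^sup>2 \<partial>lebesgue_on {0..T}) \<le> \<epsilon>"
proof -
  let ?M = "lebesgue_on (ball (0::real^2) R)" and ?I = "lebesgue_on {0..T}" and ?N = "L2_norm_on (ball (0::real^2) R)"
  let ?S = "{0..} \<times> ball (0::real^2) R"
  interpret M: finite_measure ?M by (rule finite_measure_ball)
  interpret I: finite_measure ?I by (rule finite_measure_lebesgue_on) simp
  have sub: "AE t in ?I. P t" if "AE t in lebesgue_on {0..}. P t" for P
    using that by (rule AE_lebesgue_on_mono) auto
  have L2T: "AE t in ?I. in_L2 (ball 0 R) (G t)" by (rule sub[OF L2])
  \<comment> \<open>One measurability statement for all integrands below: \<open>f\<close> combines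
    the values of \<open>G\<close> with those of a continuous \<open>h\<close>.\<close>
  have secm: "(\<lambda>t. (?N (\<lambda>x. f (G t x) (h (t, x))))\<^sup>2) \<in> borel_measurable ?I"
    if f: "continuous_on UNIV (\<lambda>p. f (fst p) (snd p))" and h: "continuous_on UNIV h"
    for f :: "'b \<Rightarrow> 'b \<Rightarrow> 'b" and h
  proof -
    have fm: "(\<lambda>p. f (fst p) (snd p)) \<in> borel_measurable borel" by (rule borel_measurable_continuous_onI[OF f])
    have "(\<lambda>z. (case z of (t, x) \<Rightarrow> G t x, h z)) \<in> borel_measurable (lebesgue_on ?S)"
      by (rule borel_measurable_Pair[OF meas borel_measurable_lebesgue_on_continuous[OF h]])
    from measurable_compose[OF this fm]
    have "(\<lambda>z. f (case z of (t, x) \<Rightarrow> G t x) (h z)) \<in> borel_measurable (lebesgue_on ?S)" by simp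
    then have "(\<lambda>z. (norm (f (case z of (t, x) \<Rightarrow> G t x) (h z)))\<^sup>2) \<in> borel_measurable (lebesgue_on ?S)" by measurable
    also have "(\<lambda>z. (norm (f (case z of (t, x) \<Rightarrow> G t x) (h z)))\<^sup>2) = (\<lambda>(t, x). (norm (f (G t x) (h (t, x))))\<^sup>2)" by auto
    finally have m: "(\<lambda>(t, x). (norm (f (G t x) (h (t, x))))\<^sup>2) \<in> borel_measurable (lebesgue_on ?S)" .
    have "(\<lambda>t. \<integral>x. (norm (f (G t x) (h (t, x))))\<^sup>2 \<partial>?M) \<in> borel_measurable (lebesgue_on {0..})"
    proof (rule measurable_section_integral[OF m], rule eventually_mono[OF L2])
      fix t assume "in_L2 (ball 0 R) (G t)"
      then have "G t \<in> borel_measurable ?M" by (simp add: in_L2_def)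
      moreover have "continuous_on UNIV (\<lambda>x. h (t, x))"
        by (rule continuous_on_compose2[OF h]) (auto intro!: continuous_intros)
      ultimately have "(\<lambda>x. (G t x, h (t, x))) \<in> borel_measurable ?M"
        by (rule borel_measurable_Pair[OF _ borel_measurable_lebesgue_on_continuous])
      from measurable_compose[OF this fm] have "(\<lambda>x. f (G t x) (h (t, x))) \<in> borel_measurable ?M" by simp
      then show "(\<lambda>x. (norm (f (G t x) (h (t, x))))\<^sup>2) \<in> borel_measurable ?M" by measurable
    qed
    then show ?thesis unfolding L2_norm_on_power2 by (rule measurable_lebesgue_on_mono) auto
  qed
  have clampc: "continuous_on UNIV (clamp_norm k :: 'b \<Rightarrow> 'b)" if "k > 0" for k using clamp_norm_continuous[OF that] .
  have clampm: "(\<lambda>x. clamp_norm k (F x) :: 'b) \<in> borel_measurable ?M" if "F \<in> borel_measurable ?M" "k > 0" for F k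
    using measurable_compose[OF that(1) borel_measurable_continuous_onI[OF clampc[OF that(2)]]] .
  have s1: "(\<lambda>k. \<integral>t. (?N (\<lambda>x. clamp_norm (real (Suc k)) (G t x) - G t x))\<^sup>2 \<partial>?I) \<longlonglongrightarrow> (\<integral>t. 0 \<partial>?I)"
  proof (rule integral_dominated_convergence[OF _ _ int])
    have cc: "continuous_on UNIV (\<lambda>p::'b\<times>'b. clamp_norm (real (Suc k)) (fst p) - fst p)" for k
      by (intro continuous_intros continuous_on_compose2[OF clampc]) auto
    show "(\<lambda>t. (?N (\<lambda>x. clamp_norm (real (Suc k)) (G t x) - G t x))\<^sup>2) \<in> borel_measurable ?I" for k
      using secm[of "\<lambda>a b. clamp_norm (real (Suc k)) a - a" "\<lambda>z. 0"] cc by simp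
    have dom: "(norm (clamp_norm (real (Suc k)) y - y))\<^sup>2 \<le> (norm y)\<^sup>2" for k and y :: 'b
      by (intro power_mono clamp_norm_diff_le) auto
    have intk: "integrable ?M (\<lambda>x. (norm (clamp_norm (real (Suc k)) (G t x) - G t x))\<^sup>2)" if g: "in_L2 (ball 0 R) (G t)" for k t
    proof (rule Bochner_Integration.integrable_bound[where f="\<lambda>x. (norm (G t x))\<^sup>2"])
      have "G t \<in> borel_measurable ?M" using g by (simp add: in_L2_def)
      then have "(\<lambda>x. clamp_norm (real (Suc k)) (G t x) - G t x) \<in> borel_measurable ?M" using clampm by simp
      then show "(\<lambda>x. (norm (clamp_norm (real (Suc k)) (G t x) - G t x))\<^sup>2) \<in> borel_measurable ?M" by measurable
    qed (use g dom in \<open>auto simp: in_L2_def\<close>)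
    show "AE t in ?I. norm ((?N (\<lambda>x. clamp_norm (real (Suc k)) (G t x) - G t x))\<^sup>2) \<le> (?N (G t))\<^sup>2" for k
      using L2T
    proof eventually_elim
      case (elim t)
      then have "(?N (\<lambda>x. clamp_norm (real (Suc k)) (G t x) - G t x))\<^sup>2 \<le> (?N (G t))\<^sup>2"
        unfolding L2_norm_on_power2 using intk[OF elim, of k] dom by (intro integral_mono) (auto simp: in_L2_def)
      then show ?case by simp
    qed
    show "AE t in ?I. (\<lambda>k. (?N (\<lambda>x. clamp_norm (real (Suc k)) (G t x) - G t x))\<^sup>2) \<longlonglongrightarrow> 0"
      using L2T
    proof eventually_elim
      case (elim t)
      have "(\<lambda>k. \<integral>x. (norm (clamp_norm (real (Suc k)) (G t x) - G t x))\<^sup>2 \<partial>?M) \<longlonglongrightarrow> (\<integral>x. 0 \<partial>?M)"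
      proof (rule integral_dominated_convergence[where w="\<lambda>x. (norm (G t x))\<^sup>2"])
        show "integrable ?M (\<lambda>x. (norm (G t x))\<^sup>2)" using elim by (simp add: in_L2_def)
        show "(\<lambda>x. (norm (clamp_norm (real (Suc k)) (G t x) - G t x))\<^sup>2) \<in> borel_measurable ?M" for k
          using intk[OF elim] by (rule borel_measurable_integrable)
        show "AE x in ?M. norm ((norm (clamp_norm (real (Suc k)) (G t x) - G t x))\<^sup>2) \<le> (norm (G t x))\<^sup>2" for k
          using dom by simp
        show "AE x in ?M. (\<lambda>k. (norm (clamp_norm (real (Suc k)) (G t x) - G t x))\<^sup>2) \<longlonglongrightarrow> 0"
        proof (rule AE_I2, rule tendsto_eventually)
          fix x
          obtain k0 :: nat where k0: "norm (G t x) \<le> real k0" using real_arch_simple by blast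
          show "\<forall>\<^sub>F k in sequentially. (norm (clamp_norm (real (Suc k)) (G t x) - G t x))\<^sup>2 = 0"
            using eventually_ge_at_top[of k0]
          proof eventually_elim
            case (elim k)
            then have "norm (G t x) \<le> real (Suc k)" using k0 by simp
            then show ?case by (simp add: clamp_norm_id del: of_nat_Suc)
          qed
        qed
      qed simp
      then show ?case unfolding L2_norm_on_power2 by simp
    qed
  qed simp
  \<comment> \<open>Both the clamping and the approximation error are made smaller than
    \<open>\<epsilon> / 4\<close>, because the square of a sum costs a factor 2 in front of each of
    the two.\<close>
  then obtain k0 where k0: "norm ((\<integral>t. (?N (\<lambda>x. clamp_norm (real (Suc k0)) (G t x) - G t x))\<^sup>2 \<partial>?I) - 0) < \<epsilon> / 4"
    using LIMSEQ_D[of _ "\<integral>t. 0 \<partial>?I" "\<epsilon> / 4"] eps by fastforce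
  define k where "k = real (Suc k0)"
  have kp: "k > 0" by (simp add: k_def)
  have k: "(\<integral>t. (?N (\<lambda>x. clamp_norm k (G t x) - G t x))\<^sup>2 \<partial>?I) < \<epsilon> / 4"
    using k0 unfolding k_def by simp
  obtain g where g: "\<And>n::nat. continuous_on UNIV (g n)"
    "AE t in lebesgue_on {0..}. AE x in ?M. (\<lambda>n. g n (t, x)) \<longlonglongrightarrow> (case (t, x) of (t, x) \<Rightarrow> G t x)"
    by (rule continuous_approximation[OF meas]) blast
  have gc: "continuous_on UNIV (\<lambda>x. g n (t, x))" for n t
    by (rule continuous_on_compose2[OF g(1)]) (auto intro!: continuous_intros)
  let ?m = "measure ?M (space ?M)"
  have b4: "(norm (clamp_norm k a - clamp_norm k b))\<^sup>2 \<le> (2 * k)\<^sup>2" for a b :: 'b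
  proof (intro power_mono)
    show "norm (clamp_norm k a - clamp_norm k b) \<le> 2 * k"
      using norm_triangle_ineq4[of "clamp_norm k a" "clamp_norm k b"] clamp_norm_le[OF kp, of a] clamp_norm_le[OF kp, of b] by linarith
  qed simp
  have m2: "(\<lambda>x. (norm (clamp_norm k (G t x) - clamp_norm k (g n (t, x))))\<^sup>2) \<in> borel_measurable ?M"
    if "in_L2 (ball 0 R) (G t)" for t n
  proof -
    have "G t \<in> borel_measurable ?M" using that by (simp add: in_L2_def)
    then have "(\<lambda>x. clamp_norm k (G t x) - clamp_norm k (g n (t, x))) \<in> borel_measurable ?M"
      by (intro borel_measurable_diff clampm[OF _ kp]) (auto intro: borel_measurable_lebesgue_on_continuous gc)
    then show ?thesis by measurable
  qed
  have i2: "integrable ?M (\<lambda>x. (norm (clamp_norm k (G t x) - clamp_norm k (g n (t, x))))\<^sup>2)"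
    if "in_L2 (ball 0 R) (G t)" for t n
    by (rule M.integrable_const_bound[of _ "(2 * k)\<^sup>2"]) (use m2[OF that] b4 in auto)
  have mt2: "(\<lambda>t. (?N (\<lambda>x. clamp_norm k (G t x) - clamp_norm k (g n (t, x))))\<^sup>2) \<in> borel_measurable ?I" for n
  proof -
    have "continuous_on UNIV (\<lambda>p::'b\<times>'b. clamp_norm k (fst p) - clamp_norm k (snd p))"
      by (intro continuous_intros continuous_on_compose2[OF clampc[OF kp]]) auto
    then show ?thesis using secm[of "\<lambda>a b. clamp_norm k a - clamp_norm k b" "g n"] g(1) by simp
  qed
  have bd2: "AE t in ?I. norm ((?N (\<lambda>x. clamp_norm k (G t x) - clamp_norm k (g n (t, x))))\<^sup>2) \<le> (2 * k)\<^sup>2 * ?m" for n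
    using L2T
  proof eventually_elim
    case (elim t)
    have "(\<integral>x. (norm (clamp_norm k (G t x) - clamp_norm k (g n (t, x))))\<^sup>2 \<partial>?M) \<le> (\<integral>x. (2 * k)\<^sup>2 \<partial>?M)"
      using i2[OF elim] b4 by (intro integral_mono) auto
    then show ?case unfolding L2_norm_on_power2 by (simp add: mult.commute)
  qed
  have "(\<lambda>n. \<integral>t. (?N (\<lambda>x. clamp_norm k (G t x) - clamp_norm k (g n (t, x))))\<^sup>2 \<partial>?I) \<longlonglongrightarrow> (\<integral>t. 0 \<partial>?I)"
  proof (rule integral_dominated_convergence[OF _ mt2 _ _ bd2])
    show "AE t in ?I. (\<lambda>n. (?N (\<lambda>x. clamp_norm k (G t x) - clamp_norm k (g n (t, x))))\<^sup>2) \<longlonglongrightarrow> 0"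
      using L2T sub[OF g(2)]
    proof eventually_elim
      case (elim t)
      have "(\<lambda>n. \<integral>x. (norm (clamp_norm k (G t x) - clamp_norm k (g n (t, x))))\<^sup>2 \<partial>?M) \<longlonglongrightarrow> (\<integral>x. 0 \<partial>?M)"
      proof (rule integral_dominated_convergence[where w="\<lambda>x. (2 * k)\<^sup>2"])
        show "AE x in ?M. (\<lambda>n. (norm (clamp_norm k (G t x) - clamp_norm k (g n (t, x))))\<^sup>2) \<longlonglongrightarrow> 0"
          using elim(2)
        proof eventually_elim
          case (elim x)
          then have gx: "(\<lambda>n. g n (t, x)) \<longlonglongrightarrow> G t x" by simp
          have "isCont (clamp_norm k) (G t x)"
            using clampc[OF kp] by (simp add: continuous_on_eq_continuous_at)
          from isCont_tendsto_compose[OF this gx]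
          have "(\<lambda>n. clamp_norm k (g n (t, x))) \<longlonglongrightarrow> clamp_norm k (G t x)" .
          then have "(\<lambda>n. (norm (clamp_norm k (G t x) - clamp_norm k (g n (t, x))))\<^sup>2) \<longlonglongrightarrow> (norm (clamp_norm k (G t x) - clamp_norm k (G t x)))\<^sup>2"
            by (intro tendsto_intros)
          then show ?case by simp
        qed
      qed (use m2[OF elim(1)] b4 in auto)
      then show ?case unfolding L2_norm_on_power2 by simp
    qed
  qed auto
  then have lim2: "(\<lambda>n. \<integral>t. (?N (\<lambda>x. clamp_norm k (G t x) - clamp_norm k (g n (t, x))))\<^sup>2 \<partial>?I) \<longlonglongrightarrow> 0" by simp
  obtain n where "norm ((\<integral>t. (?N (\<lambda>x. clamp_norm k (G t x) - clamp_norm k (g n (t, x))))\<^sup>2 \<partial>?I) - 0) < \<epsilon> / 4"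
    using LIMSEQ_D[OF lim2, of "\<epsilon> / 4"] eps by (metis order_refl zero_less_divide_iff zero_less_numeral)
  then have n: "(\<integral>t. (?N (\<lambda>x. clamp_norm k (G t x) - clamp_norm k (g n (t, x))))\<^sup>2 \<partial>?I) < \<epsilon> / 4"
    by (simp only: real_norm_def diff_zero abs_less_iff)
  \<comment> \<open>The approximation is clamped as well: being bounded by \<open>k\<close>, it
    admits dominated convergence on a finite measure space, whereas \<open>g n\<close> itself need
    not be close to \<open>G\<close> in L2.\<close>
  define \<Gamma> where "\<Gamma> z = clamp_norm k (g n z)" for z
  have Gc: "continuous_on UNIV \<Gamma>"
    unfolding \<Gamma>_def[abs_def] by (rule continuous_on_compose2[OF clampc[OF kp] g(1)]) auto
  let ?A = "\<lambda>t. (?N (\<lambda>x. clamp_norm k (G t x) - G t x))\<^sup>2" and ?B = "\<lambda>t. (?N (\<lambda>x. clamp_norm k (G t x) - clamp_norm k (g n (t, x))))\<^sup>2"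
  let ?C = "\<lambda>t. (?N (\<lambda>x. G t x - \<Gamma> (t, x)))\<^sup>2"
  have Bi: "integrable ?I ?B" by (rule I.integrable_const_bound[OF bd2 mt2])
  have cL2: "in_L2 (ball 0 R) (\<lambda>x. clamp_norm k (G t x))" if "in_L2 (ball 0 R) (G t)" for t
    using that by (intro in_L2_bounded[of _ _ k] clampm kp clamp_norm_le) (simp add: in_L2_def)
  have hL2: "in_L2 (ball 0 R) (\<lambda>x. \<Gamma> (t, x))" for t
    by (rule in_L2_continuous, rule continuous_on_compose2[OF Gc]) (auto intro!: continuous_intros)
  have Ab: "AE t in ?I. norm (?A t) \<le> norm ((?N (G t))\<^sup>2)"
    using L2T
  proof eventually_elim
    case (elim t)
    have "(norm (clamp_norm k y - y))\<^sup>2 \<le> (norm y)\<^sup>2" for y :: 'b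
      by (intro power_mono clamp_norm_diff_le kp) auto
    then have "(?N (\<lambda>x. clamp_norm k (G t x) - G t x))\<^sup>2 \<le> (?N (G t))\<^sup>2"
      unfolding L2_norm_on_power2 using in_L2_diff[OF cL2[OF elim] elim] elim
      by (intro integral_mono) (auto simp: in_L2_def)
    then show ?case by simp
  qed
  have Am: "?A \<in> borel_measurable ?I"
  proof -
    have "continuous_on UNIV (\<lambda>p::'b\<times>'b. clamp_norm k (fst p) - fst p)"
      by (intro continuous_intros continuous_on_compose2[OF clampc[OF kp]]) auto
    then show ?thesis using secm[of "\<lambda>a b. clamp_norm k a - a" "\<lambda>z. 0"] by simp
  qed
  have Ai: "integrable ?I ?A" by (rule Bochner_Integration.integrable_bound[OF int Am Ab])
  have le: "AE t in ?I. ?C t \<le> 2 * ?A t + 2 * ?B t"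
    using L2T
  proof eventually_elim
    case (elim t)
    have n1: "(norm (G t x - \<Gamma> (t, x)))\<^sup>2 \<le> 2 * (norm (clamp_norm k (G t x) - G t x))\<^sup>2 + 2 * (norm (clamp_norm k (G t x) - clamp_norm k (g n (t, x))))\<^sup>2" for x
      using norm_add_square_le[of "G t x - clamp_norm k (G t x)" "clamp_norm k (G t x) - clamp_norm k (g n (t, x))"]
      by (simp add: \<Gamma>_def norm_minus_commute)
    have "integrable ?M (\<lambda>x. (norm (G t x - \<Gamma> (t, x)))\<^sup>2)"
      using in_L2_diff[OF elim hL2] unfolding in_L2_def by blast
    moreover have "integrable ?M (\<lambda>x. (norm (clamp_norm k (G t x) - G t x))\<^sup>2)"
      using in_L2_diff[OF cL2[OF elim] elim] unfolding in_L2_def by blast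
    ultimately have "(\<integral>x. (norm (G t x - \<Gamma> (t, x)))\<^sup>2 \<partial>?M)
      \<le> (\<integral>x. 2 * (norm (clamp_norm k (G t x) - G t x))\<^sup>2 + 2 * (norm (clamp_norm k (G t x) - clamp_norm k (g n (t, x))))\<^sup>2 \<partial>?M)"
      using n1 i2[OF elim] by (intro integral_mono) auto
    also have "\<dots> = 2 * ?A t + 2 * ?B t"
      unfolding L2_norm_on_power2 using i2[OF elim] in_L2_diff[OF cL2[OF elim] elim] by (simp add: in_L2_def)
    finally show ?case unfolding L2_norm_on_power2 .
  qed
  have Cm: "?C \<in> borel_measurable ?I"
  proof -
    have "continuous_on UNIV (\<lambda>p::'b\<times>'b. fst p - snd p)" by (intro continuous_intros)
    then show ?thesis using secm[of "\<lambda>a b. a - b" \<Gamma>] Gc by simp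
  qed
  have Ci: "integrable ?I ?C"
  proof (rule Bochner_Integration.integrable_bound[where f="\<lambda>t. 2 * ?A t + 2 * ?B t"])
    show "AE t in ?I. norm (?C t) \<le> norm (2 * ?A t + 2 * ?B t)" using le by eventually_elim simp
  qed (use Ai Bi Cm in auto)
  have "(\<integral>t. ?C t \<partial>?I) \<le> (\<integral>t. 2 * ?A t + 2 * ?B t \<partial>?I)"
    using Ai Bi Ci le by (intro integral_mono_AE) auto
  also have "\<dots> = 2 * (\<integral>t. ?A t \<partial>?I) + 2 * (\<integral>t. ?B t \<partial>?I)" using Ai Bi by simp
  also have "\<dots> \<le> \<epsilon>" using k n by linarith
  finally show thesis using that[OF Gc Ci] by blast
qed

section \<open>The energy inequality between arbitrary times\<close>

lemma integral_le_negligible: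
  fixes f g :: "real \<Rightarrow> real"
  assumes "f integrable_on S" "g integrable_on S" "negligible N" "\<And>x. x \<in> S - N \<Longrightarrow> f x \<le> g x"
  shows "integral S f \<le> integral S g"
proof -
  define f' where "f' x = (if x \<in> N then g x else f x)" for x
  have "f' integrable_on S"
    by (rule integrable_spike[OF assms(1,3)]) (simp add: f'_def)
  then have "integral S f' \<le> integral S g"
    using assms by (intro integral_le) (auto simp: f'_def)
  moreover have "integral S f' = integral S f"
    by (rule integral_spike[OF assms(3)]) (simp add: f'_def)
  ultimately show ?thesis by simp
qed

lemma filterlim_add_at_within_Icc:
  assumes "a < (b::real)"
  shows "filterlim (\<lambda>h. a + h) (at a within {a..b}) (at_right 0)"
  unfolding filterlim_at
proof
  show "((\<lambda>h. a + h) \<longlongrightarrow> a) (at_right 0)" by (auto intro!: tendsto_eq_intros)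
  have "\<forall>\<^sub>F h in at_right 0. h \<in> {0<..<b - a}"
    using eventually_at_right_real[of 0 "b - a"] assms by simp
  then show "\<forall>\<^sub>F h in at_right 0. a + h \<in> {a..b} \<and> a + h \<noteq> a" by eventually_elim auto
qed

lemma average_tendsto:
  fixes g :: "real \<Rightarrow> real"
  assumes "a < b" "continuous_on {a..b} g"
  shows "((\<lambda>h. integral {a..a + h} g / h) \<longlongrightarrow> g a) (at_right 0)"
proof -
  have "((\<lambda>x. integral {a..x} g) has_real_derivative g a) (at a within {a..b})"
    by (rule integral_has_real_derivative) (use assms in auto)
  then have "((\<lambda>x. (integral {a..x} g - integral {a..a} g) / (x - a)) \<longlongrightarrow> g a) (at a within {a..b})"
    by (simp add: has_field_derivative_iff)
  from filterlim_compose[OF this filterlim_add_at_within_Icc[OF assms(1)]]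
  show ?thesis by simp
qed

lemma short_integral_tendsto_0:
  fixes g :: "real \<Rightarrow> real"
  assumes "a < b" "g integrable_on {a..b}"
  shows "((\<lambda>h. integral {a..a + h} g) \<longlongrightarrow> 0) (at_right 0)"
proof -
  have "continuous_on {a..b} (\<lambda>x. integral {a..x} g)"
    by (rule indefinite_integral_continuous_1[OF assms(2)])
  then have "((\<lambda>x. integral {a..x} g) \<longlongrightarrow> integral {a..a} g) (at a within {a..b})"
    using assms(1) unfolding continuous_on_def by (meson atLeastAtMost_iff less_imp_le order_refl)
  from filterlim_compose[OF this filterlim_add_at_within_Icc[OF assms(1)]]
  show ?thesis by simp
qed

text \<open>The bound on the increments of \<open>y\<close> holds for almost every right end point and
  every left end point; averaging it over time intervals of length \<open>h\<close> and letting \<open>h\<close>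
  tend to \<open>0\<close> gives a bound between any two times, provided that \<open>y\<close> is controlled from above at
  the left and from below at the right end.\<close>

lemma energy_from_increments:
  fixes y D \<alpha> c :: "real \<Rightarrow> real"
  assumes st: "0 \<le> s" "s < t" "t < T"
    and int: "y integrable_on {0..T}" "D integrable_on {0..T}" "\<alpha> integrable_on {0..T}"
    and nn: "\<And>r. 0 \<le> \<alpha> r" "\<And>r. 0 \<le> D r"
    and N: "negligible N"
    and inc: "\<And>\<epsilon>. \<epsilon> > 0 \<Longrightarrow> \<exists>e \<delta>. e integrable_on {0..T} \<and> (\<forall>r. 0 \<le> e r) \<and> integral {0..T} e \<le> \<epsilon>\<^sup>2 \<and> \<delta> > 0 \<and>
      (\<forall>\<tau>\<in>{0..T} - N. \<forall>h. 0 < h \<longrightarrow> h < \<delta> \<longrightarrow> h \<le> \<tau> \<longrightarrow>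
        y \<tau> - y (\<tau> - h) \<le> integral {\<tau> - h..\<tau>} (\<lambda>r. - 2 * \<nu> * D r + \<epsilon> * \<alpha> r + 4 / \<epsilon> * e r) + 4 / \<epsilon> * h * (e \<tau> + \<epsilon>\<^sup>2))"
    and left: "\<And>\<tau>. \<tau> \<in> {s..T} - N \<Longrightarrow> y \<tau> - y s \<le> integral {s..\<tau>} \<alpha> + (\<tau> - s) * D \<tau>"
    and right: "continuous_on {t..T} c" "c t = y t" "\<And>\<tau>. \<tau> \<in> {t..T} \<Longrightarrow> c \<tau> \<le> y \<tau>"
  shows "y t + 2 * \<nu> * integral {s..t} D \<le> y s"
proof -
  have sub: "f integrable_on {a..b}" if "f integrable_on {0..T}" "0 \<le> a" "b \<le> T" for f :: "real \<Rightarrow> real" and a b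
    using that by (rule_tac integrable_subinterval_real[OF that(1)]) auto
  \<comment> \<open>For fixed \<open>\<epsilon>\<close> the errors add up to
    \<open>\<epsilon>\<close> times a constant: the integral of \<open>\<alpha>\<close> from the
    Young term, 4 from \<open>4 / \<epsilon>\<close> times the integral of \<open>e\<close>, and
    \<open>4 * (1 + T)\<close> from the terms \<open>e \<tau> + \<epsilon>\<^sup>2\<close>. At the
    end \<open>\<epsilon>\<close> tends to 0.\<close>
  have step: "y t - y s \<le> - 2 * \<nu> * integral {s..t} D + \<epsilon> * (integral {0..T} \<alpha> + 4 + 4 * (1 + T))" if eps: "\<epsilon> > 0" for \<epsilon>
  proof -
    obtain e \<delta> where e: "e integrable_on {0..T}" "\<And>r. 0 \<le> e r" "integral {0..T} e \<le> \<epsilon>\<^sup>2" "\<delta> > 0"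
      "\<And>\<tau> h. \<tau> \<in> {0..T} - N \<Longrightarrow> 0 < h \<Longrightarrow> h < \<delta> \<Longrightarrow> h \<le> \<tau> \<Longrightarrow>
        y \<tau> - y (\<tau> - h) \<le> integral {\<tau> - h..\<tau>} (\<lambda>r. - 2 * \<nu> * D r + \<epsilon> * \<alpha> r + 4 / \<epsilon> * e r) + 4 / \<epsilon> * h * (e \<tau> + \<epsilon>\<^sup>2)"
      using inc[OF eps] by blast
    define p where "p r = - 2 * \<nu> * D r + \<epsilon> * \<alpha> r + 4 / \<epsilon> * e r" for r
    have pi: "p integrable_on {0..T}"
      unfolding p_def[abs_def] by (intro integrable_add integrable_on_mult_right int e)
    define P where "P \<tau> = integral {0..\<tau>} p" for \<tau>
    have Pc: "continuous_on {0..T} P" unfolding P_def[abs_def] by (rule indefinite_integral_continuous_1[OF pi])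
    have Pd: "integral {a..b} p = P b - P a" if "0 \<le> a" "a \<le> b" "b \<le> T" for a b
      using Henstock_Kurzweil_Integration.integral_combine[of 0 a b p] sub[OF pi, of 0 b] that by (simp add: P_def)
    have Pi: "P integrable_on {0..T}" by (rule integrable_continuous_real[OF Pc])
    \<comment> \<open>Subtracting the primitive \<open>P\<close> leaves a function whose increments
      over a step \<open>h\<close> are, outside \<open>N\<close>, at most
      \<open>4 / \<epsilon> * h * (e \<tau> + \<epsilon>\<^sup>2)\<close>.\<close>
    define z where "z \<tau> = y \<tau> - P \<tau>" for \<tau>
    have zi: "z integrable_on {0..T}" unfolding z_def[abs_def] by (intro integrable_diff int Pi)
    have main: "integral {t..t + h} (\<lambda>\<tau>. c \<tau> - P \<tau>) / h - y s - integral {s..s + h} \<alpha> - integral {s..s + h} D + integral {s..s + h} P / h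
        \<le> 4 * \<epsilon> * (1 + T)" if h: "0 < h" "h < \<delta>" "h < T - t" "h < t - s" for h
    proof -
      have zsh: "integral {s + h..t + h} (\<lambda>\<tau>. z (\<tau> - h)) = integral {s..t} z"
        using integral_shift_Icc_real[of s t "\<lambda>\<tau>. z (\<tau> - h)" h] by (simp add: o_def)
      have zshi: "(\<lambda>\<tau>. z (\<tau> - h)) integrable_on {s + h..t + h}"
        using integrable_on_shift_Icc_real[of "\<lambda>\<tau>. z (\<tau> - h)" h s t] sub[OF zi, of s t] st by (simp add: o_def)
      have ei: "e integrable_on {s + h..t + h}" using sub[OF e(1)] st h by simp
      \<comment> \<open>Integrating the increments over \<open>{s + h..t + h}\<close> cancels the
        common part \<open>{s + h..t}\<close> and leaves the integrals over the intervals of length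
        \<open>h\<close> to the right of \<open>t\<close> and of \<open>s\<close>.\<close>
      have "integral {s + h..t + h} z - integral {s..t} z = integral {s + h..t + h} (\<lambda>\<tau>. z \<tau> - z (\<tau> - h))"
        using sub[OF zi, of "s + h" "t + h"] zshi st h by (simp add: Henstock_Kurzweil_Integration.integral_diff zsh)
      also have "\<dots> \<le> integral {s + h..t + h} (\<lambda>\<tau>. 4 / \<epsilon> * h * (e \<tau> + \<epsilon>\<^sup>2))"
      proof (rule integral_le_negligible[OF _ _ N])
        show "(\<lambda>\<tau>. z \<tau> - z (\<tau> - h)) integrable_on {s + h..t + h}"
          using sub[OF zi, of "s + h" "t + h"] zshi st h by (intro integrable_diff) auto
        show "(\<lambda>\<tau>. 4 / \<epsilon> * h * (e \<tau> + \<epsilon>\<^sup>2)) integrable_on {s + h..t + h}"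
          by (intro integrable_on_mult_right integrable_add ei) auto
        show "z \<tau> - z (\<tau> - h) \<le> 4 / \<epsilon> * h * (e \<tau> + \<epsilon>\<^sup>2)" if "\<tau> \<in> {s + h..t + h} - N" for \<tau>
          using e(5)[of \<tau> h] Pd[of "\<tau> - h" \<tau>] that h st unfolding p_def[symmetric] by (simp add: z_def)
      qed
      also have "\<dots> = 4 / \<epsilon> * h * (integral {s + h..t + h} e + \<epsilon>\<^sup>2 * (t - s))"
        using ei st by (simp add: Henstock_Kurzweil_Integration.integral_add integrable_const_ivl mult.commute)
      also have "\<dots> \<le> 4 / \<epsilon> * h * (\<epsilon>\<^sup>2 + \<epsilon>\<^sup>2 * T)"
      proof (intro mult_left_mono add_mono)
        have "integral {s + h..t + h} e \<le> integral {0..T} e"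
          by (rule integral_subset_le) (use ei e st h in auto)
        then show "integral {s + h..t + h} e \<le> \<epsilon>\<^sup>2" using e(3) by linarith
      qed (use eps h st in auto)
      also have "\<dots> = h * (4 * \<epsilon> * (1 + T))" using eps by (simp add: field_simps power2_eq_square)
      finally have z1: "integral {s + h..t + h} z - integral {s..t} z \<le> h * (4 * \<epsilon> * (1 + T))" .
      have z2: "integral {s + h..t + h} z = integral {s + h..t} z + integral {t..t + h} z"
        using Henstock_Kurzweil_Integration.integral_combine[of "s + h" t "t + h" z] sub[OF zi, of "s + h" "t + h"] st h by simp
      have z3: "integral {s..t} z = integral {s..s + h} z + integral {s + h..t} z"
        using Henstock_Kurzweil_Integration.integral_combine[of s "s + h" t z] sub[OF zi, of s t] st h by simp
      have ci: "c integrable_on {t..t + h}"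
        by (rule integrable_continuous_real, rule continuous_on_subset[OF right(1)]) (use h in auto)
      have Pit: "P integrable_on {t..t + h}" "P integrable_on {s..s + h}" using sub[OF Pi] st h by auto
      have z4: "integral {t..t + h} (\<lambda>\<tau>. c \<tau> - P \<tau>) \<le> integral {t..t + h} z"
      proof (rule integral_le)
        show "z integrable_on {t..t + h}" using sub[OF zi] st h by simp
        show "(\<lambda>\<tau>. c \<tau> - P \<tau>) integrable_on {t..t + h}" by (intro integrable_diff ci Pit)
        show "c \<tau> - P \<tau> \<le> z \<tau>" if "\<tau> \<in> {t..t + h}" for \<tau> using right(3)[of \<tau>] that h by (simp add: z_def)
      qed
      have \<alpha>i: "\<alpha> integrable_on {s..s + h}" and Di: "D integrable_on {s..s + h}"
        using sub[OF int(3), of s "s + h"] sub[OF int(2), of s "s + h"] st h by simp_all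
      \<comment> \<open>The term \<open>(\<tau> - s) * D \<tau>\<close> is at most
        \<open>h * D \<tau>\<close>; after integration and division by \<open>h\<close> it
        contributes the integral of \<open>D\<close> over an interval of length \<open>h\<close>,
        which tends to 0 even if \<open>D\<close> is unbounded.\<close>
      have "integral {s..s + h} z \<le> integral {s..s + h} (\<lambda>\<tau>. (y s + integral {s..s + h} \<alpha>) + h * D \<tau> - P \<tau>)"
      proof (rule integral_le_negligible[OF _ _ N])
        show "z integrable_on {s..s + h}" using sub[OF zi] st h by simp
        show "(\<lambda>\<tau>. (y s + integral {s..s + h} \<alpha>) + h * D \<tau> - P \<tau>) integrable_on {s..s + h}"
          by (intro integrable_diff integrable_add integrable_on_mult_right Di Pit) auto
        fix \<tau> assume tau: "\<tau> \<in> {s..s + h} - N"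
        have "integral {s..\<tau>} \<alpha> \<le> integral {s..s + h} \<alpha>"
          by (rule integral_subset_le) (use tau nn sub[OF int(3), of s \<tau>] \<alpha>i st h in auto)
        moreover have "(\<tau> - s) * D \<tau> \<le> h * D \<tau>" using tau nn by (intro mult_right_mono) auto
        ultimately show "z \<tau> \<le> (y s + integral {s..s + h} \<alpha>) + h * D \<tau> - P \<tau>"
          using left[of \<tau>] tau st h by (simp add: z_def)
      qed
      also have "\<dots> = h * (y s + integral {s..s + h} \<alpha>) + h * integral {s..s + h} D - integral {s..s + h} P"
      proof (rule integral_unique)
        have k: "((\<lambda>\<tau>. y s + integral {s..s + h} \<alpha>) has_integral h * (y s + integral {s..s + h} \<alpha>)) {s..s + h}"
          using has_integral_const_real[of "y s + integral {s..s + h} \<alpha>" s "s + h"] h by simp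
        show "((\<lambda>\<tau>. (y s + integral {s..s + h} \<alpha>) + h * D \<tau> - P \<tau>) has_integral
            h * (y s + integral {s..s + h} \<alpha>) + h * integral {s..s + h} D - integral {s..s + h} P) {s..s + h}"
          by (intro has_integral_diff has_integral_add k has_integral_mult_right integrable_integral Di Pit)
      qed
      finally have z5: "integral {s..s + h} z \<le> h * (y s + integral {s..s + h} \<alpha>) + h * integral {s..s + h} D - integral {s..s + h} P" .
      have "integral {t..t + h} (\<lambda>\<tau>. c \<tau> - P \<tau>) - h * (y s + integral {s..s + h} \<alpha>) - h * integral {s..s + h} D + integral {s..s + h} P
          \<le> h * (4 * \<epsilon> * (1 + T))"
        using z1 z2 z3 z4 z5 by linarith
      then have "(integral {t..t + h} (\<lambda>\<tau>. c \<tau> - P \<tau>) - h * (y s + integral {s..s + h} \<alpha>) - h * integral {s..s + h} D + integral {s..s + h} P) / h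
          \<le> 4 * \<epsilon> * (1 + T)"
        using h(1) by (simp add: divide_le_eq mult.commute)
      then show ?thesis using h(1) by (simp add: add_divide_distrib diff_divide_distrib algebra_simps)
    qed
    have "((\<lambda>h. integral {t..t + h} (\<lambda>\<tau>. c \<tau> - P \<tau>) / h - y s - integral {s..s + h} \<alpha> - integral {s..s + h} D + integral {s..s + h} P / h)
        \<longlongrightarrow> (c t - P t) - y s - 0 - 0 + P s) (at_right 0)"
    proof (intro tendsto_intros)
      show "((\<lambda>h. integral {t..t + h} (\<lambda>\<tau>. c \<tau> - P \<tau>) / h) \<longlongrightarrow> c t - P t) (at_right 0)"
        by (rule average_tendsto[OF st(3)]) (use right(1) continuous_on_subset[OF Pc] st in \<open>auto intro!: continuous_intros\<close>)
      show "((\<lambda>h. integral {s..s + h} P / h) \<longlongrightarrow> P s) (at_right 0)"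
        by (rule average_tendsto[of s T]) (use continuous_on_subset[OF Pc] st in auto)
      show "((\<lambda>h. integral {s..s + h} \<alpha>) \<longlongrightarrow> 0) (at_right 0)"
        by (rule short_integral_tendsto_0[of s T]) (use sub int st in auto)
      show "((\<lambda>h. integral {s..s + h} D) \<longlongrightarrow> 0) (at_right 0)"
        by (rule short_integral_tendsto_0[of s T]) (use sub int st in auto)
    qed
    moreover have "\<forall>\<^sub>F h in at_right 0. integral {t..t + h} (\<lambda>\<tau>. c \<tau> - P \<tau>) / h - y s - integral {s..s + h} \<alpha> - integral {s..s + h} D + integral {s..s + h} P / h
        \<le> 4 * \<epsilon> * (1 + T)"
    proof -
      have "\<forall>\<^sub>F h in at_right 0. h \<in> {0<..<min \<delta> (min (T - t) (t - s))}"
        using eventually_at_right_real[of 0 "min \<delta> (min (T - t) (t - s))"] e(4) st by simp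
      then show ?thesis by eventually_elim (use main in auto)
    qed
    ultimately have "(c t - P t) - y s - 0 - 0 + P s \<le> 4 * \<epsilon> * (1 + T)"
      by (intro tendsto_upperbound[where F="at_right (0::real)"]) auto
    then have "y t - y s \<le> integral {s..t} p + 4 * \<epsilon> * (1 + T)"
      using Pd[of s t] st right(2) by simp
    also have "integral {s..t} p = - 2 * \<nu> * integral {s..t} D + \<epsilon> * integral {s..t} \<alpha> + 4 / \<epsilon> * integral {s..t} e"
      unfolding p_def[abs_def] using sub[OF int(2), of s t] sub[OF int(3), of s t] sub[OF e(1), of s t] st
      by (intro integral_unique has_integral_add has_integral_mult_right integrable_integral) auto
    also have "\<dots> \<le> - 2 * \<nu> * integral {s..t} D + \<epsilon> * integral {0..T} \<alpha> + 4 / \<epsilon> * \<epsilon>\<^sup>2"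
    proof -
      have "integral {s..t} \<alpha> \<le> integral {0..T} \<alpha>"
        by (rule integral_subset_le) (use sub[OF int(3), of s t] int nn st in auto)
      moreover have "integral {s..t} e \<le> integral {0..T} e"
        by (rule integral_subset_le) (use sub[OF e(1), of s t] e st in auto)
      ultimately have "\<epsilon> * integral {s..t} \<alpha> \<le> \<epsilon> * integral {0..T} \<alpha>" "4 / \<epsilon> * integral {s..t} e \<le> 4 / \<epsilon> * \<epsilon>\<^sup>2"
        using e(3) eps by (auto intro!: mult_left_mono divide_right_mono)
      then show ?thesis by linarith
    qed
    finally show ?thesis using eps by (simp add: power2_eq_square algebra_simps)
  qed
  have "((\<lambda>\<epsilon>. - 2 * \<nu> * integral {s..t} D + \<epsilon> * (integral {0..T} \<alpha> + 4 + 4 * (1 + T))) \<longlongrightarrow>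
      - 2 * \<nu> * integral {s..t} D + 0 * (integral {0..T} \<alpha> + 4 + 4 * (1 + T))) (at_right 0)"
    by (intro tendsto_intros)
  then have "y t - y s \<le> - 2 * \<nu> * integral {s..t} D + 0 * (integral {0..T} \<alpha> + 4 + 4 * (1 + T))"
    by (rule tendsto_lowerbound) (use step in \<open>auto simp: eventually_at_filter\<close>)
  then show ?thesis by simp
qed

text \<open>As in the implicit Euler scheme, \<open>n\<close> equal steps give
  \<open>y t * (1 + c * t / n) ^ n \<le> y 0\<close>, and the power tends to
  \<open>exp (c * t)\<close>.\<close>

lemma decay_from_steps:
  fixes y :: "real \<Rightarrow> real"
  assumes c: "c \<ge> 0" and nn: "\<And>t. t \<ge> 0 \<Longrightarrow> y t \<ge> 0"
    and step: "\<And>s t. 0 \<le> s \<Longrightarrow> s < t \<Longrightarrow> y t * (1 + c * (t - s)) \<le> y s" and t: "t \<ge> 0"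
  shows "y t \<le> y 0 * exp (- c * t)"
proof (cases "t = 0")
  case False
  then have tp: "t > 0" using t by simp
  have b: "y (real k * (t / real n)) * (1 + c * t / real n) ^ k \<le> y 0" if n: "n > 0" for k n :: nat
  proof (induction k)
    case (Suc k)
    have "y (real (Suc k) * (t / real n)) * (1 + c * (real (Suc k) * (t / real n) - real k * (t / real n))) \<le> y (real k * (t / real n))"
    proof (rule step)
      show "real k * (t / real n) < real (Suc k) * (t / real n)"
        by (rule mult_strict_right_mono) (use tp n in auto)
    qed (use tp in auto)
    also have "real (Suc k) * (t / real n) - real k * (t / real n) = t / real n" by (simp add: distrib_right add_divide_distrib)
    finally have "y (real (Suc k) * (t / real n)) * (1 + c * t / real n) * (1 + c * t / real n) ^ k
        \<le> y (real k * (t / real n)) * (1 + c * t / real n) ^ k"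
      using c tp by (intro mult_right_mono) auto
    then show ?case using Suc by (simp add: mult.assoc)
  qed simp
  have "(\<lambda>n. y t * (1 + c * t / real n) ^ n) \<longlonglongrightarrow> y t * exp (c * t)"
    by (intro tendsto_intros tendsto_exp_limit_sequentially)
  then have "y t * exp (c * t) \<le> y 0"
  proof (rule tendsto_upperbound)
    show "\<forall>\<^sub>F n in sequentially. y t * (1 + c * t / real n) ^ n \<le> y 0"
      using eventually_gt_at_top[of 0]
    proof eventually_elim
      case (elim n)
      then show ?case using b[OF elim, of n] by simp
    qed
  qed simp
  then show ?thesis by (simp add: exp_minus field_simps)
qed simp

lemma integral_add_const:
  fixes f :: "real \<Rightarrow> real"
  assumes "f integrable_on {a..b}" "a \<le> b"
  shows "integral {a..b} (\<lambda>x. f x + c) = integral {a..b} f + (b - a) * c"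
  using has_integral_add[OF integrable_integral[OF assms(1)] has_integral_const_real[of c a b]] assms(2)
  by (intro integral_unique) simp

lemma L2_norm_on_mono:
  assumes "in_L2 S f" "in_L2 S g" "\<And>x. x \<in> S \<Longrightarrow> norm (f x) \<le> norm (g x)"
  shows "L2_norm_on S f \<le> L2_norm_on S g"
  unfolding L2_norm_on_def using assms
  by (intro real_sqrt_le_mono integral_mono) (auto simp: in_L2_def intro!: power_mono)

lemma square_sum4_le: "(a + b + c + d)\<^sup>2 \<le> 4 * (a\<^sup>2 + b\<^sup>2 + c\<^sup>2 + (d::real)\<^sup>2)"
proof -
  have "0 \<le> (a - b)\<^sup>2 + (a - c)\<^sup>2 + (a - d)\<^sup>2 + (b - c)\<^sup>2 + (b - d)\<^sup>2 + (c - d)\<^sup>2" by simp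
  then show ?thesis by (simp add: power2_eq_square algebra_simps)
qed

lemma L2_inner_le_weighted:
  assumes "in_L2 S f" "in_L2 S g" "\<epsilon> > 0"
  shows "2 * (\<integral>x. f x \<bullet> g x \<partial>lebesgue_on S) \<le> \<epsilon> * (L2_norm_on S f)\<^sup>2 + 1 / \<epsilon> * (L2_norm_on S g)\<^sup>2"
proof -
  have "2 * (\<integral>x. f x \<bullet> g x \<partial>lebesgue_on S) \<le> 2 * (L2_norm_on S f \<bullet> L2_norm_on S g)"
    using L2_Cauchy_Schwarz[OF assms(1,2)] by simp
  also have "\<dots> \<le> 2 * (\<epsilon> / 2 * (L2_norm_on S f)\<^sup>2 + 1 / (2 * \<epsilon>) * (L2_norm_on S g)\<^sup>2)"
    using abs_inner_le_weighted[OF assms(3), of "L2_norm_on S f" "L2_norm_on S g"] by simp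
  also have "\<dots> = \<epsilon> * (L2_norm_on S f)\<^sup>2 + 1 / \<epsilon> * (L2_norm_on S g)\<^sup>2" by (simp add: distrib_left)
  finally show ?thesis .
qed

lemma L2_norm_diff_square:
  assumes "in_L2 S f" "in_L2 S g"
  shows "(L2_norm_on S (\<lambda>x. f x - g x))\<^sup>2
    = (L2_norm_on S f)\<^sup>2 - 2 * (\<integral>x. f x \<bullet> g x \<partial>lebesgue_on S) + (L2_norm_on S g)\<^sup>2"
proof -
  have "(norm (f x - g x))\<^sup>2 = (norm (f x))\<^sup>2 - 2 * (f x \<bullet> g x) + (norm (g x))\<^sup>2" for x
    by (simp add: power2_norm_eq_inner inner_diff_left inner_diff_right inner_commute)
  then show ?thesis
    unfolding L2_norm_on_power2 using assms in_L2_inner_integrable[OF assms] by (simp add: in_L2_def)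
qed

lemma lebesgue_on_Icc_integral:
  fixes f :: "real \<Rightarrow> real"
  assumes "integrable (lebesgue_on {0..T}) f" "0 \<le> a" "b \<le> T"
  shows "(\<integral>x. f x \<partial>lebesgue_on {a..b}) = integral {a..b} f" "f integrable_on {a..b}"
  using integrable_lebesgue_on_subset[OF assms]
  by (auto intro: lebesgue_integral_eq_integral integrable_on_lebesgue_on)

lemma integrable_lebesgue_on_bound:
  fixes f g :: "real \<Rightarrow> real"
  assumes "f \<in> borel_measurable (lebesgue_on {0..})" "integrable (lebesgue_on {0..T}) g"
    and "AE t in lebesgue_on {0..}. \<bar>f t\<bar> \<le> g t"
  shows "integrable (lebesgue_on {0..T}) f"
proof (rule Bochner_Integration.integrable_bound[OF assms(2)])
  show "f \<in> borel_measurable (lebesgue_on {0..T})"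
    by (rule measurable_lebesgue_on_mono[OF assms(1)]) auto
  have "AE t in lebesgue_on {0..T}. \<bar>f t\<bar> \<le> g t"
    by (rule AE_lebesgue_on_mono[OF assms(3)]) auto
  then show "AE t in lebesgue_on {0..T}. norm (f t) \<le> norm (g t)" by eventually_elim simp
qed

text \<open>Pointwise the tensor square of \<open>v + b\<close> is at most twice the sum of the
  squared norms of \<open>v\<close> and \<open>b\<close>, and Ladyzhenskaya's inequality handles the
  first. For \<open>v\<close> bounded in L2 the bound is affine in the norm of the gradient, hence
  square integrable over finite times.\<close>

lemma L2_convection_flux_le:
  assumes H: "H10_with_grad (ball 0 R) v g" and T: "in_L2 (ball 0 R) (\<lambda>x. tensor (v x + solid_body \<omega> x) (v x + solid_body \<omega> x))"
  shows "L2_norm_on (ball 0 R) (\<lambda>x. tensor (v x + solid_body \<omega> x) (v x + solid_body \<omega> x))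
    \<le> 4 * (L2_norm_on (ball 0 R) v * L2_norm_on (ball 0 R) g) + 2 * L2_norm_on (ball 0 R) (\<lambda>x. (norm (solid_body \<omega> x))\<^sup>2)"
proof -
  let ?B = "ball (0::real^2) R" and ?b = "solid_body \<omega>"
  have v2: "in_L2 ?B (\<lambda>x. (norm (v x))\<^sup>2)" by (rule Ladyzhenskaya_H10(1)[OF H])
  have b2: "in_L2 ?B (\<lambda>x. (norm (?b x))\<^sup>2)"
    by (intro in_L2_continuous continuous_intros smooth_continuous smooth_solid_body)
  have "L2_norm_on ?B (\<lambda>x. tensor (v x + ?b x) (v x + ?b x)) \<le> L2_norm_on ?B (\<lambda>x. 2 *\<^sub>R (norm (v x))\<^sup>2 + 2 *\<^sub>R (norm (?b x))\<^sup>2)"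
  proof (rule L2_norm_on_mono[OF T])
    show "in_L2 ?B (\<lambda>x. 2 *\<^sub>R (norm (v x))\<^sup>2 + 2 *\<^sub>R (norm (?b x))\<^sup>2)" by (intro in_L2_add in_L2_scaleR v2 b2)
    show "norm (tensor (v x + ?b x) (v x + ?b x)) \<le> norm (2 *\<^sub>R (norm (v x))\<^sup>2 + 2 *\<^sub>R (norm (?b x))\<^sup>2)" for x
      using norm_add_square_le[of "v x" "?b x"] by (simp add: norm_tensor power2_eq_square)
  qed
  also have "\<dots> \<le> L2_norm_on ?B (\<lambda>x. 2 *\<^sub>R (norm (v x))\<^sup>2) + L2_norm_on ?B (\<lambda>x. 2 *\<^sub>R (norm (?b x))\<^sup>2)"
    by (intro L2_triangle in_L2_scaleR v2 b2)
  also have "\<dots> = 2 * L2_norm_on ?B (\<lambda>x. (norm (v x))\<^sup>2) + 2 * L2_norm_on ?B (\<lambda>x. (norm (?b x))\<^sup>2)"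
    by (simp only: L2_norm_on_scaleR abs_numeral)
  finally show ?thesis using Ladyzhenskaya_H10(2)[OF H] by linarith
qed

lemma uniform_continuity_L2:
  fixes \<Gamma> :: "real \<times> (real^2) \<Rightarrow> 'b::euclidean_space"
  assumes c: "continuous_on UNIV \<Gamma>" and eps: "\<epsilon> > 0"
  obtains \<delta> where "\<delta> > 0" "\<And>r \<tau>. r \<in> {0..T} \<Longrightarrow> \<tau> \<in> {0..T} \<Longrightarrow> \<bar>\<tau> - r\<bar> < \<delta> \<Longrightarrow>
    L2_norm_on (ball 0 R) (\<lambda>x. \<Gamma> (\<tau>, x) - \<Gamma> (r, x)) \<le> \<epsilon>"
proof -
  let ?m = "sqrt (measure lebesgue (ball (0::real^2) R))"
  \<comment> \<open>The 1 in the denominator excludes division by zero for an empty disk.\<close>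
  define \<eta> where "\<eta> = \<epsilon> / (1 + ?m)"
  have m: "?m \<ge> 0" by simp
  have eta: "\<eta> > 0" using eps m by (simp add: \<eta>_def add_pos_nonneg)
  have "uniformly_continuous_on ({0..T} \<times> cball 0 R) \<Gamma>"
    by (intro compact_uniformly_continuous compact_Times continuous_on_subset[OF c]) auto
  then obtain \<delta> where d: "\<delta> > 0" "\<And>z z'. z \<in> {0..T} \<times> cball 0 R \<Longrightarrow> z' \<in> {0..T} \<times> cball 0 R \<Longrightarrow> dist z' z < \<delta> \<Longrightarrow> dist (\<Gamma> z') (\<Gamma> z) < \<eta>"
    using eta unfolding uniformly_continuous_on_def by metis
  have s: "continuous_on UNIV (\<lambda>x. \<Gamma> (r, x))" for r
    by (rule continuous_on_compose2[OF c]) (auto intro!: continuous_intros)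
  show thesis
  proof (rule that[OF d(1)])
    fix r \<tau> assume h: "r \<in> {0..T}" "\<tau> \<in> {0..T}" "\<bar>\<tau> - r\<bar> < \<delta>"
    have "L2_norm_on (ball 0 R) (\<lambda>x. \<Gamma> (\<tau>, x) - \<Gamma> (r, x)) \<le> \<eta> * ?m"
    proof (rule L2_norm_on_bounded)
      show "(\<lambda>x. \<Gamma> (\<tau>, x) - \<Gamma> (r, x)) \<in> borel_measurable (lebesgue_on (ball 0 R))"
        by (intro borel_measurable_lebesgue_on_continuous continuous_on_diff s)
      show "norm (\<Gamma> (\<tau>, x) - \<Gamma> (r, x)) \<le> \<eta>" if "x \<in> ball 0 R" for x
      proof -
        have "dist (\<tau>, x) (r, x) < \<delta>" using h(3) by (simp add: dist_Pair_Pair dist_real_def)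
        then have "dist (\<Gamma> (\<tau>, x)) (\<Gamma> (r, x)) < \<eta>" using d(2)[of "(r, x)" "(\<tau>, x)"] h that by auto
        then show ?thesis by (simp add: dist_norm)
      qed
    qed (use eta in simp)
    also have "\<eta> * ?m \<le> \<eta> * (1 + ?m)" using eta by (intro mult_left_mono) auto
    also have "\<eta> * (1 + ?m) = \<epsilon>" using m by (simp add: \<eta>_def add_nonneg_eq_0_iff)
    finally show "L2_norm_on (ball 0 R) (\<lambda>x. \<Gamma> (\<tau>, x) - \<Gamma> (r, x)) \<le> \<epsilon>" .
  qed
qed

text \<open>The solution itself is not an admissible test function, but by density the weak
  formulation can be tested with \<open>v(\<tau>)\<close> for almost every \<open>\<tau>\<close>. Together with
  \<open>\<bar>v(\<tau>)\<bar>\<^sup>2 - \<bar>v(\<sigma>)\<bar>\<^sup>2 \<le> 2 \<langle>v(\<tau>) - v(\<sigma>), v(\<tau>)\<rangle>\<close> this bounds the increments of the energy.\<close>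

theorem leray_hopf_energy:
  assumes R: "R > 0" and nu: "\<nu> > 0"
    and LH: "leray_hopf_solution R \<omega> \<nu> u\<^sub>0 u" and st: "0 \<le> s" "s < t"
  defines "y \<equiv> \<lambda>t. (L2_norm_on (ball 0 R) (\<lambda>x. u t x - solid_body \<omega> x))\<^sup>2"
  shows "y integrable_on {s..t}" and "y t + 2 * \<nu> * disk_eigenvalue R * integral {s..t} y \<le> y s"
    and "y 0 \<le> (L2_norm_on (ball 0 R) (\<lambda>x. u\<^sub>0 x - solid_body \<omega> x))\<^sup>2"
proof -
  let ?B = "ball (0::real^2) R" and ?M = "lebesgue_on (ball (0::real^2) R)" and ?N = "L2_norm_on (ball (0::real^2) R)"
  let ?S = "{0::real..} \<times> ball (0::real^2) R"
  define b where "b = solid_body \<omega>"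
  define v where "v t x = u t x - b x" for t x
  define v0 where "v0 x = u\<^sub>0 x - b x" for x
  note LH' = LH[unfolded leray_hopf_solution_def Let_def, folded b_def, folded v_def v0_def]
  from LH' have vm: "(\<lambda>(t, x). v t x) \<in> borel_measurable (lebesgue_on ?S)"
    and v2: "\<And>t. t \<ge> 0 \<Longrightarrow> in_L2 ?B (v t)"
    and vc: "\<And>g. in_L2 ?B g \<Longrightarrow> continuous_on {0..} (\<lambda>t. \<integral>x. v t x \<bullet> g x \<partial>?M)"
    and vd: "\<And>t. t \<ge> 0 \<Longrightarrow> div_free_distr ?B (v t)"
    by blast+
  from LH' obtain G :: "real \<Rightarrow> real^2 \<Rightarrow> real^2^2" where
        Gm: "(\<lambda>(t, x). G t x) \<in> borel_measurable (lebesgue_on ?S)"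
    and GH: "AE t in lebesgue_on {0..}. H10_with_grad ?B (v t) (G t)"
    and Gi: "\<And>T. T > 0 \<Longrightarrow> integrable (lebesgue_on {0..T}) (\<lambda>t. (?N (G t))\<^sup>2)"
    and weak: "\<And>\<phi> t. test_function ?B \<phi> \<Longrightarrow> (\<forall>x. divergence \<phi> x = 0) \<Longrightarrow> t \<ge> 0 \<Longrightarrow>
       (\<integral>x. v t x \<bullet> \<phi> x \<partial>?M) = (\<integral>x. v0 x \<bullet> \<phi> x \<partial>?M) +
         (\<integral>s. (\<integral>x. tensor (u s x) (u s x) \<bullet> grad \<phi> x - \<nu> * (G s x \<bullet> grad \<phi> x) \<partial>?M) \<partial>lebesgue_on {0..t})"
    and energy: "\<And>t. t \<ge> 0 \<Longrightarrow> (?N (v t))\<^sup>2 / 2 + \<nu> * (\<integral>s. (?N (G s))\<^sup>2 \<partial>lebesgue_on {0..t}) \<le> (?N v0)\<^sup>2 / 2"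
    by (elim conjE exE) blast
  have y_def: "y t = (?N (v t))\<^sup>2" for t by (simp add: assms(6) v_def[abs_def] b_def)
  define D where "D t = (?N (G t))\<^sup>2" for t
  \<comment> \<open>The total flux, convective minus viscous: in integrated form, the weak
    formulation says that the pairing of \<open>v\<close> with \<open>\<phi>\<close> has time
    derivative \<open>K \<phi>\<close>.\<close>
  define hh where "hh t x = tensor (u t x) (u t x) - \<nu> *\<^sub>R G t x" for t x
  define \<alpha> where "\<alpha> t = (?N (hh t))\<^sup>2" for t
  define K where "K \<phi> r = (\<integral>x. hh r x \<bullet> grad \<phi> x \<partial>?M)" for \<phi> r
  \<comment> \<open>Dropping the dissipation bounds the energy at every time, not only almost every
    one. Through the convection estimate this makes the flux square integrable in
    space-time.\<close>
  have yE: "y t \<le> (?N v0)\<^sup>2" if "t \<ge> 0" for t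
  proof -
    have "0 \<le> \<nu> * (\<integral>s. (?N (G s))\<^sup>2 \<partial>lebesgue_on {0..t})"
      using nu by (intro mult_nonneg_nonneg integral_nonneg_AE) auto
    then show ?thesis using energy[OF that] unfolding y_def by linarith
  qed
  have uv: "u t x = v t x + b x" for t x by (simp add: v_def)
  have bc: "continuous_on UNIV b" unfolding b_def by (rule smooth_continuous[OF smooth_solid_body])
  have tc: "continuous_on UNIV (\<lambda>w. tensor w w)"
    by (intro bounded_bilinear.continuous_on[OF bounded_bilinear_tensor] continuous_intros)
  have goodH: "in_L2 ?B (G t)" "in_L2 ?B (hh t)" if "H10_with_grad ?B (v t) (G t)" "t \<ge> 0" for t
  proof -
    show "in_L2 ?B (G t)" using that by (simp add: H10_with_grad_def)
    then show "in_L2 ?B (hh t)"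
      unfolding hh_def[abs_def] uv b_def
      by (intro in_L2_diff in_L2_scaleR convection_H10(1)[OF R that(1) vd[OF that(2)]])
  qed
  have good\<alpha>: "\<alpha> t \<le> 2 * (4 * ?N v0 + \<nu>)\<^sup>2 * D t + 8 * (?N (\<lambda>x. (norm (b x))\<^sup>2))\<^sup>2"
    if g: "H10_with_grad ?B (v t) (G t)" "t \<ge> 0" for t
  proof -
    have T: "in_L2 ?B (\<lambda>x. tensor (v t x + b x) (v t x + b x))"
      unfolding b_def by (rule convection_H10(1)[OF R g(1) vd[OF g(2)]])
    have GL: "in_L2 ?B (G t)" by (rule goodH(1)[OF g])
    have "?N (hh t) \<le> ?N (\<lambda>x. tensor (v t x + b x) (v t x + b x)) + ?N (\<lambda>x. (- \<nu>) *\<^sub>R G t x)"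
      using L2_triangle[OF T in_L2_scaleR[OF GL], of "- \<nu>"] by (simp add: hh_def[abs_def] uv)
    also have "?N (\<lambda>x. (- \<nu>) *\<^sub>R G t x) = \<nu> * ?N (G t)" unfolding L2_norm_on_scaleR using nu by simp
    also have "?N (\<lambda>x. tensor (v t x + b x) (v t x + b x)) \<le> 4 * (?N (v t) * ?N (G t)) + 2 * ?N (\<lambda>x. (norm (b x))\<^sup>2)"
      using L2_convection_flux_le[OF g(1)] T unfolding b_def by blast
    also have "?N (v t) \<le> ?N v0"
      using yE[OF g(2)] unfolding y_def by (rule power2_le_imp_le) simp
    finally have "?N (hh t) \<le> (4 * ?N v0 + \<nu>) * ?N (G t) + 2 * ?N (\<lambda>x. (norm (b x))\<^sup>2)"
      by (simp add: algebra_simps mult_right_mono)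
    then have "\<alpha> t \<le> ((4 * ?N v0 + \<nu>) * ?N (G t) + 2 * ?N (\<lambda>x. (norm (b x))\<^sup>2))\<^sup>2"
      unfolding \<alpha>_def by (intro power_mono) auto
    also have "\<dots> \<le> 2 * ((4 * ?N v0 + \<nu>) * ?N (G t))\<^sup>2 + 2 * (2 * ?N (\<lambda>x. (norm (b x))\<^sup>2))\<^sup>2"
      using norm_add_square_le[of "(4 * ?N v0 + \<nu>) * ?N (G t)" "2 * ?N (\<lambda>x. (norm (b x))\<^sup>2)"] by simp
    finally show ?thesis by (simp add: D_def power_mult_distrib)
  qed
  have hm: "(\<lambda>(t, x). hh t x) \<in> borel_measurable (lebesgue_on ?S)"
  proof -
    have "continuous_on UNIV (\<lambda>z::real \<times> (real^2). b (snd z))"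
      by (rule continuous_on_compose2[OF bc]) (auto intro!: continuous_intros)
    then have "(\<lambda>z. (case z of (t, x) \<Rightarrow> v t x) + b (snd z)) \<in> borel_measurable (lebesgue_on ?S)"
      by (intro borel_measurable_add vm borel_measurable_lebesgue_on_continuous)
    from measurable_compose[OF this borel_measurable_continuous_onI[OF tc]]
    have "(\<lambda>z. tensor ((case z of (t, x) \<Rightarrow> v t x) + b (snd z)) ((case z of (t, x) \<Rightarrow> v t x) + b (snd z))
        - \<nu> *\<^sub>R (case z of (t, x) \<Rightarrow> G t x)) \<in> borel_measurable (lebesgue_on ?S)"
      using Gm by (intro borel_measurable_diff borel_measurable_scaleR) auto
    also have "(\<lambda>z. tensor ((case z of (t, x) \<Rightarrow> v t x) + b (snd z)) ((case z of (t, x) \<Rightarrow> v t x) + b (snd z))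
        - \<nu> *\<^sub>R (case z of (t, x) \<Rightarrow> G t x)) = (\<lambda>(t, x). hh t x)"
      by (auto simp: hh_def uv)
    finally show ?thesis .
  qed
  have AEgood: "AE t in lebesgue_on {0..}. H10_with_grad ?B (v t) (G t) \<and> t \<ge> 0"
    using GH AE_space[of "lebesgue_on {0::real..}"] by eventually_elim simp
  have norm_meas: "(\<lambda>t. (?N (F t))\<^sup>2) \<in> borel_measurable (lebesgue_on {0..})"
    if F: "(\<lambda>(t, x). F t x) \<in> borel_measurable (lebesgue_on ?S)"
      and sec: "\<And>t. H10_with_grad ?B (v t) (G t) \<Longrightarrow> t \<ge> 0 \<Longrightarrow> in_L2 ?B (F t)" for F :: "real \<Rightarrow> real^2 \<Rightarrow> 'z::euclidean_space"
  proof -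
    have "(\<lambda>z. (norm (case z of (t, x) \<Rightarrow> F t x))\<^sup>2) \<in> borel_measurable (lebesgue_on ?S)" using F by measurable
    also have "(\<lambda>z. (norm (case z of (t, x) \<Rightarrow> F t x))\<^sup>2) = (\<lambda>(t, x). (norm (F t x))\<^sup>2)" by auto
    finally have m: "(\<lambda>(t, x). (norm (F t x))\<^sup>2) \<in> borel_measurable (lebesgue_on ?S)" .
    show ?thesis unfolding L2_norm_on_power2
    proof (rule measurable_section_integral[OF m], rule eventually_mono[OF AEgood])
      fix t assume "H10_with_grad ?B (v t) (G t) \<and> t \<ge> 0"
      then have "integrable ?M (\<lambda>x. (norm (F t x))\<^sup>2)" using sec[of t] by (simp add: in_L2_def)
      then show "(\<lambda>x. (norm (F t x))\<^sup>2) \<in> borel_measurable ?M" by (rule borel_measurable_integrable)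
    qed
  qed
  have \<alpha>m: "\<alpha> \<in> borel_measurable (lebesgue_on {0..})"
    unfolding \<alpha>_def[abs_def] by (rule norm_meas[OF hm goodH(2)])
  have ym: "y \<in> borel_measurable (lebesgue_on {0..})"
    unfolding y_def[THEN ext] by (rule norm_meas[OF vm v2])
  have Km: "K \<phi> \<in> borel_measurable (lebesgue_on {0..})" if p: "smooth \<phi>" for \<phi>
  proof -
    have gc: "continuous_on UNIV (\<lambda>z::real \<times> (real^2). grad \<phi> (snd z))"
      by (rule continuous_on_compose2[OF smooth_grad[OF p, of UNIV]]) (auto intro!: continuous_intros)
    have "(\<lambda>z. (case z of (t, x) \<Rightarrow> hh t x) \<bullet> grad \<phi> (snd z)) \<in> borel_measurable (lebesgue_on ?S)"
      by (rule borel_measurable_inner[OF hm borel_measurable_lebesgue_on_continuous[OF gc]])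
    also have "(\<lambda>z. (case z of (t, x) \<Rightarrow> hh t x) \<bullet> grad \<phi> (snd z)) = (\<lambda>(t, x). hh t x \<bullet> grad \<phi> x)" by auto
    finally have m: "(\<lambda>(t, x). hh t x \<bullet> grad \<phi> x) \<in> borel_measurable (lebesgue_on ?S)" .
    show ?thesis unfolding K_def[abs_def]
    proof (rule measurable_section_integral[OF m], rule eventually_mono[OF AEgood])
      fix t assume "H10_with_grad ?B (v t) (G t) \<and> t \<ge> 0"
      then have "in_L2 ?B (hh t)" using goodH(2) by blast
      then show "(\<lambda>x. hh t x \<bullet> grad \<phi> x) \<in> borel_measurable ?M"
        by (intro borel_measurable_integrable in_L2_inner_integrable in_L2_grad p)
    qed
  qed
  \<comment> \<open>One unit of room for the averages to the right of \<open>t\<close>.\<close>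
  define T where "T = t + 1"
  have T: "T > 0" "t < T" using st by (simp_all add: T_def)
  have const_i: "integrable (lebesgue_on {0..T}) (\<lambda>t. c)" for c :: real
    by (intro finite_measure.integrable_const finite_measure_lebesgue_on) simp
  have Di: "integrable (lebesgue_on {0..T}) D" using Gi[OF T(1)] by (simp add: D_def[abs_def])
  have \<alpha>i: "integrable (lebesgue_on {0..T}) \<alpha>"
  proof (rule integrable_lebesgue_on_bound[OF \<alpha>m])
    show "integrable (lebesgue_on {0..T}) (\<lambda>t. 2 * (4 * ?N v0 + \<nu>)\<^sup>2 * D t + 8 * (?N (\<lambda>x. (norm (b x))\<^sup>2))\<^sup>2)"
      by (intro Bochner_Integration.integrable_add integrable_mult_right Di const_i)
    show "AE t in lebesgue_on {0..}. \<bar>\<alpha> t\<bar> \<le> 2 * (4 * ?N v0 + \<nu>)\<^sup>2 * D t + 8 * (?N (\<lambda>x. (norm (b x))\<^sup>2))\<^sup>2"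
      using AEgood
    proof eventually_elim
      case (elim t)
      have "\<alpha> t \<ge> 0" by (simp add: \<alpha>_def)
      then show ?case using good\<alpha>[of t] elim by simp
    qed
  qed
  have yi: "integrable (lebesgue_on {0..T}) y"
  proof (rule integrable_lebesgue_on_bound[OF ym const_i])
    show "AE t in lebesgue_on {0..}. \<bar>y t\<bar> \<le> (?N v0)\<^sup>2"
      using AEgood
    proof eventually_elim
      case (elim t)
      have "y t \<ge> 0" by (simp add: y_def)
      then show ?case using yE[of t] elim by simp
    qed
  qed
  have Ki: "integrable (lebesgue_on {0..T}) (K \<phi>)" if p: "smooth \<phi>" for \<phi>
  proof (rule integrable_lebesgue_on_bound[OF Km[OF p]])
    show "integrable (lebesgue_on {0..T}) (\<lambda>r. \<alpha> r + (?N (grad \<phi>))\<^sup>2)"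
      by (intro Bochner_Integration.integrable_add \<alpha>i const_i)
    show "AE r in lebesgue_on {0..}. \<bar>K \<phi> r\<bar> \<le> \<alpha> r + (?N (grad \<phi>))\<^sup>2"
      using AEgood
    proof eventually_elim
      case (elim r)
      have "\<bar>K \<phi> r\<bar> \<le> ?N (hh r) * ?N (grad \<phi>)"
        unfolding K_def using elim goodH(2)[of r] by (intro L2_Cauchy_Schwarz in_L2_grad p) auto
      also have "\<dots> \<le> (?N (hh r))\<^sup>2 + (?N (grad \<phi>))\<^sup>2"
      proof -
        have "?N (hh r) * ?N (grad \<phi>) \<ge> 0" by simp
        then show ?thesis using sum_squares_bound[of "?N (hh r)" "?N (grad \<phi>)"] by linarith
      qed
      finally show ?case by (simp add: \<alpha>_def)
    qed
  qed
  note hk = lebesgue_on_Icc_integral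

  \<comment> \<open>Testing the weak formulation with the solution at a fixed time\<close>
  have "AE r in lebesgue. r \<in> {0..} \<longrightarrow> (H10_with_grad ?B (v r) (G r) \<and> r \<ge> 0)"
    using AEgood by (simp add: AE_restrict_space_iff)
  \<comment> \<open>Outside \<open>N\<close> every nonnegative time is one at which
    \<open>v r\<close> lies in \<open>H10\<close> with gradient \<open>G r\<close>.\<close>
  then obtain N where N0: "N \<in> null_sets lebesgue" "{r. \<not> (r \<in> {0..} \<longrightarrow> (H10_with_grad ?B (v r) (G r) \<and> r \<ge> 0))} \<subseteq> N"
    by (auto simp: eventually_ae_filter)
  then have N: "negligible N" "\<And>r. r \<ge> 0 \<Longrightarrow> r \<notin> N \<Longrightarrow> H10_with_grad ?B (v r) (G r)"
    by (auto simp: negligible_iff_null_sets)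
  have incr: "(\<integral>x. v \<tau> x \<bullet> \<phi> x \<partial>?M) - (\<integral>x. v \<sigma> x \<bullet> \<phi> x \<partial>?M) = integral {\<sigma>..\<tau>} (K \<phi>)"
    if p: "test_function ?B \<phi>" "\<And>x. divergence \<phi> x = 0" and o: "0 \<le> \<sigma>" "\<sigma> \<le> \<tau>" "\<tau> \<le> T" for \<phi> \<sigma> \<tau>
  proof -
    have sm: "smooth \<phi>" by (rule test_function_smooth[OF p(1)])
    have w: "(\<integral>x. v \<tau> x \<bullet> \<phi> x \<partial>?M) = (\<integral>x. v0 x \<bullet> \<phi> x \<partial>?M) + integral {0..\<tau>} (K \<phi>)" if "0 \<le> \<tau>" "\<tau> \<le> T" for \<tau>
    proof -
      have "K \<phi> = (\<lambda>s. \<integral>x. tensor (u s x) (u s x) \<bullet> grad \<phi> x - \<nu> * (G s x \<bullet> grad \<phi> x) \<partial>?M)"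
        by (simp add: K_def[abs_def] hh_def inner_diff_left)
      then show ?thesis using weak[OF p(1) _ that(1)] p(2) hk(1)[OF Ki[OF sm], of 0 \<tau>] that by simp
    qed
    have "integral {0..\<sigma>} (K \<phi>) + integral {\<sigma>..\<tau>} (K \<phi>) = integral {0..\<tau>} (K \<phi>)"
      using o hk(2)[OF Ki[OF sm], of 0 \<tau>] by (intro Henstock_Kurzweil_Integration.integral_combine) auto
    then show ?thesis using w[of \<tau>] w[of \<sigma>] o by simp
  qed
  \<comment> \<open>\<open>Q\<close> bounds
    \<open>2 * integral {\<sigma>..\<tau>} (K \<phi>)\<close> in terms of the distance of
    \<open>grad \<phi>\<close> from \<open>G \<tau>\<close> and of the norm of
    \<open>grad \<phi>\<close>. Along solenoidal approximations of \<open>v \<tau>\<close> these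
    tend to 0 and to the norm of \<open>G \<tau>\<close>, and the bound tends to \<open>L\<close>.
    It serves twice: crudely at the left end \<open>s\<close>, sharply for short steps.\<close>
  have incr_le: "y \<tau> - y \<sigma> \<le> L"
    if tau: "\<tau> \<notin> N" and o: "0 \<le> \<sigma>" "\<sigma> \<le> \<tau>" "\<tau> \<le> T"
      and q: "\<And>\<phi>. smooth \<phi> \<Longrightarrow> 2 * integral {\<sigma>..\<tau>} (K \<phi>) \<le> Q (?N (\<lambda>x. grad \<phi> x - G \<tau> x)) (?N (grad \<phi>))"
      and ql: "\<And>a b. a \<longlonglongrightarrow> 0 \<Longrightarrow> b \<longlonglongrightarrow> ?N (G \<tau>) \<Longrightarrow> (\<lambda>n. Q (a n) (b n)) \<longlonglongrightarrow> L" for \<tau> \<sigma> L Q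
  proof -
    have t0: "\<tau> \<ge> 0" using o by simp
    have H: "H10_with_grad ?B (v \<tau>) (G \<tau>)" by (rule N(2)[OF t0 tau])
    obtain \<psi> where p: "\<And>n::nat. test_function ?B (\<psi> n)" "\<And>n x. divergence (\<psi> n) x = 0"
      "(\<lambda>n. ?N (\<lambda>x. \<psi> n x - v \<tau> x)) \<longlonglongrightarrow> 0" "(\<lambda>n. ?N (\<lambda>x. grad (\<psi> n) x - G \<tau> x)) \<longlonglongrightarrow> 0"
      by (rule solenoidal_test_functions_dense[OF R H vd[OF t0]]) blast
    have sm: "smooth (\<psi> n)" for n by (rule test_function_smooth[OF p(1)])
    have L2: "in_L2 ?B (\<psi> n)" "in_L2 ?B (grad (\<psi> n))" for n by (intro in_L2_smooth in_L2_grad sm)+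
    have lim: "(\<lambda>n. 2 * ((\<integral>x. v \<tau> x \<bullet> \<psi> n x \<partial>?M) - (\<integral>x. v \<sigma> x \<bullet> \<psi> n x \<partial>?M)))
        \<longlonglongrightarrow> 2 * ((\<integral>x. v \<tau> x \<bullet> v \<tau> x \<partial>?M) - (\<integral>x. v \<sigma> x \<bullet> v \<tau> x \<partial>?M))"
      using t0 o by (intro tendsto_intros L2_tendsto_inner L2 v2 p) auto
    have "(\<lambda>n. Q (?N (\<lambda>x. grad (\<psi> n) x - G \<tau> x)) (?N (grad (\<psi> n)))) \<longlonglongrightarrow> L"
      by (rule ql[OF p(4) L2_tendsto_norm[OF L2(2) goodH(1)[OF H t0] p(4)]])
    then have "2 * ((\<integral>x. v \<tau> x \<bullet> v \<tau> x \<partial>?M) - (\<integral>x. v \<sigma> x \<bullet> v \<tau> x \<partial>?M)) \<le> L"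
      by (rule LIMSEQ_le[OF lim]) (use q[OF sm] incr[OF p(1,2) o] in auto)
    moreover have "0 \<le> (?N (\<lambda>x. v \<sigma> x - v \<tau> x))\<^sup>2" by simp
    moreover have "y \<tau> = (\<integral>x. v \<tau> x \<bullet> v \<tau> x \<partial>?M)" unfolding y_def L2_norm_on_power2 by (simp add: power2_norm_eq_inner)
    ultimately show ?thesis
      using L2_norm_diff_square[OF v2[OF o(1)] v2[OF t0]] by (simp add: y_def)
  qed

  \<comment> \<open>The hypotheses of the averaging argument\<close>
  have "y t + 2 * \<nu> * integral {s..t} D \<le> y s"
  proof (rule energy_from_increments[OF st T(2) _ _ _ _ _ N(1)])
    show "y integrable_on {0..T}" "D integrable_on {0..T}" "\<alpha> integrable_on {0..T}"
      using hk(2)[of T _ 0 T] yi Di \<alpha>i by auto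
    show "0 \<le> \<alpha> r" "0 \<le> D r" for r by (simp_all add: \<alpha>_def D_def)
  next
    fix \<tau> assume tau: "\<tau> \<in> {s..T} - N"
    then have o: "\<tau> \<notin> N" "0 \<le> s" "s \<le> \<tau>" "\<tau> \<le> T" using st by auto
    have ai: "\<alpha> integrable_on {s..\<tau>}" using hk(2)[OF \<alpha>i, of s \<tau>] o by simp
    show "y \<tau> - y s \<le> integral {s..\<tau>} \<alpha> + (\<tau> - s) * D \<tau>"
    \<comment> \<open>Young's inequality with weight 1 is enough here: smallness will come from the
      shrinking interval alone.\<close>
    proof (rule incr_le[of \<tau> s "\<lambda>a b. integral {s..\<tau>} \<alpha> + (\<tau> - s) * b\<^sup>2", OF o])
      fix \<phi> :: "real^2 \<Rightarrow> real^2" assume sm: "smooth \<phi>"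
      have "integral {s..\<tau>} (\<lambda>r. 2 * K \<phi> r) \<le> integral {s..\<tau>} (\<lambda>r. \<alpha> r + (?N (grad \<phi>))\<^sup>2)"
      proof (rule integral_le_negligible[OF _ _ N(1)])
        show "(\<lambda>r. 2 * K \<phi> r) integrable_on {s..\<tau>}"
          using hk(2)[OF Ki[OF sm], of s \<tau>] o by (intro integrable_on_mult_right) auto
        show "(\<lambda>r. \<alpha> r + (?N (grad \<phi>))\<^sup>2) integrable_on {s..\<tau>}" by (intro integrable_add ai) auto
        fix r assume r: "r \<in> {s..\<tau>} - N"
        then have "in_L2 ?B (hh r)" using o by (intro goodH(2) N(2)) auto
        from L2_inner_le_weighted[OF this in_L2_grad[OF sm], of 1]
        show "2 * K \<phi> r \<le> \<alpha> r + (?N (grad \<phi>))\<^sup>2" by (simp add: K_def \<alpha>_def)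
      qed
      also have "integral {s..\<tau>} (\<lambda>r. \<alpha> r + (?N (grad \<phi>))\<^sup>2) = integral {s..\<tau>} \<alpha> + (\<tau> - s) * (?N (grad \<phi>))\<^sup>2"
        by (rule integral_add_const[OF ai o(3)])
      finally show "2 * integral {s..\<tau>} (K \<phi>) \<le> integral {s..\<tau>} \<alpha> + (\<tau> - s) * (?N (grad \<phi>))\<^sup>2" by simp
    next
      fix a b' :: "nat \<Rightarrow> real" assume "b' \<longlonglongrightarrow> ?N (G \<tau>)"
      then show "(\<lambda>n. integral {s..\<tau>} \<alpha> + (\<tau> - s) * (b' n)\<^sup>2) \<longlonglongrightarrow> integral {s..\<tau>} \<alpha> + (\<tau> - s) * D \<tau>"
        unfolding D_def by (intro tendsto_intros)
    qed
  next
    have vt: "in_L2 ?B (v t)" using v2 st by simp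
    \<comment> \<open>Expanding the squared norm of \<open>v \<tau> - v t\<close>, which is
      nonnegative, bounds \<open>y \<tau>\<close> below by this function. Weak continuity of
      \<open>v\<close> makes it continuous, although \<open>y\<close> itself need not be, and at
      \<open>t\<close> it equals \<open>y t\<close>.\<close>
    show "continuous_on {t..T} (\<lambda>\<tau>. 2 * (\<integral>x. v \<tau> x \<bullet> v t x \<partial>?M) - y t)"
      using st by (intro continuous_intros continuous_on_subset[OF vc[OF vt]]) auto
    show "2 * (\<integral>x. v t x \<bullet> v t x \<partial>?M) - y t = y t"
      unfolding y_def L2_norm_on_power2 by (simp add: power2_norm_eq_inner)
    show "2 * (\<integral>x. v \<tau> x \<bullet> v t x \<partial>?M) - y t \<le> y \<tau>" if "\<tau> \<in> {t..T}" for \<tau>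
    proof -
      have "0 \<le> (?N (\<lambda>x. v \<tau> x - v t x))\<^sup>2" by simp
      moreover have "in_L2 ?B (v \<tau>)" using v2 st that by simp
      ultimately show ?thesis using L2_norm_diff_square[OF _ vt] by (simp add: y_def)
    qed
  next
    fix \<epsilon> :: real assume eps: "\<epsilon> > 0"
    have GL: "AE t in lebesgue_on {0..}. in_L2 ?B (G t)"
      using AEgood by eventually_elim (simp add: H10_with_grad_def)
    have e2: "\<epsilon>\<^sup>2 > 0" using eps by simp
    obtain \<Gamma> where Gam: "continuous_on UNIV \<Gamma>"
      "integrable (lebesgue_on {0..T}) (\<lambda>t. (?N (\<lambda>x. G t x - \<Gamma> (t, x)))\<^sup>2)"
      "(\<integral>t. (?N (\<lambda>x. G t x - \<Gamma> (t, x)))\<^sup>2 \<partial>lebesgue_on {0..T}) \<le> \<epsilon>\<^sup>2"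
      by (rule space_time_L2_approximation[OF Gm GL Gi[OF T(1)] e2]) blast
    define e where "e t = (?N (\<lambda>x. G t x - \<Gamma> (t, x)))\<^sup>2" for t
    obtain \<delta> where del: "\<delta> > 0" "\<And>r \<tau>. r \<in> {0..T} \<Longrightarrow> \<tau> \<in> {0..T} \<Longrightarrow> \<bar>\<tau> - r\<bar> < \<delta> \<Longrightarrow>
        ?N (\<lambda>x. \<Gamma> (\<tau>, x) - \<Gamma> (r, x)) \<le> \<epsilon>"
      by (rule uniform_continuity_L2[OF Gam(1) eps, where T=T and R=R]) blast
    have GamL: "in_L2 ?B (\<lambda>x. \<Gamma> (r, x))" for r
      by (rule in_L2_continuous, rule continuous_on_compose2[OF Gam(1)]) (auto intro!: continuous_intros)
    have ei: "integrable (lebesgue_on {0..T}) e" using Gam(2) by (simp add: e_def[abs_def])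
    show "\<exists>e \<delta>. e integrable_on {0..T} \<and> (\<forall>r. 0 \<le> e r) \<and> integral {0..T} e \<le> \<epsilon>\<^sup>2 \<and> \<delta> > 0 \<and>
      (\<forall>\<tau>\<in>{0..T} - N. \<forall>h. 0 < h \<longrightarrow> h < \<delta> \<longrightarrow> h \<le> \<tau> \<longrightarrow>
        y \<tau> - y (\<tau> - h) \<le> integral {\<tau> - h..\<tau>} (\<lambda>r. - 2 * \<nu> * D r + \<epsilon> * \<alpha> r + 4 / \<epsilon> * e r) + 4 / \<epsilon> * h * (e \<tau> + \<epsilon>\<^sup>2))"
    proof (intro exI conjI allI impI ballI)
      show "e integrable_on {0..T}" using hk(2)[OF ei] by simp
      show "0 \<le> e r" for r by (simp add: e_def)
      show "integral {0..T} e \<le> \<epsilon>\<^sup>2" using hk(1)[OF ei, of 0 T] Gam(3) by (simp add: e_def[abs_def])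
      show "\<delta> > 0" by fact
      fix \<tau> h assume tau: "\<tau> \<in> {0..T} - N" and h: "0 < h" "h < \<delta>" "h \<le> \<tau>"
      then have o: "\<tau> \<notin> N" "0 \<le> \<tau> - h" "\<tau> - h \<le> \<tau>" "\<tau> \<le> T" by auto
      define p where "p r = - 2 * \<nu> * D r + \<epsilon> * \<alpha> r + 4 / \<epsilon> * e r" for r
      have "integrable (lebesgue_on {0..T}) p" unfolding p_def[abs_def]
        by (intro Bochner_Integration.integrable_add integrable_mult_right Di \<alpha>i ei)
      then have pi: "p integrable_on {\<tau> - h..\<tau>}" using hk(2)[of T p "\<tau> - h" \<tau>] o by simp
      have Gt: "in_L2 ?B (G \<tau>)" using tau by (intro goodH(1) N(2)) auto
      \<comment> \<open>The summand \<open>0\<^sup>2\<close> is the limit of the squared distance of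
        \<open>grad \<phi>\<close> from \<open>G \<tau>\<close> along the approximating test
        functions.\<close>
      have "y \<tau> - y (\<tau> - h) \<le> integral {\<tau> - h..\<tau>} p + h * (4 / \<epsilon> * (0\<^sup>2 + e \<tau> + \<epsilon>\<^sup>2))"
      proof (rule incr_le[of \<tau> "\<tau> - h" "\<lambda>a b. integral {\<tau> - h..\<tau>} p + h * (4 / \<epsilon> * (a\<^sup>2 + e \<tau> + \<epsilon>\<^sup>2))", OF o])
        fix \<phi> :: "real^2 \<Rightarrow> real^2" assume sm: "smooth \<phi>"
        let ?a = "?N (\<lambda>x. grad \<phi> x - G \<tau> x)"
        have pL: "in_L2 ?B (grad \<phi>)" by (rule in_L2_grad[OF sm])
        have "integral {\<tau> - h..\<tau>} (\<lambda>r. 2 * K \<phi> r) \<le> integral {\<tau> - h..\<tau>} (\<lambda>r. p r + 4 / \<epsilon> * (?a\<^sup>2 + e \<tau> + \<epsilon>\<^sup>2))"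
        proof (rule integral_le_negligible[OF _ _ N(1)])
          show "(\<lambda>r. 2 * K \<phi> r) integrable_on {\<tau> - h..\<tau>}"
            using hk(2)[OF Ki[OF sm], of "\<tau> - h" \<tau>] o by (intro integrable_on_mult_right) auto
          show "(\<lambda>r. p r + 4 / \<epsilon> * (?a\<^sup>2 + e \<tau> + \<epsilon>\<^sup>2)) integrable_on {\<tau> - h..\<tau>}"
            by (intro integrable_add pi) auto
          fix r assume r: "r \<in> {\<tau> - h..\<tau>} - N"
          then have r0: "r \<ge> 0" "r \<le> T" "\<bar>\<tau> - r\<bar> < \<delta>" using o h by auto
          have Hr: "H10_with_grad ?B (v r) (G r)" using r r0 by (intro N(2)) auto
          have hr: "in_L2 ?B (hh r)" "in_L2 ?B (G r)" using goodH[OF Hr r0(1)] by auto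
          have "K \<phi> r = (\<integral>x. hh r x \<bullet> G r x \<partial>?M) + (\<integral>x. hh r x \<bullet> (grad \<phi> x - G r x) \<partial>?M)"
            unfolding K_def using in_L2_inner_integrable[OF hr(1) pL] in_L2_inner_integrable[OF hr]
            by (simp add: inner_diff_right)
          \<comment> \<open>The convective part cancels in the pairing with the gradient at the same
            time \<open>r\<close>, which is why \<open>grad \<phi>\<close> is split at
            \<open>G r\<close> rather than at \<open>G \<tau>\<close>.\<close>
          moreover have "(\<integral>x. hh r x \<bullet> G r x \<partial>?M) = - \<nu> * D r"
          proof -
            have T0: "in_L2 ?B (\<lambda>x. tensor (v r x + b x) (v r x + b x))"
              "(\<integral>x. tensor (v r x + b x) (v r x + b x) \<bullet> G r x \<partial>?M) = 0"
              unfolding b_def by (rule convection_H10[OF R Hr vd[OF r0(1)]])+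
            have "(\<integral>x. hh r x \<bullet> G r x \<partial>?M) = (\<integral>x. tensor (v r x + b x) (v r x + b x) \<bullet> G r x - \<nu> * (G r x \<bullet> G r x) \<partial>?M)"
              by (simp add: hh_def uv inner_diff_left)
            also have "\<dots> = - \<nu> * (\<integral>x. G r x \<bullet> G r x \<partial>?M)"
              using in_L2_inner_integrable[OF T0(1) hr(2)] in_L2_inner_integrable[OF hr(2) hr(2)] T0(2) by simp
            finally show ?thesis unfolding D_def L2_norm_on_power2 by (simp add: power2_norm_eq_inner)
          qed
          moreover have "2 * (\<integral>x. hh r x \<bullet> (grad \<phi> x - G r x) \<partial>?M) \<le> \<epsilon> * \<alpha> r + 1 / \<epsilon> * (?N (\<lambda>x. grad \<phi> x - G r x))\<^sup>2"
            using L2_inner_le_weighted[OF hr(1) in_L2_diff[OF pL hr(2)] eps] by (simp add: \<alpha>_def)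
          \<comment> \<open>From \<open>grad \<phi>\<close> to \<open>G r\<close> in four steps,
            through \<open>G \<tau>\<close>, \<open>\<Gamma>\<close> at time \<open>\<tau>\<close>
            and \<open>\<Gamma>\<close> at time \<open>r\<close>. The factor 4 of
            \<open>square_sum4_le\<close> is the origin of \<open>4 / \<epsilon>\<close>.\<close>
          moreover have "1 / \<epsilon> * (?N (\<lambda>x. grad \<phi> x - G r x))\<^sup>2 \<le> 1 / \<epsilon> * (4 * (?a\<^sup>2 + e \<tau> + \<epsilon>\<^sup>2 + e r))"
          proof (intro mult_left_mono)
            have "?N (\<lambda>x. grad \<phi> x - G r x) \<le> ?a + ?N (\<lambda>x. G \<tau> x - G r x)" by (rule L2_triangle_diff[OF pL Gt hr(2)])
            also have "?N (\<lambda>x. G \<tau> x - G r x) \<le> ?N (\<lambda>x. G \<tau> x - \<Gamma> (\<tau>, x)) + ?N (\<lambda>x. \<Gamma> (\<tau>, x) - G r x)"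
              by (rule L2_triangle_diff[OF Gt GamL hr(2)])
            also have "?N (\<lambda>x. \<Gamma> (\<tau>, x) - G r x) \<le> ?N (\<lambda>x. \<Gamma> (\<tau>, x) - \<Gamma> (r, x)) + ?N (\<lambda>x. \<Gamma> (r, x) - G r x)"
              by (rule L2_triangle_diff[OF GamL GamL hr(2)])
            also have "?N (\<lambda>x. \<Gamma> (\<tau>, x) - \<Gamma> (r, x)) \<le> \<epsilon>" using del(2)[of r \<tau>] r0 o by auto
            finally have "?N (\<lambda>x. grad \<phi> x - G r x) \<le> ?a + ?N (\<lambda>x. G \<tau> x - \<Gamma> (\<tau>, x)) + \<epsilon> + ?N (\<lambda>x. \<Gamma> (r, x) - G r x)" by simp
            then have "(?N (\<lambda>x. grad \<phi> x - G r x))\<^sup>2 \<le> (?a + ?N (\<lambda>x. G \<tau> x - \<Gamma> (\<tau>, x)) + \<epsilon> + ?N (\<lambda>x. \<Gamma> (r, x) - G r x))\<^sup>2"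
              by (intro power_mono) auto
            also have "\<dots> \<le> 4 * (?a\<^sup>2 + (?N (\<lambda>x. G \<tau> x - \<Gamma> (\<tau>, x)))\<^sup>2 + \<epsilon>\<^sup>2 + (?N (\<lambda>x. \<Gamma> (r, x) - G r x))\<^sup>2)"
              by (rule square_sum4_le)
            finally show "(?N (\<lambda>x. grad \<phi> x - G r x))\<^sup>2 \<le> 4 * (?a\<^sup>2 + e \<tau> + \<epsilon>\<^sup>2 + e r)"
              unfolding e_def using L2_norm_on_minus[of ?B "\<lambda>x. \<Gamma> (r, x)" "G r"] by simp
          qed (use eps in simp)
          ultimately have "2 * K \<phi> r \<le> - 2 * \<nu> * D r + \<epsilon> * \<alpha> r + 1 / \<epsilon> * (4 * (?a\<^sup>2 + e \<tau> + \<epsilon>\<^sup>2 + e r))"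
            by (simp add: algebra_simps)
          then show "2 * K \<phi> r \<le> p r + 4 / \<epsilon> * (?a\<^sup>2 + e \<tau> + \<epsilon>\<^sup>2)"
            by (simp add: p_def algebra_simps add_divide_distrib)
        qed
        also have "\<dots> = integral {\<tau> - h..\<tau>} p + h * (4 / \<epsilon> * (?a\<^sup>2 + e \<tau> + \<epsilon>\<^sup>2))"
          using integral_add_const[OF pi o(3)] by simp
        finally show "2 * integral {\<tau> - h..\<tau>} (K \<phi>) \<le> integral {\<tau> - h..\<tau>} p + h * (4 / \<epsilon> * (?a\<^sup>2 + e \<tau> + \<epsilon>\<^sup>2))"
          by simp
      next
        fix a b' :: "nat \<Rightarrow> real" assume "a \<longlonglongrightarrow> 0"
        then show "(\<lambda>n. integral {\<tau> - h..\<tau>} p + h * (4 / \<epsilon> * ((a n)\<^sup>2 + e \<tau> + \<epsilon>\<^sup>2)))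
          \<longlonglongrightarrow> integral {\<tau> - h..\<tau>} p + h * (4 / \<epsilon> * (0\<^sup>2 + e \<tau> + \<epsilon>\<^sup>2))"
          by (intro tendsto_intros)
      qed
      then show "y \<tau> - y (\<tau> - h) \<le> integral {\<tau> - h..\<tau>} (\<lambda>r. - 2 * \<nu> * D r + \<epsilon> * \<alpha> r + 4 / \<epsilon> * e r) + 4 / \<epsilon> * h * (e \<tau> + \<epsilon>\<^sup>2)"
        unfolding p_def[abs_def] by (simp add: mult_ac)
    qed
  qed
  moreover have yst: "y integrable_on {s..t}" using hk(2)[OF yi, of s t] st T by simp
  moreover have "disk_eigenvalue R * integral {s..t} y \<le> integral {s..t} D"
  proof -
    have "integral {s..t} (\<lambda>r. disk_eigenvalue R * y r) \<le> integral {s..t} D"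
    proof (rule integral_le_negligible[OF _ _ N(1)])
      show "(\<lambda>r. disk_eigenvalue R * y r) integrable_on {s..t}" by (intro integrable_on_mult_right yst)
      show "D integrable_on {s..t}" using hk(2)[OF Di, of s t] st T by simp
      show "disk_eigenvalue R * y r \<le> D r" if "r \<in> {s..t} - N" for r
        unfolding y_def D_def using that st by (intro Poincare_H10 N(2)) auto
    qed
    then show ?thesis by simp
  qed
  moreover from this have "\<nu> * (disk_eigenvalue R * integral {s..t} y) \<le> \<nu> * integral {s..t} D"
    using nu by (intro mult_left_mono) auto
  ultimately show "y integrable_on {s..t}" "y t + 2 * \<nu> * disk_eigenvalue R * integral {s..t} y \<le> y s"
    by (auto simp: mult.assoc)
  show "y 0 \<le> (?N (\<lambda>x. u\<^sub>0 x - solid_body \<omega> x))\<^sup>2"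
    using yE[of 0] by (simp add: v0_def[abs_def] b_def)
qed

text \<open>The energy is nonincreasing, so its integral over \<open>{s..t'}\<close> is at least
  \<open>(t' - s) * y t'\<close>, and the energy inequality becomes the hypothesis of
  \<open>decay_from_steps\<close>. The factor 2 in the rate belongs to the squared norm. Finally
  \<open>y 0\<close> is compared with the datum by the energy inequality at time 0, as the datum
  need not be attained pointwise.\<close>

lemma leray_hopf_decay:
  assumes R: "R > 0" and nu: "\<nu> > 0" and LH: "leray_hopf_solution R \<omega> \<nu> u\<^sub>0 u" and t: "t \<ge> 0"
  shows "L2_norm_on (ball 0 R) (\<lambda>x. u t x - solid_body \<omega> x)
    \<le> L2_norm_on (ball 0 R) (\<lambda>x. u\<^sub>0 x - solid_body \<omega> x) * exp (- disk_eigenvalue R * \<nu> * t)"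
proof (rule power2_le_imp_le)
  define y where "y t = (L2_norm_on (ball 0 R) (\<lambda>x. u t x - solid_body \<omega> x))\<^sup>2" for t
  note E = leray_hopf_energy[OF R nu LH, folded y_def]
  let ?c = "2 * \<nu> * disk_eigenvalue R"
  have c: "?c \<ge> 0" using nu disk_eigenvalue_pos[OF R] by simp
  have nn: "y t \<ge> 0" for t by (simp add: y_def)
  have mono: "y r' \<le> y r" if "0 \<le> r" "r < r'" for r r'
  proof -
    have "0 \<le> integral {r..r'} y" by (rule integral_nonneg[OF E(1)[OF that]]) (rule nn)
    then have "0 \<le> ?c * integral {r..r'} y" by (rule mult_nonneg_nonneg[OF c])
    then show ?thesis using E(2)[OF that] by simp
  qed
  have "y t' * (1 + ?c * (t' - s)) \<le> y s" if st: "0 \<le> s" "s < t'" for s t'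
  proof -
    have "integral {s..t'} (\<lambda>r. y t') \<le> integral {s..t'} y"
    proof (rule integral_le)
      show "y t' \<le> y r" if "r \<in> {s..t'}" for r using mono[of r t'] that st by (cases "r = t'") auto
    qed (use E(1)[OF st] in auto)
    then have "?c * ((t' - s) * y t') \<le> ?c * integral {s..t'} y"
      using c st by (intro mult_left_mono) auto
    then show ?thesis using E(2)[OF st] by (simp add: algebra_simps)
  qed
  from decay_from_steps[OF c nn this t]
  have "y t \<le> y 0 * exp (- ?c * t)" by simp
  also have "\<dots> \<le> (L2_norm_on (ball 0 R) (\<lambda>x. u\<^sub>0 x - solid_body \<omega> x))\<^sup>2 * exp (- ?c * t)"
    using E(3)[of 0 1] by (intro mult_right_mono) auto
  also have "exp (- ?c * t) = (exp (- disk_eigenvalue R * \<nu> * t))\<^sup>2"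
    by (simp add: power2_eq_square mult_ac flip: exp_add)
  finally show "(L2_norm_on (ball 0 R) (\<lambda>x. u t x - solid_body \<omega> x))\<^sup>2
    \<le> (L2_norm_on (ball 0 R) (\<lambda>x. u\<^sub>0 x - solid_body \<omega> x) * exp (- disk_eigenvalue R * \<nu> * t))\<^sup>2"
    by (simp add: y_def power_mult_distrib)
qed simp

theorem theorem1:
  fixes R \<omega>\<^sub>0 \<nu> :: real
    and u\<^sub>0 :: "real^2 \<Rightarrow> real^2"
    and u :: "real \<Rightarrow> real^2 \<Rightarrow> real^2"
  assumes "R > 0" and "\<nu> > 0"
    and "in_L2 (ball 0 R) u\<^sub>0"
    and "div_free_distr (ball 0 R) u\<^sub>0"
    and "leray_hopf_solution R \<omega>\<^sub>0 \<nu> u\<^sub>0 u"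
  shows "((\<lambda>t. L2_norm_on (ball 0 R) (\<lambda>x. u t x - solid_body \<omega>\<^sub>0 x)) \<longlongrightarrow> 0) at_top
    \<and> (\<forall>x. vorticity (solid_body \<omega>\<^sub>0) x = \<omega>\<^sub>0)
    \<and> (\<forall>t\<ge>0. L2_norm_on (ball 0 R) (\<lambda>x. u t x - solid_body \<omega>\<^sub>0 x)
          \<le> L2_norm_on (ball 0 R) (\<lambda>x. u\<^sub>0 x - solid_body \<omega>\<^sub>0 x)
             * exp (- first_dirichlet_eigenvalue (ball 0 R) * \<nu> * t))"
proof (intro conjI allI impI)
  let ?\<mu> = "disk_eigenvalue R" and ?n = "\<lambda>t. L2_norm_on (ball 0 R) (\<lambda>x. u t x - solid_body \<omega>\<^sub>0 x)"
  let ?C = "L2_norm_on (ball 0 R) (\<lambda>x. u\<^sub>0 x - solid_body \<omega>\<^sub>0 x)"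
  have decay: "?n t \<le> ?C * exp (- ?\<mu> * \<nu> * t)" if "t \<ge> 0" for t
    by (rule leray_hopf_decay[OF assms(1,2,5) that])
  then show "?n t \<le> ?C * exp (- first_dirichlet_eigenvalue (ball 0 R) * \<nu> * t)" if "t \<ge> 0" for t
    using that by (simp add: first_dirichlet_eigenvalue_disk[OF assms(1)])
  show "vorticity (solid_body \<omega>\<^sub>0) x = \<omega>\<^sub>0" for x
    by (simp add: vorticity_def partial_solid_body perp_def axis_def)
  have p: "?\<mu> * \<nu> > 0" using assms(2) disk_eigenvalue_pos[OF assms(1)] by simp
  have "((\<lambda>t. C * exp (- (k * t))) \<longlongrightarrow> 0) at_top" if "k > 0" for C k :: real
    using that by real_asymp
  from this[OF p, of ?C] have lim: "((\<lambda>t. ?C * exp (- ?\<mu> * \<nu> * t)) \<longlongrightarrow> 0) at_top" by simp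
  show "(?n \<longlongrightarrow> 0) at_top"
  proof (rule Lim_null_comparison[OF _ lim])
    show "\<forall>\<^sub>F t in at_top. norm (?n t) \<le> ?C * exp (- ?\<mu> * \<nu> * t)"
      using eventually_ge_at_top[of 0]
    proof eventually_elim
      case (elim t)
      then show ?case using decay[of t] by simp
    qed
  qed
qed

end
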